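(* $\mathsf{Ann}:\mathbf{ba\ell}\to\mathsf{DeV}$ is a covariant functor, and the diagram consisting of $\mathsf{Arch}:\mathbf{ba\ell}\to\mathsf{KRFrm}$, $\mathfrak B:\mathsf{KRFrm}\to\mathsf{DeV}$ and $\mathsf{Ann}:\mathbf{ba\ell}\to\mathsf{DeV}$ commutes, i.e. $\mathsf{Ann}=\mathfrak B\circ\mathsf{Arch}$.
   Context: All algebras are commutative and unital. An $\ell$-algebra is an $\mathbb R$-algebra $A$ that is also a lattice such that: $a\le b$ implies $a+c\le b+c$; $0\le a,b$ implies $0\le ab$; $0\le a$ and $0\le r\in\mathbb R$ imply $0\le ra$. It is bounded if for each $a\in A$ there is an integer $n\ge1$ with $a\le n\cdot 1$; archimedean if whenever $na\le b$ for all integers $n\ge1$, then $a\le0$. $\mathbf{ba\ell}$ is the category of bounded archimedean $\ell$-algebras and unital $\ell$-algebra homomorphisms. With $|a|=a\vee(-a)$, an $\ell$-ideal of $A$ is an ideal $I$ such that $|a|\le|b|$ and $b\in I$ imply $a\in I$; it is archimedean if $A/I$ is archimedean. A frame is a complete lattice $L$ with $a\wedge\bigvee S=\bigvee\{a\wedge s:s\in S\}$; frame homomorphisms preserve finite meets and arbitrary joins. $a^*=\bigvee\{b: a\wedge b=0\}$ is the pseudocomplement, and the well-inside relation is $a\prec b$ iff $a^*\vee b=1$. $L$ is compact if $\bigvee S=1$ implies $\bigvee T=1$ for some finite $T\subseteq S$, and regular if $a=\bigvee\{b: b\prec a\}$ for each $a$. $\mathsf{KRFrm}$ is the category of compact regular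 frames and frame homomorphisms. $\mathsf{Arch}(A)$ is the poset of archimedean $\ell$-ideals of $A$ under inclusion; it is known to be a compact regular frame (meet is intersection, join is the archimedean $\ell$-ideal generated by the union), and $\mathsf{Arch}:\mathbf{ba\ell}\to\mathsf{KRFrm}$ is a functor, where for $\alpha:A\to A'$, $\mathsf{Arch}(\alpha)(I)$ is the archimedean $\ell$-ideal of $A'$ generated by $\alpha[I]$. A de Vries algebra is a complete boolean algebra $B$ with a binary relation $\prec$ such that: (DV1) $1\prec1$; (DV2) $a\prec b$ implies $a\le b$; (DV3) $a\le b\prec c\le d$ implies $a\prec d$; (DV4) $a\prec b,c$ implies $a\prec b\wedge c$; (DV5) $a\prec b$ implies $b^*\prec a^*$; (DV6) $a\prec b$ implies there is $c$ with $a\prec c\prec b$; (DV7) $a\ne0$ implies there is $b\ne0$ with $b\prec a$. A de Vries morphism $\sigma:B\to B'$ satisfies (M1) $\sigma(0)=0$; (M2) $\sigma(a\wedge b)=\sigma(a)\wedge\sigma(b)$; (M3) $a\prec b$ implies $\sigma(a^* )^*\prec\sigma(b)$; (M4) $\sigma(a)=\bigvee\{\sigma(b): b\prec a\}$. $\mathsf{DeV}$ is the category of de Vries algebras and de Vries morphisms with composition $(\sigma_2\star\sigma_1)(a)=\bigvee\{\sigma_2\sigma_1(b): b\prec a\}$. The booleanization $\mathfrak B(L)=\{a\in L: a^{**}=a\}$ of a frame $L$ is a complete boolean algebra; for $L$ compact regular, $\mathfrak B(L)$ with the restriction of the well-inside relation is a de Vries algebra, and with $\mathfrak B(h)(a)=h(a)^{**}$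 for frame homomorphisms $h$, $\mathfrak B:\mathsf{KRFrm}\to\mathsf{DeV}$ is known to be a functor (an equivalence). For $S\subseteq A$, $\mathrm{Ann}_A(S)=\{a\in A: as=0\ \forall s\in S\}$. $\mathsf{Ann}(A)$ is the set of annihilator ideals of $A$ (ideals of the form $\mathrm{Ann}_A(S)$) ordered by inclusion, with the relation $I\prec J$ iff $I^*\vee J=A$, where $I^*$ and $\vee$ are computed in $\mathsf{Arch}(A)$ (annihilator ideals are archimedean $\ell$-ideals). For a morphism $\alpha:A\to A'$, $\mathsf{Ann}(\alpha)(I)=(\mathsf{Arch}(\alpha)(I))^{**}$, with $^*$ computed in $\mathsf{Arch}(A')$. *)

theory Defs
  imports "HOL-Algebra.Algebra" "HOL-Algebra.Algebraic_Closure_Type"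
begin

section \<open>Categories and functors\<close>

text \<open>Arrows are indexed by source and target, so that the same underlying function may occur
  in several hom-sets: \<open>Comp C P Q R g f\<close> is the composite of \<open>f : P \<rightarrow> Q\<close> and \<open>g : Q \<rightarrow> R\<close>.
  In the concrete categories below arrows are functions that are extensional on the carrier of
  their source (value \<open>undefined\<close> elsewhere), so that equality of functions is equality of arrows.
  All objects of a category live on one carrier type, which acts as the universe of sets.\<close>

record ('o, 'm) cat =
  Ob :: "'o set"
  Arr :: "'o \<Rightarrow> 'o \<Rightarrow> 'm set"
  Ident :: "'o \<Rightarrow> 'm"
  Comp :: "'o \<Rightarrow> 'o \<Rightarrow> 'o \<Rightarrow> 'm \<Rightarrow> 'm \<Rightarrow> 'm"

locale category =
  fixes C :: "('o, 'm) cat"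
  assumes ident_arr: "P \<in> Ob C \<Longrightarrow> Ident C P \<in> Arr C P P"
    and comp_arr: "\<lbrakk>P \<in> Ob C; Q \<in> Ob C; R \<in> Ob C; f \<in> Arr C P Q; g \<in> Arr C Q R\<rbrakk>
      \<Longrightarrow> Comp C P Q R g f \<in> Arr C P R"
    and comp_ident_right: "\<lbrakk>P \<in> Ob C; Q \<in> Ob C; f \<in> Arr C P Q\<rbrakk>
      \<Longrightarrow> Comp C P P Q f (Ident C P) = f"
    and comp_ident_left: "\<lbrakk>P \<in> Ob C; Q \<in> Ob C; f \<in> Arr C P Q\<rbrakk>
      \<Longrightarrow> Comp C P Q Q (Ident C Q) f = f"
    and comp_assoc: "\<lbrakk>N \<in> Ob C; P \<in> Ob C; Q \<in> Ob C; R \<in> Ob C;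
        f \<in> Arr C N P; g \<in> Arr C P Q; h \<in> Arr C Q R\<rbrakk>
      \<Longrightarrow> Comp C N Q R h (Comp C N P Q g f) = Comp C N P R (Comp C P Q R h g) f"

record ('o, 'm, 'p, 'n) functor_data =
  omap :: "'o \<Rightarrow> 'p"
  amap :: "'o \<Rightarrow> 'o \<Rightarrow> 'm \<Rightarrow> 'n"

locale covariant_functor = source: category C + target: category D
  for C :: "('o, 'm) cat" and D :: "('p, 'n) cat" +
  fixes F :: "('o, 'm, 'p, 'n) functor_data"
  assumes omap_ob: "P \<in> Ob C \<Longrightarrow> omap F P \<in> Ob D"
    and amap_arr: "\<lbrakk>P \<in> Ob C; Q \<in> Ob C; f \<in> Arr C P Q\<rbrakk>
      \<Longrightarrow> amap F P Q f \<in> Arr D (omap F P) (omap F Q)"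
    and amap_ident: "P \<in> Ob C \<Longrightarrow> amap F P P (Ident C P) = Ident D (omap F P)"
    and amap_comp: "\<lbrakk>P \<in> Ob C; Q \<in> Ob C; R \<in> Ob C; f \<in> Arr C P Q; g \<in> Arr C Q R\<rbrakk>
      \<Longrightarrow> amap F P R (Comp C P Q R g f)
        = Comp D (omap F P) (omap F Q) (omap F R) (amap F Q R g) (amap F P Q f)"

definition functor_comp ::
    "('p, 'n, 'q, 'k) functor_data \<Rightarrow> ('o, 'm, 'p, 'n) functor_data \<Rightarrow> ('o, 'm, 'q, 'k) functor_data"
    (infixl \<open>\<circ>\<^sub>F\<close> 55) where
  "G \<circ>\<^sub>F F = \<lparr>omap = (\<lambda>P. omap G (omap F P)),
              amap = (\<lambda>P Q f. amap G (omap F P) (omap F Q) (amap F P Q f))\<rparr>"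

definition functor_eq_on ::
    "('o, 'm) cat \<Rightarrow> ('o, 'm, 'p, 'n) functor_data \<Rightarrow> ('o, 'm, 'p, 'n) functor_data \<Rightarrow> bool" where
  "functor_eq_on C F G \<longleftrightarrow>
     (\<forall>P \<in> Ob C. omap F P = omap G P) \<and>
     (\<forall>P \<in> Ob C. \<forall>Q \<in> Ob C. \<forall>f \<in> Arr C P Q. amap F P Q f = amap G P Q f)"

definition commuting_triangle ::
    "('o, 'm) cat \<Rightarrow> ('p, 'n) cat \<Rightarrow> ('q, 'k) cat \<Rightarrow> ('o, 'm, 'p, 'n) functor_data \<Rightarrow>
     ('p, 'n, 'q, 'k) functor_data \<Rightarrow> ('o, 'm, 'q, 'k) functor_data \<Rightarrow> bool" where
  "commuting_triangle C D E F G H \<longleftrightarrow>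
     covariant_functor C D F \<and> covariant_functor D E G \<and> covariant_functor C E H \<and>
     functor_eq_on C H (G \<circ>\<^sub>F F)"


section \<open>Bounded archimedean lattice-ordered algebras\<close>

text \<open>The zero algebra (\<open>\<one> = \<zero>\<close>) is allowed, as in the HOL-Algebra locale \<^locale>\<open>algebra\<close>.\<close>

record 'a lalg = "(real, 'a) module" +
  ale :: "'a \<Rightarrow> 'a \<Rightarrow> bool" (infixl \<open>\<preceq>\<index>\<close> 50)

definition order_of :: "'a lalg \<Rightarrow> 'a gorder" where
  "order_of A = \<lparr>carrier = carrier A, eq = (=), le = ale A\<rparr>"

locale l_algebra = algebra "ring_of_type_algebra :: real ring" A
  for A :: "'a lalg" (structure) +
  assumes lattice_order: "lattice (order_of A)"
    and add_mono: "\<lbrakk>a \<in> carrier A; b \<in> carrier A; c \<in> carrier A; a \<preceq> b\<rbrakk> \<Longrightarrow> a \<oplus> c \<preceq> b \<oplus> c"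
    and mult_nonneg: "\<lbrakk>a \<in> carrier A; b \<in> carrier A; \<zero> \<preceq> a; \<zero> \<preceq> b\<rbrakk> \<Longrightarrow> \<zero> \<preceq> a \<otimes> b"
    and smult_nonneg: "\<lbrakk>a \<in> carrier A; \<zero> \<preceq> a; 0 \<le> r\<rbrakk> \<Longrightarrow> \<zero> \<preceq> r \<odot> a"

definition bounded_lalg :: "'a lalg \<Rightarrow> bool" where
  "bounded_lalg A \<longleftrightarrow>
     (\<forall>a \<in> carrier A. \<exists>n::nat. n \<ge> 1 \<and> a \<preceq>\<^bsub>A\<^esub> [n] \<cdot>\<^bsub>A\<^esub> \<one>\<^bsub>A\<^esub>)"

definition archimedean_lalg :: "'a lalg \<Rightarrow> bool" where
  "archimedean_lalg A \<longleftrightarrow>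
     (\<forall>a \<in> carrier A. \<forall>b \<in> carrier A.
        (\<forall>n::nat. n \<ge> 1 \<longrightarrow> [n] \<cdot>\<^bsub>A\<^esub> a \<preceq>\<^bsub>A\<^esub> b) \<longrightarrow> a \<preceq>\<^bsub>A\<^esub> \<zero>\<^bsub>A\<^esub>)"

definition lalg_hom :: "'a lalg \<Rightarrow> 'b lalg \<Rightarrow> ('a \<Rightarrow> 'b) set" where
  "lalg_hom A B = {\<alpha> \<in> ring_hom A B.
     (\<forall>r. \<forall>a \<in> carrier A. \<alpha> (r \<odot>\<^bsub>A\<^esub> a) = r \<odot>\<^bsub>B\<^esub> \<alpha> a) \<and>
     (\<forall>a \<in> carrier A. \<forall>b \<in> carrier A.
        \<alpha> (a \<squnion>\<^bsub>order_of A\<^esub> b) = \<alpha> a \<squnion>\<^bsub>order_of B\<^esub> \<alpha> b \<and>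
        \<alpha> (a \<sqinter>\<^bsub>order_of A\<^esub> b) = \<alpha> a \<sqinter>\<^bsub>order_of B\<^esub> \<alpha> b)}"

definition BAL :: "('a lalg, 'a \<Rightarrow> 'a) cat" where
  "BAL = \<lparr>Ob = {A. l_algebra A \<and> bounded_lalg A \<and> archimedean_lalg A},
          Arr = (\<lambda>A B. lalg_hom A B \<inter> extensional (carrier A)),
          Ident = (\<lambda>A. \<lambda>a \<in> carrier A. a),
          Comp = (\<lambda>A B C \<beta> \<alpha>. compose (carrier A) \<beta> \<alpha>)\<rparr>"


section \<open>Archimedean \<open>\<ell>\<close>-ideals\<close>

definition labs :: "'a lalg \<Rightarrow> 'a \<Rightarrow> 'a" where
  "labs A a = a \<squnion>\<^bsub>order_of A\<^esub> (\<ominus>\<^bsub>A\<^esub> a)"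

definition l_ideal :: "'a set \<Rightarrow> 'a lalg \<Rightarrow> bool" where
  "l_ideal I A \<longleftrightarrow> ideal I A \<and>
     (\<forall>a \<in> carrier A. \<forall>b \<in> I. labs A a \<preceq>\<^bsub>A\<^esub> labs A b \<longrightarrow> a \<in> I)"

text \<open>The order on \<open>A/I\<close> is the usual one: \<open>a + I \<le> b + I\<close> iff \<open>a \<le> b + i\<close> for some \<open>i \<in> I\<close>,
  i.e. iff some representatives are so related.\<close>

definition lalg_quot :: "'a lalg \<Rightarrow> 'a set \<Rightarrow> 'a set lalg" where
  "lalg_quot A I =
     \<lparr>carrier = carrier (A Quot I), monoid.mult = monoid.mult (A Quot I), one = one (A Quot I),
      ring.zero = ring.zero (A Quot I), add = add (A Quot I),
      module.smult = (\<lambda>r U. \<Union>x \<in> U. I +>\<^bsub>A\<^esub> (r \<odot>\<^bsub>A\<^esub> x)),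
      ale = (\<lambda>U V. \<exists>x \<in> U. \<exists>y \<in> V. x \<preceq>\<^bsub>A\<^esub> y)\<rparr>"

definition arch_ideals :: "'a lalg \<Rightarrow> 'a set set" where
  "arch_ideals A = {I. l_ideal I A \<and> archimedean_lalg (lalg_quot A I)}"

definition arch_gen :: "'a lalg \<Rightarrow> 'a set \<Rightarrow> 'a set" where
  "arch_gen A S = \<Inter>{J \<in> arch_ideals A. S \<subseteq> J}"


section \<open>Frames\<close>

locale frame = complete_lattice L for L (structure) +
  assumes meet_sup_distrib:
    "\<lbrakk>a \<in> carrier L; S \<subseteq> carrier L\<rbrakk> \<Longrightarrow> a \<sqinter> \<Squnion>S = \<Squnion>{a \<sqinter> s | s. s \<in> S}"

definition pcompl :: "('a, 'b) gorder_scheme \<Rightarrow> 'a \<Rightarrow> 'a" where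
  "pcompl L a = \<Squnion>\<^bsub>L\<^esub>{b \<in> carrier L. a \<sqinter>\<^bsub>L\<^esub> b = \<bottom>\<^bsub>L\<^esub>}"

definition well_inside :: "('a, 'b) gorder_scheme \<Rightarrow> 'a \<Rightarrow> 'a \<Rightarrow> bool" where
  "well_inside L a b \<longleftrightarrow> pcompl L a \<squnion>\<^bsub>L\<^esub> b = \<top>\<^bsub>L\<^esub>"

definition compact_frame :: "('a, 'b) gorder_scheme \<Rightarrow> bool" where
  "compact_frame L \<longleftrightarrow>
     (\<forall>S \<subseteq> carrier L. \<Squnion>\<^bsub>L\<^esub>S = \<top>\<^bsub>L\<^esub> \<longrightarrow> (\<exists>T \<subseteq> S. finite T \<and> \<Squnion>\<^bsub>L\<^esub>T = \<top>\<^bsub>L\<^esub>))"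

definition regular_frame :: "('a, 'b) gorder_scheme \<Rightarrow> bool" where
  "regular_frame L \<longleftrightarrow>
     (\<forall>a \<in> carrier L. a = \<Squnion>\<^bsub>L\<^esub>{b \<in> carrier L. well_inside L b a})"

definition frame_hom :: "('a, 'c) gorder_scheme \<Rightarrow> ('b, 'd) gorder_scheme \<Rightarrow> ('a \<Rightarrow> 'b) set" where
  "frame_hom L M = {h \<in> carrier L \<rightarrow> carrier M.
     h \<top>\<^bsub>L\<^esub> = \<top>\<^bsub>M\<^esub> \<and>
     (\<forall>a \<in> carrier L. \<forall>b \<in> carrier L. h (a \<sqinter>\<^bsub>L\<^esub> b) = h a \<sqinter>\<^bsub>M\<^esub> h b) \<and>
     (\<forall>S \<subseteq> carrier L. h (\<Squnion>\<^bsub>L\<^esub>S) = \<Squnion>\<^bsub>M\<^esub>(h ` S))}"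

definition KRFrm :: "('a gorder, 'a \<Rightarrow> 'a) cat" where
  "KRFrm = \<lparr>Ob = {L. frame L \<and> compact_frame L \<and> regular_frame L},
            Arr = (\<lambda>L M. frame_hom L M \<inter> extensional (carrier L)),
            Ident = (\<lambda>L. \<lambda>a \<in> carrier L. a),
            Comp = (\<lambda>L M N h g. compose (carrier L) h g)\<rparr>"


section \<open>De Vries algebras\<close>

no_notation lesspoll (infixl \<open>\<prec>\<close> 50)

record 'a dv = "'a gorder" +
  prec :: "'a \<Rightarrow> 'a \<Rightarrow> bool" (infixl \<open>\<prec>\<index>\<close> 50)

text \<open>In a boolean algebra the pseudocomplement is the complement.\<close>

locale complete_boolean_algebra = complete_lattice L for L (structure) +
  assumes meet_join_distrib:
    "\<lbrakk>a \<in> carrier L; b \<in> carrier L; c \<in> carrier L\<rbrakk> \<Longrightarrow> a \<sqinter> (b \<squnion> c) = (a \<sqinter> b) \<squnion> (a \<sqinter> c)"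
    and complement_exists:
    "a \<in> carrier L \<Longrightarrow> \<exists>b \<in> carrier L. a \<sqinter> b = \<bottom> \<and> a \<squnion> b = \<top>"

locale de_vries_algebra = complete_boolean_algebra B for B :: "'a dv" (structure) +
  assumes DV1: "\<top> \<prec> \<top>"
    and DV2: "\<lbrakk>a \<in> carrier B; b \<in> carrier B; a \<prec> b\<rbrakk> \<Longrightarrow> a \<sqsubseteq> b"
    and DV3: "\<lbrakk>a \<in> carrier B; b \<in> carrier B; c \<in> carrier B; d \<in> carrier B;
        a \<sqsubseteq> b; b \<prec> c; c \<sqsubseteq> d\<rbrakk> \<Longrightarrow> a \<prec> d"
    and DV4: "\<lbrakk>a \<in> carrier B; b \<in> carrier B; c \<in> carrier B; a \<prec> b; a \<prec> c\<rbrakk> \<Longrightarrow> a \<prec> b \<sqinter> c"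
    and DV5: "\<lbrakk>a \<in> carrier B; b \<in> carrier B; a \<prec> b\<rbrakk> \<Longrightarrow> pcompl B b \<prec> pcompl B a"
    and DV6: "\<lbrakk>a \<in> carrier B; b \<in> carrier B; a \<prec> b\<rbrakk> \<Longrightarrow> \<exists>c \<in> carrier B. a \<prec> c \<and> c \<prec> b"
    and DV7: "\<lbrakk>a \<in> carrier B; a \<noteq> \<bottom>\<rbrakk> \<Longrightarrow> \<exists>b \<in> carrier B. b \<noteq> \<bottom> \<and> b \<prec> a"

definition dv_hom :: "'a dv \<Rightarrow> 'b dv \<Rightarrow> ('a \<Rightarrow> 'b) set" where
  "dv_hom B B' = {\<sigma> \<in> carrier B \<rightarrow> carrier B'.
     \<sigma> \<bottom>\<^bsub>B\<^esub> = \<bottom>\<^bsub>B'\<^esub> \<and>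
     (\<forall>a \<in> carrier B. \<forall>b \<in> carrier B. \<sigma> (a \<sqinter>\<^bsub>B\<^esub> b) = \<sigma> a \<sqinter>\<^bsub>B'\<^esub> \<sigma> b) \<and>
     (\<forall>a \<in> carrier B. \<forall>b \<in> carrier B.
        a \<prec>\<^bsub>B\<^esub> b \<longrightarrow> pcompl B' (\<sigma> (pcompl B a)) \<prec>\<^bsub>B'\<^esub> \<sigma> b) \<and>
     (\<forall>a \<in> carrier B. \<sigma> a = \<Squnion>\<^bsub>B'\<^esub>{\<sigma> b | b. b \<in> carrier B \<and> b \<prec>\<^bsub>B\<^esub> a})}"

definition dv_comp :: "'a dv \<Rightarrow> 'b dv \<Rightarrow> 'c dv \<Rightarrow> ('b \<Rightarrow> 'c) \<Rightarrow> ('a \<Rightarrow> 'b) \<Rightarrow> 'a \<Rightarrow> 'c" where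
  "dv_comp B1 B2 B3 \<sigma>2 \<sigma>1 =
     (\<lambda>a \<in> carrier B1. \<Squnion>\<^bsub>B3\<^esub>{\<sigma>2 (\<sigma>1 b) | b. b \<in> carrier B1 \<and> b \<prec>\<^bsub>B1\<^esub> a})"

definition DeV :: "('a dv, 'a \<Rightarrow> 'a) cat" where
  "DeV = \<lparr>Ob = {B. de_vries_algebra B},
          Arr = (\<lambda>B B'. dv_hom B B' \<inter> extensional (carrier B)),
          Ident = (\<lambda>B. \<lambda>a \<in> carrier B. a),
          Comp = dv_comp\<rparr>"


section \<open>The functors\<close>

definition Arch_ob :: "'a lalg \<Rightarrow> 'a set gorder" where
  "Arch_ob A = \<lparr>carrier = arch_ideals A, eq = (=), le = (\<subseteq>)\<rparr>"

definition Arch_map :: "'a lalg \<Rightarrow> 'b lalg \<Rightarrow> ('a \<Rightarrow> 'b) \<Rightarrow> 'a set \<Rightarrow> 'b set" where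
  "Arch_map A A' \<alpha> = (\<lambda>I \<in> arch_ideals A. arch_gen A' (\<alpha> ` I))"

definition Arch :: "('a lalg, 'a \<Rightarrow> 'a, 'a set gorder, 'a set \<Rightarrow> 'a set) functor_data" where
  "Arch = \<lparr>omap = Arch_ob, amap = Arch_map\<rparr>"

definition regular_elements :: "'a gorder \<Rightarrow> 'a set" where
  "regular_elements L = {a \<in> carrier L. pcompl L (pcompl L a) = a}"

text \<open>The relations on \<open>booleanization L\<close> and on \<open>Ann_ob A\<close> are made false outside the carriers, so
  that equality of these records is exactly equality of the structures on the carriers. Note that
  pseudocomplement, join and top are those of \<open>L\<close>, respectively of \<open>Arch_ob A\<close>.\<close>

definition booleanization :: "'a gorder \<Rightarrow> 'a dv" where
  "booleanization L =
     \<lparr>carrier = regular_elements L, eq = eq L, le = le L,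
      prec = (\<lambda>a b. a \<in> regular_elements L \<and> b \<in> regular_elements L \<and> well_inside L a b)\<rparr>"

definition booleanization_map :: "'a gorder \<Rightarrow> 'b gorder \<Rightarrow> ('a \<Rightarrow> 'b) \<Rightarrow> 'a \<Rightarrow> 'b" where
  "booleanization_map L M h = (\<lambda>a \<in> regular_elements L. pcompl M (pcompl M (h a)))"

definition Booleanization :: "('a gorder, 'a \<Rightarrow> 'a, 'a dv, 'a \<Rightarrow> 'a) functor_data" where
  "Booleanization = \<lparr>omap = booleanization, amap = booleanization_map\<rparr>"

definition annihilator :: "'a lalg \<Rightarrow> 'a set \<Rightarrow> 'a set" where
  "annihilator A S = {a \<in> carrier A. \<forall>s \<in> S. a \<otimes>\<^bsub>A\<^esub> s = \<zero>\<^bsub>A\<^esub>}"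

definition ann_ideals :: "'a lalg \<Rightarrow> 'a set set" where
  "ann_ideals A = {annihilator A S | S. S \<subseteq> carrier A}"

definition Ann_ob :: "'a lalg \<Rightarrow> 'a set dv" where
  "Ann_ob A =
     \<lparr>carrier = ann_ideals A, eq = (=), le = (\<subseteq>),
      prec = (\<lambda>I J. I \<in> ann_ideals A \<and> J \<in> ann_ideals A \<and>
        pcompl (Arch_ob A) I \<squnion>\<^bsub>Arch_ob A\<^esub> J = carrier A)\<rparr>"

definition Ann_map :: "'a lalg \<Rightarrow> 'b lalg \<Rightarrow> ('a \<Rightarrow> 'b) \<Rightarrow> 'a set \<Rightarrow> 'b set" where
  "Ann_map A A' \<alpha> =
     (\<lambda>I \<in> ann_ideals A. pcompl (Arch_ob A') (pcompl (Arch_ob A') (Arch_map A A' \<alpha> I)))"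

definition Ann :: "('a lalg, 'a \<Rightarrow> 'a, 'a set dv, 'a set \<Rightarrow> 'a set) functor_data" where
  "Ann = \<lparr>omap = Ann_ob, amap = Ann_map\<rparr>"

end

theory Submission
  imports Defs
begin

text \<open>Everything about \<open>Arch\<close> rests on a description of archimedean \<open>\<ell>\<close>-ideals without lattice
  operations: a ring ideal \<open>I\<close> is one iff it contains every \<open>x\<close> such that for each \<open>e > 0\<close> there
  is \<open>i \<in> I\<close> with \<open>x\<^sup>2 \<le> e + i\<close>. This condition is stable under intersections, inverse images
  and residuals \<open>(M : S)\<close>. Residuals yield the frame law, the preservation of meets by
  \<open>Arch(\<alpha>)\<close>, and \<open>I\<^sup>* = Ann(I)\<close>; hence annihilator ideals are exactly the regular elements of
  \<open>Arch(A)\<close> and \<open>Ann\<close> is the composite of \<open>Arch\<close> and the booleanization, both on objects and on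
  arrows. Functoriality of \<open>Ann\<close> follows from that of the two factors.\<close>

section \<open>Frames\<close>

text \<open>The obstacle is that the archimedean ideal generated by a set has no workable formula in
  its generators. An assertion about all its elements is therefore proved by showing that the
  elements satisfying it form an archimedean ideal containing the generators. This suits assertions
  about one element at a time, so intersections are traded for products: a \<open>z\<close> in both
  \<open>I\<close> and \<open>J\<close> has \<open>z^2\<close> among the products, and squares
  detect membership. Squares also replace absolute values, since \<open>|x|^2 = x^2\<close>, and
  \<open>(c x - d)^2 \<ge> 0\<close> brings bounds on \<open>x^2\<close> back to bounds on
  \<open>x\<close>. Compactness is the exception, because it asks for a concrete element; there the
  closure of an ideal is shown to be reached in a single step. On the de Vries side composition is
  not composition of functions. Comparing a composite with the pointwise one costs a step of
  \<open>\<prec>\<close>, and interpolation (DV6) supplies that step.\<close>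

context complete_lattice
begin

lemma sup_eqI:
  assumes "S \<subseteq> carrier L" "s \<in> carrier L" "\<And>x. x \<in> S \<Longrightarrow> x \<sqsubseteq> s"
    and "\<And>u. \<lbrakk>u \<in> carrier L; \<And>x. x \<in> S \<Longrightarrow> x \<sqsubseteq> u\<rbrakk> \<Longrightarrow> s \<sqsubseteq> u"
  shows "\<Squnion>S = s"
  using assms by (intro le_antisym sup_least[OF assms(1)] assms(4)) (auto intro: sup_upper)

lemma meet_eqI:
  assumes "a \<in> carrier L" "b \<in> carrier L" "s \<in> carrier L" "s \<sqsubseteq> a" "s \<sqsubseteq> b"
    and "\<And>u. \<lbrakk>u \<in> carrier L; u \<sqsubseteq> a; u \<sqsubseteq> b\<rbrakk> \<Longrightarrow> u \<sqsubseteq> s"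
  shows "a \<sqinter> b = s"
  using assms by (intro le_antisym meet_le assms(6)) (auto intro: meet_left meet_right)

lemma top_eqI: "\<lbrakk>t \<in> carrier L; \<And>x. x \<in> carrier L \<Longrightarrow> x \<sqsubseteq> t\<rbrakk> \<Longrightarrow> \<top> = t"
  by (simp add: le_antisym)

lemma bottom_eqI: "\<lbrakk>t \<in> carrier L; \<And>x. x \<in> carrier L \<Longrightarrow> t \<sqsubseteq> x\<rbrakk> \<Longrightarrow> \<bottom> = t"
  by (simp add: le_antisym)

lemma sup_empty [simp]: "\<Squnion>{} = \<bottom>"
  using weak_sup_empty by (simp add: eq_is_equal)

lemma sup_insert: "\<lbrakk>a \<in> carrier L; S \<subseteq> carrier L\<rbrakk> \<Longrightarrow> \<Squnion>(insert a S) = a \<squnion> \<Squnion>S"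
  using weak_sup_insert[of a S] by (simp add: eq_is_equal)

lemma le_bottom_iff: "x \<in> carrier L \<Longrightarrow> x \<sqsubseteq> \<bottom> \<longleftrightarrow> x = \<bottom>"
  by (auto intro: le_antisym)

lemma top_le_iff: "x \<in> carrier L \<Longrightarrow> \<top> \<sqsubseteq> x \<longleftrightarrow> x = \<top>"
  by (auto intro: le_antisym)

lemma le_iff_meet: "\<lbrakk>x \<in> carrier L; y \<in> carrier L\<rbrakk> \<Longrightarrow> x \<sqsubseteq> y \<longleftrightarrow> x \<sqinter> y = x"
  by (metis le_antisym le_refl meet_closed meet_le meet_left meet_right)

lemma meet_mono:
  "\<lbrakk>a \<sqsubseteq> c; b \<sqsubseteq> d; a \<in> carrier L; b \<in> carrier L; c \<in> carrier L; d \<in> carrier L\<rbrakk>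
    \<Longrightarrow> a \<sqinter> b \<sqsubseteq> c \<sqinter> d"
  by (intro meet_le) (auto intro: le_trans[OF meet_left] le_trans[OF meet_right])

lemma join_mono:
  "\<lbrakk>a \<sqsubseteq> c; b \<sqsubseteq> d; a \<in> carrier L; b \<in> carrier L; c \<in> carrier L; d \<in> carrier L\<rbrakk>
    \<Longrightarrow> a \<squnion> b \<sqsubseteq> c \<squnion> d"
  by (intro join_le) (auto intro: le_trans[OF _ join_left] le_trans[OF _ join_right])

lemma meet_left_comm:
  "\<lbrakk>a \<in> carrier L; b \<in> carrier L; c \<in> carrier L\<rbrakk> \<Longrightarrow> a \<sqinter> (b \<sqinter> c) = b \<sqinter> (a \<sqinter> c)"
  by (metis meet_assoc meet_comm)

lemma meet_bottom [simp]: "x \<in> carrier L \<Longrightarrow> x \<sqinter> \<bottom> = \<bottom>" "x \<in> carrier L \<Longrightarrow> \<bottom> \<sqinter> x = \<bottom>"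
  using bottom_meet[of x] by (simp_all add: meet_comm[of L x] eq_is_equal)

lemma meet_top [simp]: "x \<in> carrier L \<Longrightarrow> x \<sqinter> \<top> = x" "x \<in> carrier L \<Longrightarrow> \<top> \<sqinter> x = x"
  using top_meet[of x] by (simp_all add: meet_comm[of L x] eq_is_equal)

lemma join_bottom [simp]: "x \<in> carrier L \<Longrightarrow> x \<squnion> \<bottom> = x" "x \<in> carrier L \<Longrightarrow> \<bottom> \<squnion> x = x"
  using bottom_join[of x] by (simp_all add: join_comm[of L x] eq_is_equal)

lemma join_top [simp]: "x \<in> carrier L \<Longrightarrow> x \<squnion> \<top> = \<top>" "x \<in> carrier L \<Longrightarrow> \<top> \<squnion> x = \<top>"
  using top_join[of x] by (simp_all add: join_comm[of L x] eq_is_equal)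

end

section \<open>Pseudocomplements and the well-inside relation\<close>

context frame
begin

lemma meet_join_distrib:
  assumes "a \<in> carrier L" "b \<in> carrier L" "c \<in> carrier L"
  shows "a \<sqinter> (b \<squnion> c) = (a \<sqinter> b) \<squnion> (a \<sqinter> c)"
proof -
  have "{a \<sqinter> s | s. s \<in> {b, c}} = {a \<sqinter> b, a \<sqinter> c}"
    by auto
  then show ?thesis
    using meet_sup_distrib[of a "{b, c}"] assms by (simp add: join_def)
qed

text \<open>This half of the dual distributive law merges two covers with a common member into one.
  It makes \<open>well_inside\<close> stable under meets on the right and joins on the left.\<close>

lemma join_meet_le:
  assumes [simp]: "a \<in> carrier L" "b \<in> carrier L" "c \<in> carrier L"
  shows "(a \<squnion> b) \<sqinter> (a \<squnion> c) \<sqsubseteq> a \<squnion> (b \<sqinter> c)"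
proof -
  have "(a \<squnion> b) \<sqinter> (a \<squnion> c) = ((a \<squnion> b) \<sqinter> a) \<squnion> ((a \<squnion> b) \<sqinter> c)"
    by (simp add: meet_join_distrib)
  also have "(a \<squnion> b) \<sqinter> c = (a \<sqinter> c) \<squnion> (b \<sqinter> c)"
    by (metis assms join_closed meet_comm meet_join_distrib)
  finally have *: "(a \<squnion> b) \<sqinter> (a \<squnion> c) = ((a \<squnion> b) \<sqinter> a) \<squnion> ((a \<sqinter> c) \<squnion> (b \<sqinter> c))" .
  have "(a \<sqinter> c) \<squnion> (b \<sqinter> c) \<sqsubseteq> a \<squnion> (b \<sqinter> c)"
    by (simp add: join_mono meet_left)
  moreover have "(a \<squnion> b) \<sqinter> a \<sqsubseteq> a \<squnion> (b \<sqinter> c)"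
    by (meson assms join_closed join_left le_trans meet_closed meet_right)
  ultimately show ?thesis
    unfolding * by (simp add: join_le)
qed

lemma pcompl_closed [simp]: "pcompl L a \<in> carrier L"
  unfolding pcompl_def by (rule sup_closed) auto

lemma meet_pcompl [simp]:
  assumes [simp]: "a \<in> carrier L"
  shows "a \<sqinter> pcompl L a = \<bottom>" "pcompl L a \<sqinter> a = \<bottom>"
proof -
  let ?S = "{b \<in> carrier L. a \<sqinter> b = \<bottom>}"
  have "a \<sqinter> \<Squnion>?S = \<Squnion>{a \<sqinter> s | s. s \<in> ?S}"
    by (rule meet_sup_distrib) auto
  also have "\<dots> = \<bottom>"
    by (rule sup_eqI) auto
  finally show "a \<sqinter> pcompl L a = \<bottom>"
    unfolding pcompl_def .
  then show "pcompl L a \<sqinter> a = \<bottom>"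
    by (simp add: meet_comm)
qed

lemma le_pcompl_iff:
  assumes [simp]: "a \<in> carrier L" "b \<in> carrier L"
  shows "b \<sqsubseteq> pcompl L a \<longleftrightarrow> a \<sqinter> b = \<bottom>"
proof
  assume "b \<sqsubseteq> pcompl L a"
  then have "a \<sqinter> b \<sqsubseteq> a \<sqinter> pcompl L a"
    by (intro meet_mono) auto
  then show "a \<sqinter> b = \<bottom>"
    by (simp add: le_bottom_iff)
next
  assume "a \<sqinter> b = \<bottom>"
  then show "b \<sqsubseteq> pcompl L a"
    unfolding pcompl_def by (intro sup_upper) auto
qed

lemma pcompl_antimono:
  assumes "a \<sqsubseteq> b" and [simp]: "a \<in> carrier L" "b \<in> carrier L"
  shows "pcompl L b \<sqsubseteq> pcompl L a"
proof -
  have "a \<sqinter> pcompl L b \<sqsubseteq> b \<sqinter> pcompl L b"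
    using assms by (intro meet_mono) auto
  then show ?thesis
    by (simp add: le_pcompl_iff le_bottom_iff)
qed

lemma le_pcompl2 [simp]: "a \<in> carrier L \<Longrightarrow> a \<sqsubseteq> pcompl L (pcompl L a)"
  by (simp add: le_pcompl_iff)

lemma pcompl3 [simp]: "a \<in> carrier L \<Longrightarrow> pcompl L (pcompl L (pcompl L a)) = pcompl L a"
  by (simp add: le_antisym pcompl_antimono)

lemma pcompl2_mono:
  "\<lbrakk>a \<sqsubseteq> b; a \<in> carrier L; b \<in> carrier L\<rbrakk>
    \<Longrightarrow> pcompl L (pcompl L a) \<sqsubseteq> pcompl L (pcompl L b)"
  by (simp add: pcompl_antimono)

lemma pcompl_top [simp]: "pcompl L \<top> = \<bottom>"
  by (metis meet_pcompl(1) meet_top(2) pcompl_closed top_closed)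

lemma pcompl_bottom [simp]: "pcompl L \<bottom> = \<top>"
  by (metis bottom_closed le_pcompl_iff meet_bottom(2) pcompl_closed top_closed top_le_iff)

lemma pcompl_join:
  assumes [simp]: "a \<in> carrier L" "b \<in> carrier L"
  shows "pcompl L (a \<squnion> b) = pcompl L a \<sqinter> pcompl L b"
proof (rule le_antisym)
  show "pcompl L (a \<squnion> b) \<sqsubseteq> pcompl L a \<sqinter> pcompl L b"
    by (simp add: join_left join_right meet_le pcompl_antimono)
  let ?c = "pcompl L a \<sqinter> pcompl L b"
  have "?c \<sqinter> a = \<bottom>" "?c \<sqinter> b = \<bottom>"
    by (simp_all add: meet_assoc meet_left_comm[of "pcompl L a" "pcompl L b" a])
  then have "?c \<sqinter> (a \<squnion> b) = \<bottom>"
    by (simp add: meet_join_distrib)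
  then show "?c \<sqsubseteq> pcompl L (a \<squnion> b)"
    by (simp add: le_pcompl_iff meet_comm)
qed auto

text \<open>With \<open>x\<close> the pseudocomplement of \<open>a \<sqinter> b\<close>, the factors
  are replaced by their double pseudocomplements one at a time:
  \<open>a \<sqinter> (b \<sqinter> x)\<close> is bottom, so \<open>b \<sqinter> x\<close> lies
  below \<open>pcompl L a\<close>, which is disjoint from \<open>pcompl L (pcompl L a)\<close>. The
  same move then treats \<open>b\<close>.\<close>

lemma pcompl2_meet:
  assumes [simp]: "a \<in> carrier L" "b \<in> carrier L"
  shows "pcompl L (pcompl L (a \<sqinter> b)) = pcompl L (pcompl L a) \<sqinter> pcompl L (pcompl L b)"
proof (rule le_antisym)
  show "pcompl L (pcompl L (a \<sqinter> b)) \<sqsubseteq> pcompl L (pcompl L a) \<sqinter> pcompl L (pcompl L b)"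
    by (simp add: meet_le meet_left meet_right pcompl2_mono)
  let ?x = "pcompl L (a \<sqinter> b)"
  have "a \<sqinter> (b \<sqinter> ?x) = \<bottom>"
    by (simp flip: meet_assoc)
  then have "b \<sqinter> ?x \<sqsubseteq> pcompl L a"
    by (simp add: le_pcompl_iff)
  then have "pcompl L (pcompl L a) \<sqinter> (b \<sqinter> ?x) \<sqsubseteq> pcompl L (pcompl L a) \<sqinter> pcompl L a"
    by (intro meet_mono) auto
  then have "b \<sqinter> (pcompl L (pcompl L a) \<sqinter> ?x) = \<bottom>"
    by (simp add: le_bottom_iff meet_left_comm)
  then have "pcompl L (pcompl L a) \<sqinter> ?x \<sqsubseteq> pcompl L b"
    by (simp add: le_pcompl_iff)
  then have "pcompl L (pcompl L b) \<sqinter> (pcompl L (pcompl L a) \<sqinter> ?x)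
      \<sqsubseteq> pcompl L (pcompl L b) \<sqinter> pcompl L b"
    by (intro meet_mono) auto
  then have "?x \<sqinter> (pcompl L (pcompl L a) \<sqinter> pcompl L (pcompl L b)) = \<bottom>"
    by (simp add: le_bottom_iff meet_left_comm meet_comm)
  then show "pcompl L (pcompl L a) \<sqinter> pcompl L (pcompl L b) \<sqsubseteq> pcompl L (pcompl L (a \<sqinter> b))"
    by (simp add: le_pcompl_iff)
qed auto

lemma well_inside_le:
  assumes "well_inside L a b" and [simp]: "a \<in> carrier L" "b \<in> carrier L"
  shows "a \<sqsubseteq> b"
proof -
  have "a = a \<sqinter> (pcompl L a \<squnion> b)"
    using assms by (simp add: well_inside_def)
  also have "\<dots> = a \<sqinter> b"
    by (simp add: meet_join_distrib)
  finally show ?thesis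
    by (simp add: le_iff_meet)
qed

lemma well_inside_mono:
  assumes "a \<sqsubseteq> b" "well_inside L b c" "c \<sqsubseteq> d"
    and [simp]: "a \<in> carrier L" "b \<in> carrier L" "c \<in> carrier L" "d \<in> carrier L"
  shows "well_inside L a d"
proof -
  have "pcompl L b \<squnion> c \<sqsubseteq> pcompl L a \<squnion> d"
    using assms by (intro join_mono pcompl_antimono) auto
  then show ?thesis
    using assms(2) by (simp add: well_inside_def top_le_iff)
qed

lemma well_inside_meet:
  assumes "well_inside L a b" "well_inside L a c"
    and [simp]: "a \<in> carrier L" "b \<in> carrier L" "c \<in> carrier L"
  shows "well_inside L a (b \<sqinter> c)"
  using join_meet_le[of "pcompl L a" b c] assms(1,2) by (simp add: well_inside_def top_le_iff)

lemma well_inside_join: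
  assumes "well_inside L a c" "well_inside L b c"
    and [simp]: "a \<in> carrier L" "b \<in> carrier L" "c \<in> carrier L"
  shows "well_inside L (a \<squnion> b) c"
  using join_meet_le[of c "pcompl L a" "pcompl L b"] assms(1,2)
  by (simp add: well_inside_def top_le_iff pcompl_join join_comm)

lemma well_inside_bottom [simp]: "a \<in> carrier L \<Longrightarrow> well_inside L \<bottom> a"
  by (simp add: well_inside_def)

lemma well_inside_pcompl:
  assumes "well_inside L a b" and [simp]: "a \<in> carrier L" "b \<in> carrier L"
  shows "well_inside L (pcompl L b) (pcompl L a)"
proof -
  have "pcompl L a \<squnion> b \<sqsubseteq> pcompl L a \<squnion> pcompl L (pcompl L b)"
    by (intro join_mono) auto
  then show ?thesis
    using assms(1) by (simp add: well_inside_def top_le_iff join_comm)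
qed

text \<open>The left argument enters \<open>well_inside\<close> only through its pseudocomplement.
  Hence elements found well inside \<open>b\<close> in the frame can be made regular at no
  cost.\<close>

lemma well_inside_pcompl2:
  "a \<in> carrier L \<Longrightarrow> well_inside L (pcompl L (pcompl L a)) b \<longleftrightarrow> well_inside L a b"
  by (simp add: well_inside_def)

text \<open>By regularity \<open>b\<close> is the join of the elements well inside it, so these
  together with \<open>pcompl L a\<close> cover the top. Compactness leaves finitely many of them,
  and their join is the interpolant.\<close>

lemma well_inside_interpolate:
  assumes compact: "compact_frame L" and regular: "regular_frame L"
    and ab: "well_inside L a b" and [simp]: "a \<in> carrier L" "b \<in> carrier L"
  shows "\<exists>c \<in> carrier L. well_inside L a c \<and> well_inside L c b"
proof -
  let ?W = "{c \<in> carrier L. well_inside L c b}"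
  let ?S = "insert (pcompl L a) ?W"
  have b: "\<Squnion>?W = b"
    using regular by (auto simp: regular_frame_def)
  have "\<Squnion>?S = pcompl L a \<squnion> \<Squnion>?W"
    by (intro sup_insert) auto
  then have "\<Squnion>?S = \<top>"
    using ab b by (simp add: well_inside_def)
  moreover have "?S \<subseteq> carrier L"
    by auto
  ultimately obtain T where T: "T \<subseteq> ?S" "finite T" "\<Squnion>T = \<top>"
    using compact unfolding compact_frame_def by meson
  \<comment> \<open>Each finite part of the cover is absorbed by \<open>pcompl L a\<close> and a
    single element well inside \<open>b\<close>. The induction starts from bottom, which is well
    inside everything.\<close>
  have "\<exists>c \<in> ?W. \<Squnion>T \<sqsubseteq> pcompl L a \<squnion> c"
    using T(2,1)
  proof (induction T)
    case empty
    show ?case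
      by (intro bexI[of _ "\<bottom>"]) auto
  next
    case (insert x T)
    then obtain c where c: "c \<in> ?W" "\<Squnion>T \<sqsubseteq> pcompl L a \<squnion> c"
      by auto
    have x: "x = pcompl L a \<or> x \<in> ?W" and xL: "x \<in> carrier L" and TL: "T \<subseteq> carrier L"
      using insert by auto
    have sup: "\<Squnion>(insert x T) = x \<squnion> \<Squnion>T"
      using xL TL by (rule sup_insert)
    show ?case
      using x
    proof
      assume "x = pcompl L a"
      then show ?thesis
        using c xL TL sup by (intro bexI[of _ c]) (auto intro!: join_le join_left)
    next
      assume "x \<in> ?W"
      then have "x \<squnion> c \<in> ?W"
        using c by (auto intro: well_inside_join)
      moreover have "pcompl L a \<squnion> c \<sqsubseteq> pcompl L a \<squnion> (x \<squnion> c)"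
        using c xL by (intro join_mono join_right) auto
      then have "\<Squnion>T \<sqsubseteq> pcompl L a \<squnion> (x \<squnion> c)"
        using c xL TL by (auto intro: le_trans)
      moreover have "x \<sqsubseteq> pcompl L a \<squnion> (x \<squnion> c)"
        using c xL by (auto intro: le_trans[OF join_left join_right])
      ultimately show ?thesis
        using c xL TL sup by (intro bexI[of _ "x \<squnion> c"]) (auto intro!: join_le)
    qed
  qed
  then obtain c where "c \<in> ?W" "\<top> \<sqsubseteq> pcompl L a \<squnion> c"
    using T(3) by auto
  then show ?thesis
    by (intro bexI[of _ c]) (auto simp: well_inside_def top_le_iff)
qed

end

section \<open>Complete boolean algebras as frames\<close>

text \<open>Makes the pseudocomplement calculus of frames available in de Vries algebras. If
  \<open>c\<close> is a complement of \<open>a\<close>, every \<open>s\<close> lies below the join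
  of \<open>a \<sqinter> s\<close> and \<open>c\<close>; meeting the join of all \<open>s\<close>
  with \<open>a\<close> then removes \<open>c\<close>.\<close>

lemma frame_if_complete_boolean_algebra:
  assumes "complete_boolean_algebra L"
  shows "frame L"
proof -
  interpret complete_boolean_algebra L by fact
  show ?thesis
  proof
    fix a S
    assume a [simp]: "a \<in> carrier L" and S: "S \<subseteq> carrier L"
    let ?u = "\<Squnion>\<^bsub>L\<^esub>{a \<sqinter>\<^bsub>L\<^esub> s | s. s \<in> S}"
    have sub: "{a \<sqinter>\<^bsub>L\<^esub> s | s. s \<in> S} \<subseteq> carrier L"
      using S by auto
    then have [simp]: "?u \<in> carrier L"
      by simp
    obtain c where c [simp]: "c \<in> carrier L" and ac: "a \<sqinter>\<^bsub>L\<^esub> c = \<bottom>\<^bsub>L\<^esub>" "a \<squnion>\<^bsub>L\<^esub> c = \<top>\<^bsub>L\<^esub>"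
      using complement_exists[OF a] by auto
    have "s \<sqsubseteq>\<^bsub>L\<^esub> ?u \<squnion>\<^bsub>L\<^esub> c" if "s \<in> S" for s
    proof -
      have s [simp]: "s \<in> carrier L"
        using S that by auto
      have "s = s \<sqinter>\<^bsub>L\<^esub> (a \<squnion>\<^bsub>L\<^esub> c)"
        by (simp add: ac)
      also have "\<dots> = (a \<sqinter>\<^bsub>L\<^esub> s) \<squnion>\<^bsub>L\<^esub> (s \<sqinter>\<^bsub>L\<^esub> c)"
        by (simp add: meet_join_distrib meet_comm)
      also have "\<dots> \<sqsubseteq>\<^bsub>L\<^esub> ?u \<squnion>\<^bsub>L\<^esub> c"
        using that sub by (intro join_mono meet_right sup_upper) auto
      finally show ?thesis .
    qed
    then have "\<Squnion>\<^bsub>L\<^esub>S \<sqsubseteq>\<^bsub>L\<^esub> ?u \<squnion>\<^bsub>L\<^esub> c"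
      using S by (intro sup_least) auto
    then have "a \<sqinter>\<^bsub>L\<^esub> \<Squnion>\<^bsub>L\<^esub>S \<sqsubseteq>\<^bsub>L\<^esub> a \<sqinter>\<^bsub>L\<^esub> (?u \<squnion>\<^bsub>L\<^esub> c)"
      using S by (intro meet_mono) auto
    also have "a \<sqinter>\<^bsub>L\<^esub> (?u \<squnion>\<^bsub>L\<^esub> c) = a \<sqinter>\<^bsub>L\<^esub> ?u"
      by (simp add: meet_join_distrib ac)
    finally have "a \<sqinter>\<^bsub>L\<^esub> \<Squnion>\<^bsub>L\<^esub>S \<sqsubseteq>\<^bsub>L\<^esub> ?u"
      using S by (auto intro: le_trans[OF _ meet_right])
    moreover have "?u \<sqsubseteq>\<^bsub>L\<^esub> a \<sqinter>\<^bsub>L\<^esub> \<Squnion>\<^bsub>L\<^esub>S"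
      using S sub by (intro sup_least) (auto intro!: meet_mono sup_upper)
    ultimately show "a \<sqinter>\<^bsub>L\<^esub> \<Squnion>\<^bsub>L\<^esub>S = ?u"
      using S by (intro le_antisym) auto
  qed
qed

sublocale complete_boolean_algebra \<subseteq> frame
  by (rule frame_if_complete_boolean_algebra) (rule complete_boolean_algebra_axioms)

text \<open>The pseudocomplement is above any complement, so it joins with \<open>a\<close> to the
  top. This says that the double pseudocomplement is well inside \<open>a\<close>, hence below
  it.\<close>

lemma (in complete_boolean_algebra) pcompl2 [simp]:
  assumes a [simp]: "a \<in> carrier L"
  shows "pcompl L (pcompl L a) = a"
proof (rule le_antisym)
  obtain c where c [simp]: "c \<in> carrier L" and ac: "a \<sqinter> c = \<bottom>" "a \<squnion> c = \<top>"
    using complement_exists[OF a] by auto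
  have "c \<sqsubseteq> pcompl L a"
    by (simp add: le_pcompl_iff ac)
  then have "a \<squnion> c \<sqsubseteq> a \<squnion> pcompl L a"
    by (intro join_mono) auto
  then have "well_inside L (pcompl L (pcompl L a)) a"
    by (simp add: ac top_le_iff well_inside_def join_comm)
  then show "pcompl L (pcompl L a) \<sqsubseteq> a"
    by (intro well_inside_le) auto
qed auto


lemma (in frame) sup_meet_sup_le:
  assumes S: "S \<subseteq> carrier L" and T: "T \<subseteq> carrier L" and u [simp]: "u \<in> carrier L"
    and le: "\<And>s t. \<lbrakk>s \<in> S; t \<in> T\<rbrakk> \<Longrightarrow> s \<sqinter> t \<sqsubseteq> u"
  shows "\<Squnion>S \<sqinter> \<Squnion>T \<sqsubseteq> u"
proof -
  have [simp]: "\<Squnion>S \<in> carrier L"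
    using S by simp
  have "\<Squnion>S \<sqinter> t \<sqsubseteq> u" if "t \<in> T" for t
  proof -
    have t: "t \<in> carrier L"
      using T that by auto
    have "t \<sqinter> \<Squnion>S = \<Squnion>{t \<sqinter> s | s. s \<in> S}"
      using t S by (rule meet_sup_distrib)
    also have "\<dots> \<sqsubseteq> u"
      using le that S t by (intro sup_least) (auto simp: meet_comm)
    finally show ?thesis
      by (simp add: meet_comm)
  qed
  moreover have "\<Squnion>S \<sqinter> \<Squnion>T = \<Squnion>{\<Squnion>S \<sqinter> t | t. t \<in> T}"
    using T by (intro meet_sup_distrib) auto
  ultimately show ?thesis
    using T by (auto intro!: sup_least)
qed


section \<open>De Vries algebras\<close>

context de_vries_algebra
begin

lemma prec_meet:
  assumes "a \<prec> c" "b \<prec> d"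
    and [simp]: "a \<in> carrier B" "b \<in> carrier B" "c \<in> carrier B" "d \<in> carrier B"
  shows "a \<sqinter> b \<prec> c \<sqinter> d"
proof (rule DV4)
  show "a \<sqinter> b \<prec> c"
    by (rule DV3[of _ a c]) (auto simp: assms(1) meet_left)
  show "a \<sqinter> b \<prec> d"
    by (rule DV3[of _ b d]) (auto simp: assms(2) meet_right)
qed auto

text \<open>A nonzero remainder of \<open>a\<close> outside the join would by (DV7) contain a
  nonzero \<open>b \<prec> a\<close>, which is already part of the join. This is (M4) for identity
  arrows.\<close>

lemma sup_prec:
  assumes a [simp]: "a \<in> carrier B"
  shows "\<Squnion>{b \<in> carrier B. b \<prec> a} = a"
proof -
  let ?s = "\<Squnion>{b \<in> carrier B. b \<prec> a}"
  have s [simp]: "?s \<in> carrier B"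
    by (rule sup_closed) auto
  have "a \<sqinter> pcompl B ?s = \<bottom>"
  proof (rule ccontr)
    assume "a \<sqinter> pcompl B ?s \<noteq> \<bottom>"
    then obtain b where b: "b \<in> carrier B" "b \<noteq> \<bottom>" "b \<prec> a \<sqinter> pcompl B ?s"
      using DV7[of "a \<sqinter> pcompl B ?s"] by auto
    have "b \<prec> a"
      using b by (intro DV3[of b b "a \<sqinter> pcompl B ?s" a]) (auto simp: meet_left)
    then have "b \<sqsubseteq> ?s"
      using b by (intro sup_upper) auto
    moreover have "b \<sqsubseteq> pcompl B ?s"
      using DV2[OF _ _ b(3)] b by (auto intro: le_trans[OF _ meet_right])
    ultimately have "b \<sqsubseteq> ?s \<sqinter> pcompl B ?s"
      using b by (intro meet_le) auto
    then show False
      using b by (simp add: le_bottom_iff)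
  qed
  then have "a \<sqsubseteq> ?s"
    using le_pcompl_iff[of "pcompl B ?s" a] by (simp add: meet_comm)
  moreover have "?s \<sqsubseteq> a"
    by (rule sup_least) (auto intro: DV2)
  ultimately show ?thesis
    by (intro le_antisym) auto
qed

end

lemma ident_dv_hom:
  assumes "de_vries_algebra B"
  shows "(\<lambda>a \<in> carrier B. a) \<in> dv_hom B B"
proof -
  interpret de_vries_algebra B by fact
  have "{(\<lambda>a\<in>carrier B. a) b |b. b \<in> carrier B \<and> b \<prec>\<^bsub>B\<^esub> a} = {b \<in> carrier B. b \<prec>\<^bsub>B\<^esub> a}" for a
    by auto
  then show ?thesis
    by (auto simp: dv_hom_def sup_prec)
qed

section \<open>De Vries morphisms and their composition\<close>

locale dv_morphism = source: de_vries_algebra B + target: de_vries_algebra B'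
  for B :: "'a dv" and B' :: "'b dv" +
  fixes \<sigma> :: "'a \<Rightarrow> 'b"
  assumes hom: "\<sigma> \<in> dv_hom B B'"
begin

lemma closed [simp]: "a \<in> carrier B \<Longrightarrow> \<sigma> a \<in> carrier B'"
  using hom unfolding dv_hom_def by blast

lemma M1: "\<sigma> \<bottom>\<^bsub>B\<^esub> = \<bottom>\<^bsub>B'\<^esub>"
  using hom by (auto simp: dv_hom_def)

lemma M2: "\<lbrakk>a \<in> carrier B; b \<in> carrier B\<rbrakk> \<Longrightarrow> \<sigma> (a \<sqinter>\<^bsub>B\<^esub> b) = \<sigma> a \<sqinter>\<^bsub>B'\<^esub> \<sigma> b"
  using hom by (auto simp: dv_hom_def)

lemma M3: "\<lbrakk>a \<prec>\<^bsub>B\<^esub> b; a \<in> carrier B; b \<in> carrier B\<rbrakk>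
    \<Longrightarrow> pcompl B' (\<sigma> (pcompl B a)) \<prec>\<^bsub>B'\<^esub> \<sigma> b"
  using hom by (auto simp: dv_hom_def)

lemma M4: "a \<in> carrier B \<Longrightarrow> \<sigma> a = \<Squnion>\<^bsub>B'\<^esub>{\<sigma> b | b. b \<in> carrier B \<and> b \<prec>\<^bsub>B\<^esub> a}"
  using hom by (auto simp: dv_hom_def)

lemma mono: "\<lbrakk>a \<sqsubseteq>\<^bsub>B\<^esub> b; a \<in> carrier B; b \<in> carrier B\<rbrakk> \<Longrightarrow> \<sigma> a \<sqsubseteq>\<^bsub>B'\<^esub> \<sigma> b"
  by (metis M2 closed source.le_iff_meet target.le_iff_meet)

text \<open>By (M1) and (M2) \<open>\<sigma>\<close> preserves disjointness, so
  \<open>\<sigma> a\<close> lies below the complement that occurs in (M3).\<close>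

lemma prec_mono:
  assumes "a \<prec>\<^bsub>B\<^esub> b" and [simp]: "a \<in> carrier B" "b \<in> carrier B"
  shows "\<sigma> a \<prec>\<^bsub>B'\<^esub> \<sigma> b"
proof (rule target.DV3)
  have "\<sigma> (pcompl B a) \<sqinter>\<^bsub>B'\<^esub> \<sigma> a = \<bottom>\<^bsub>B'\<^esub>"
    by (metis M1 M2 assms(2) source.meet_pcompl(2) source.pcompl_closed)
  then show "\<sigma> a \<sqsubseteq>\<^bsub>B'\<^esub> pcompl B' (\<sigma> (pcompl B a))"
    by (simp add: target.le_pcompl_iff)
  show "pcompl B' (\<sigma> (pcompl B a)) \<prec>\<^bsub>B'\<^esub> \<sigma> b"
    by (simp add: M3 assms(1))
qed auto

end

locale dv_composable = g: dv_morphism B1 B2 \<sigma> + h: dv_morphism B2 B3 \<rho>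
  for B1 :: "'a dv" and B2 :: "'b dv" and B3 :: "'c dv" and \<sigma> \<rho>
begin

abbreviation comp where "comp \<equiv> dv_comp B1 B2 B3 \<rho> \<sigma>"

lemma sub: "{\<rho> (\<sigma> b) | b. b \<in> carrier B1 \<and> b \<prec>\<^bsub>B1\<^esub> a} \<subseteq> carrier B3"
  by auto

lemma comp_eq: "a \<in> carrier B1 \<Longrightarrow>
    comp a = \<Squnion>\<^bsub>B3\<^esub>{\<rho> (\<sigma> b) | b. b \<in> carrier B1 \<and> b \<prec>\<^bsub>B1\<^esub> a}"
  by (simp add: dv_comp_def)

lemma comp_closed [simp]: "a \<in> carrier B1 \<Longrightarrow> comp a \<in> carrier B3"
  using h.target.sup_closed[OF sub] by (simp add: comp_eq)

text \<open>With \<open>le_comp\<close> this confines the composite at \<open>a\<close> between the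
  pointwise composite at elements \<open>b \<prec> a\<close> and the pointwise composite at
  \<open>a\<close> itself.\<close>

lemma comp_le: "a \<in> carrier B1 \<Longrightarrow> comp a \<sqsubseteq>\<^bsub>B3\<^esub> \<rho> (\<sigma> a)"
  by (auto simp: dv_comp_def intro!: h.target.sup_least h.mono g.mono g.source.DV2)

lemma le_comp: "\<lbrakk>b \<prec>\<^bsub>B1\<^esub> a; a \<in> carrier B1; b \<in> carrier B1\<rbrakk> \<Longrightarrow> \<rho> (\<sigma> b) \<sqsubseteq>\<^bsub>B3\<^esub> comp a"
  by (auto simp: dv_comp_def intro!: h.target.sup_upper)

lemma comp_least:
  assumes "a \<in> carrier B1" "u \<in> carrier B3"
    and "\<And>b. \<lbrakk>b \<prec>\<^bsub>B1\<^esub> a; b \<in> carrier B1\<rbrakk> \<Longrightarrow> \<rho> (\<sigma> b) \<sqsubseteq>\<^bsub>B3\<^esub> u"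
  shows "comp a \<sqsubseteq>\<^bsub>B3\<^esub> u"
  using assms by (auto simp: dv_comp_def intro!: h.target.sup_least)

lemma comp_mono:
  assumes "a \<sqsubseteq>\<^bsub>B1\<^esub> a'" and [simp]: "a \<in> carrier B1" "a' \<in> carrier B1"
  shows "comp a \<sqsubseteq>\<^bsub>B3\<^esub> comp a'"
  using assms(1) by (intro comp_least le_comp) (auto intro: g.source.DV3[of _ _ a a'])

lemma comp_bottom: "comp \<bottom>\<^bsub>B1\<^esub> = \<bottom>\<^bsub>B3\<^esub>"
  using comp_le[of "\<bottom>\<^bsub>B1\<^esub>"] by (simp add: g.M1 h.M1 h.target.le_bottom_iff)

lemma comp_meet:
  assumes [simp]: "a \<in> carrier B1" "b \<in> carrier B1"
  shows "comp (a \<sqinter>\<^bsub>B1\<^esub> b) = comp a \<sqinter>\<^bsub>B3\<^esub> comp b"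
proof (rule h.target.le_antisym)
  show "comp (a \<sqinter>\<^bsub>B1\<^esub> b) \<sqsubseteq>\<^bsub>B3\<^esub> comp a \<sqinter>\<^bsub>B3\<^esub> comp b"
    by (intro h.target.meet_le comp_mono)
       (auto simp: g.source.meet_left g.source.meet_right)
  have "\<rho> (\<sigma> c) \<sqinter>\<^bsub>B3\<^esub> \<rho> (\<sigma> d) \<sqsubseteq>\<^bsub>B3\<^esub> comp (a \<sqinter>\<^bsub>B1\<^esub> b)"
    if [simp]: "c \<in> carrier B1" "d \<in> carrier B1" and "c \<prec>\<^bsub>B1\<^esub> a" "d \<prec>\<^bsub>B1\<^esub> b" for c d
  proof -
    have "\<rho> (\<sigma> (c \<sqinter>\<^bsub>B1\<^esub> d)) \<sqsubseteq>\<^bsub>B3\<^esub> comp (a \<sqinter>\<^bsub>B1\<^esub> b)"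
      using that by (intro le_comp g.source.prec_meet) auto
    then show ?thesis
      by (simp add: g.M2 h.M2)
  qed
  then show "comp a \<sqinter>\<^bsub>B3\<^esub> comp b \<sqsubseteq>\<^bsub>B3\<^esub> comp (a \<sqinter>\<^bsub>B1\<^esub> b)"
    unfolding comp_eq[OF assms(1)] comp_eq[OF assms(2)] by (intro h.target.sup_meet_sup_le) auto
qed auto

text \<open>Two interpolations give \<open>a \<prec> c \<prec> d \<prec> b\<close>. The outer gaps
  pay for passing between \<open>comp\<close> and the pointwise composite at either end; the middle
  gap feeds (M3) for \<open>\<sigma>\<close> and then for \<open>\<rho>\<close>, where the inner
  double complement cancels.\<close>

lemma comp_prec:
  assumes ab: "a \<prec>\<^bsub>B1\<^esub> b" and [simp]: "a \<in> carrier B1" "b \<in> carrier B1"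
  shows "pcompl B3 (comp (pcompl B1 a)) \<prec>\<^bsub>B3\<^esub> comp b"
proof -
  obtain c where c [simp]: "c \<in> carrier B1" and ac: "a \<prec>\<^bsub>B1\<^esub> c" and "c \<prec>\<^bsub>B1\<^esub> b"
    using g.source.DV6[OF _ _ ab] by auto
  then obtain d where d [simp]: "d \<in> carrier B1" and cd: "c \<prec>\<^bsub>B1\<^esub> d" and db: "d \<prec>\<^bsub>B1\<^esub> b"
    using g.source.DV6[of c b] by auto
  have "\<rho> (\<sigma> (pcompl B1 c)) \<sqsubseteq>\<^bsub>B3\<^esub> comp (pcompl B1 a)"
    using ac by (intro le_comp g.source.DV5) auto
  then have 1: "pcompl B3 (comp (pcompl B1 a)) \<sqsubseteq>\<^bsub>B3\<^esub> pcompl B3 (\<rho> (\<sigma> (pcompl B1 c)))"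
    by (intro h.target.pcompl_antimono) auto
  have "pcompl B2 (\<sigma> (pcompl B1 c)) \<prec>\<^bsub>B2\<^esub> \<sigma> d"
    using cd by (intro g.M3) auto
  then have "pcompl B3 (\<rho> (pcompl B2 (pcompl B2 (\<sigma> (pcompl B1 c))))) \<prec>\<^bsub>B3\<^esub> \<rho> (\<sigma> d)"
    by (intro h.M3) auto
  then have 2: "pcompl B3 (\<rho> (\<sigma> (pcompl B1 c))) \<prec>\<^bsub>B3\<^esub> \<rho> (\<sigma> d)"
    by simp
  show ?thesis
    by (rule h.target.DV3[OF _ _ _ _ 1 2 le_comp[OF db]]) auto
qed

text \<open>For \<open>b \<prec> a\<close> an interpolant \<open>c\<close> makes
  \<open>\<rho> (\<sigma> b)\<close> a lower bound of \<open>comp c\<close>, which is one of the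
  joined terms.\<close>

lemma comp_sup:
  assumes [simp]: "a \<in> carrier B1"
  shows "\<Squnion>\<^bsub>B3\<^esub>{comp b | b. b \<in> carrier B1 \<and> b \<prec>\<^bsub>B1\<^esub> a} = comp a"
proof (rule h.target.sup_eqI)
  fix u
  assume u: "u \<in> carrier B3"
    and le: "\<And>x. x \<in> {comp b | b. b \<in> carrier B1 \<and> b \<prec>\<^bsub>B1\<^esub> a} \<Longrightarrow> x \<sqsubseteq>\<^bsub>B3\<^esub> u"
  show "comp a \<sqsubseteq>\<^bsub>B3\<^esub> u"
  proof (rule comp_least)
    fix b
    assume b: "b \<prec>\<^bsub>B1\<^esub> a" "b \<in> carrier B1"
    then obtain c where c: "c \<in> carrier B1" "b \<prec>\<^bsub>B1\<^esub> c" "c \<prec>\<^bsub>B1\<^esub> a"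
      using g.source.DV6[of b a] by auto
    then have "\<rho> (\<sigma> b) \<sqsubseteq>\<^bsub>B3\<^esub> comp c" "comp c \<sqsubseteq>\<^bsub>B3\<^esub> u"
      using b le by (auto intro: le_comp)
    then show "\<rho> (\<sigma> b) \<sqsubseteq>\<^bsub>B3\<^esub> u"
      using b c u by (auto intro: h.target.le_trans)
  qed (use u in auto)
qed (auto intro!: comp_mono g.source.DV2)

lemma comp_hom: "comp \<in> dv_hom B1 B3"
  by (auto simp: dv_hom_def comp_bottom comp_meet comp_prec comp_sup)

lemma comp_morphism: "dv_morphism B1 B3 comp"
  by unfold_locales (rule comp_hom)

end

lemma dv_comp_extensional [simp]: "dv_comp B1 B2 B3 \<rho> \<sigma> \<in> extensional (carrier B1)"
  by (simp add: dv_comp_def)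

text \<open>Both sides are compared with the values \<open>\<rho> (\<sigma> (\<tau> b))\<close>. The
  inner composite is at most the pointwise one at \<open>b\<close>, and the pointwise one at
  \<open>b\<close> is at most the other inner composite at an interpolant \<open>c\<close> between
  \<open>b\<close> and \<open>a\<close>.\<close>

lemma dv_comp_assoc:
  assumes "dv_morphism B0 B1 \<tau>" "dv_morphism B1 B2 \<sigma>" "dv_morphism B2 B3 \<rho>"
  shows "dv_comp B0 B2 B3 \<rho> (dv_comp B0 B1 B2 \<sigma> \<tau>) = dv_comp B0 B1 B3 (dv_comp B1 B2 B3 \<rho> \<sigma>) \<tau>"
proof -
  interpret f: dv_morphism B0 B1 \<tau> by fact
  interpret g: dv_morphism B1 B2 \<sigma> by fact
  interpret h: dv_morphism B2 B3 \<rho> by fact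
  interpret gf: dv_composable B0 B1 B2 \<tau> \<sigma> ..
  interpret hg: dv_composable B1 B2 B3 \<sigma> \<rho> ..
  interpret gf_mor: dv_morphism B0 B2 gf.comp by (rule gf.comp_morphism)
  interpret hg_mor: dv_morphism B1 B3 hg.comp by (rule hg.comp_morphism)
  interpret h_gf: dv_composable B0 B2 B3 gf.comp \<rho> ..
  interpret hg_f: dv_composable B0 B1 B3 \<tau> hg.comp ..
  have "h_gf.comp a = hg_f.comp a" if [simp]: "a \<in> carrier B0" for a
  proof (rule h.target.le_antisym)
    show "h_gf.comp a \<sqsubseteq>\<^bsub>B3\<^esub> hg_f.comp a"
    proof (rule h_gf.comp_least)
      fix b
      assume b [simp]: "b \<in> carrier B0" and ba: "b \<prec>\<^bsub>B0\<^esub> a"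
      then obtain c where c [simp]: "c \<in> carrier B0" and bc: "b \<prec>\<^bsub>B0\<^esub> c" and ca: "c \<prec>\<^bsub>B0\<^esub> a"
        using f.source.DV6[of b a] by auto
      have 1: "\<rho> (gf.comp b) \<sqsubseteq>\<^bsub>B3\<^esub> \<rho> (\<sigma> (\<tau> b))"
        by (simp add: gf.comp_le h.mono)
      have 2: "\<rho> (\<sigma> (\<tau> b)) \<sqsubseteq>\<^bsub>B3\<^esub> hg.comp (\<tau> c)"
        using bc by (intro hg.le_comp f.prec_mono) auto
      have 3: "hg.comp (\<tau> c) \<sqsubseteq>\<^bsub>B3\<^esub> hg_f.comp a"
        using ca by (intro hg_f.le_comp) auto
      show "\<rho> (gf.comp b) \<sqsubseteq>\<^bsub>B3\<^esub> hg_f.comp a"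
        by (rule h.target.le_trans[OF h.target.le_trans[OF 1 2] 3]) auto
    qed auto
    show "hg_f.comp a \<sqsubseteq>\<^bsub>B3\<^esub> h_gf.comp a"
    proof (rule hg_f.comp_least)
      fix b
      assume b [simp]: "b \<in> carrier B0" and ba: "b \<prec>\<^bsub>B0\<^esub> a"
      then obtain c where c [simp]: "c \<in> carrier B0" and bc: "b \<prec>\<^bsub>B0\<^esub> c" and ca: "c \<prec>\<^bsub>B0\<^esub> a"
        using f.source.DV6[of b a] by auto
      have 1: "hg.comp (\<tau> b) \<sqsubseteq>\<^bsub>B3\<^esub> \<rho> (\<sigma> (\<tau> b))"
        by (simp add: hg.comp_le)
      have 2: "\<rho> (\<sigma> (\<tau> b)) \<sqsubseteq>\<^bsub>B3\<^esub> \<rho> (gf.comp c)"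
        using bc by (intro h.mono gf.le_comp) auto
      have 3: "\<rho> (gf.comp c) \<sqsubseteq>\<^bsub>B3\<^esub> h_gf.comp a"
        using ca by (intro h_gf.le_comp) auto
      show "hg.comp (\<tau> b) \<sqsubseteq>\<^bsub>B3\<^esub> h_gf.comp a"
        by (rule h.target.le_trans[OF h.target.le_trans[OF 1 2] 3]) auto
    qed auto
  qed auto
  then show ?thesis
    by (intro extensionalityI[of _ "carrier B0"]) auto
qed

lemma DeV_simps:
  "P \<in> Ob DeV \<longleftrightarrow> de_vries_algebra P"
  "f \<in> Arr DeV P Q \<longleftrightarrow> f \<in> dv_hom P Q \<and> f \<in> extensional (carrier P)"
  "Ident DeV P = (\<lambda>a \<in> carrier P. a)"
  "Comp DeV P Q R g f = dv_comp P Q R g f"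
  by (simp_all add: DeV_def)

lemma dv_morphism_iff:
  "dv_morphism P Q f \<longleftrightarrow> de_vries_algebra P \<and> de_vries_algebra Q \<and> f \<in> dv_hom P Q"
  by (auto simp: dv_morphism_def dv_morphism_axioms_def)

lemma DeV_category: "category DeV"
proof
  fix P :: "'a dv"
  assume "P \<in> Ob DeV"
  then show "Ident DeV P \<in> Arr DeV P P"
    by (simp add: DeV_simps ident_dv_hom)
next
  fix P Q R :: "'a dv" and f g
  assume "P \<in> Ob DeV" "Q \<in> Ob DeV" "R \<in> Ob DeV" "f \<in> Arr DeV P Q" "g \<in> Arr DeV Q R"
  then interpret dv_composable P Q R f g
    by (simp add: DeV_simps dv_composable_def dv_morphism_iff)
  show "Comp DeV P Q R g f \<in> Arr DeV P R"
    using comp_hom by (simp add: DeV_simps)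
next
  fix P Q :: "'a dv" and f
  assume *: "P \<in> Ob DeV" "Q \<in> Ob DeV" "f \<in> Arr DeV P Q"
  then interpret dv_morphism P Q f
    by (simp add: DeV_simps dv_morphism_iff)
  have f: "f \<in> extensional (carrier P)"
    using * by (simp add: DeV_simps)
  \<comment> \<open>Composing with an identity on either side gives the join of all
    \<open>f b\<close> with \<open>b \<prec> a\<close>, which is \<open>f a\<close> by (M4).\<close>
  have 1: "{f ((\<lambda>a\<in>carrier P. a) b) |b. b \<in> carrier P \<and> b \<prec>\<^bsub>P\<^esub> a} =
      {f b |b. b \<in> carrier P \<and> b \<prec>\<^bsub>P\<^esub> a}" for a
    by auto
  have 2: "{(\<lambda>a\<in>carrier Q. a) (f b) |b. b \<in> carrier P \<and> b \<prec>\<^bsub>P\<^esub> a} =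
      {f b |b. b \<in> carrier P \<and> b \<prec>\<^bsub>P\<^esub> a}" for a
    using closed by (metis (no_types, lifting) restrict_apply')
  show "Comp DeV P P Q f (Ident DeV P) = f"
    unfolding DeV_simps
    by (rule extensionalityI[OF _ f]) (simp, simp only: dv_comp_def restrict_apply' 1 M4[symmetric])
  show "Comp DeV P Q Q (Ident DeV Q) f = f"
    unfolding DeV_simps
    by (rule extensionalityI[OF _ f]) (simp, simp only: dv_comp_def restrict_apply' 2 M4[symmetric])
next
  fix N P Q R :: "'a dv" and f g h
  assume "N \<in> Ob DeV" "P \<in> Ob DeV" "Q \<in> Ob DeV" "R \<in> Ob DeV"
    "f \<in> Arr DeV N P" "g \<in> Arr DeV P Q" "h \<in> Arr DeV Q R"
  then show "Comp DeV N Q R h (Comp DeV N P Q g f) = Comp DeV N P R (Comp DeV P Q R h g) f"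
    unfolding DeV_simps by (intro dv_comp_assoc) (simp_all add: dv_morphism_iff)
qed


section \<open>Booleanization of compact regular frames\<close>

locale kr_frame = frame L for L :: "'a gorder" (structure) +
  assumes compact: "compact_frame L" and regular: "regular_frame L"
begin

abbreviation B :: "'a dv" where "B \<equiv> booleanization L"

lemma sup_well_inside: "a \<in> carrier L \<Longrightarrow> \<Squnion>{b \<in> carrier L. well_inside L b a} = a"
  using regular by (simp add: regular_frame_def)

lemma booleanization_simps:
  "carrier B = regular_elements L" "le B = le L" "eq B = eq L"
  by (simp_all add: booleanization_def)

lemma prec_booleanization:
  "prec B a b \<longleftrightarrow> a \<in> regular_elements L \<and> b \<in> regular_elements L \<and> well_inside L a b"
  by (simp add: booleanization_def)

lemma regular_elements_iff: "a \<in> regular_elements L \<longleftrightarrow> a \<in> carrier L \<and> pcompl L (pcompl L a) = a"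
  by (simp add: regular_elements_def)

lemma pcompl_regular [simp]: "a \<in> carrier L \<Longrightarrow> pcompl L a \<in> regular_elements L"
  by (simp add: regular_elements_iff)

lemma meet_regular [simp]:
  "\<lbrakk>a \<in> regular_elements L; b \<in> regular_elements L\<rbrakk> \<Longrightarrow> a \<sqinter> b \<in> regular_elements L"
  by (simp add: regular_elements_iff pcompl2_meet)

lemma top_regular [simp]: "\<top> \<in> regular_elements L"
  by (simp add: regular_elements_iff)

lemma bottom_regular [simp]: "\<bottom> \<in> regular_elements L"
  by (simp add: regular_elements_iff)

lemma regular_closed [simp]: "a \<in> regular_elements L \<Longrightarrow> a \<in> carrier L"
  by (simp add: regular_elements_iff)

lemma regular_pcompl2 [simp]: "a \<in> regular_elements L \<Longrightarrow> pcompl L (pcompl L a) = a"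
  by (simp add: regular_elements_iff)

lemma regular_subset: "S \<subseteq> regular_elements L \<Longrightarrow> S \<subseteq> carrier L"
  by auto

lemma pcompl2_le:
  "\<lbrakk>a \<sqsubseteq> u; a \<in> carrier L; u \<in> regular_elements L\<rbrakk> \<Longrightarrow> pcompl L (pcompl L a) \<sqsubseteq> u"
  using pcompl2_mono[of a u] by simp

text \<open>Infima are inherited from \<open>L\<close>, since an infimum of regular elements is
  regular. Joins are not inherited; \<open>sup_booleanization\<close> shows the correction.\<close>

lemma complete_lattice_booleanization: "complete_lattice B"
proof -
  interpret B: partial_order B
    by unfold_locales (auto simp: booleanization_simps eq_is_equal intro: le_antisym le_trans)
  show ?thesis
  proof (rule B.complete_lattice_criterion1)
    show "\<exists>g. greatest B g (carrier B)"
      by (rule exI[of _ \<top>]) (auto simp: greatest_def booleanization_simps)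
  next
    fix S
    assume S: "S \<subseteq> carrier B"
    then have SL: "S \<subseteq> carrier L"
      by (auto simp: booleanization_simps)
    have "pcompl L (pcompl L (\<Sqinter>S)) \<sqsubseteq> \<Sqinter>S"
      using S SL by (intro inf_greatest pcompl2_le inf_lower) (auto simp: booleanization_simps)
    then have "\<Sqinter>S \<in> regular_elements L"
      using SL unfolding regular_elements_iff by (auto intro!: le_antisym)
    then have "greatest B (\<Sqinter>S) (Lower B S)"
      using S SL by (auto simp: greatest_def Lower_def booleanization_simps intro!: inf_lower inf_greatest)
    then show "\<exists>i. greatest B i (Lower B S)" ..
  qed
qed

sublocale B: complete_lattice B
  by (rule complete_lattice_booleanization)

lemma meet_booleanization:
  "\<lbrakk>a \<in> regular_elements L; b \<in> regular_elements L\<rbrakk> \<Longrightarrow> a \<sqinter>\<^bsub>B\<^esub> b = a \<sqinter> b"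
  by (intro B.meet_eqI) (auto simp: booleanization_simps meet_left meet_right meet_le)

lemma sup_booleanization:
  assumes "S \<subseteq> regular_elements L"
  shows "\<Squnion>\<^bsub>B\<^esub>S = pcompl L (pcompl L (\<Squnion>S))"
proof (rule B.sup_eqI)
  note S = regular_subset[OF assms]
  show "x \<sqsubseteq>\<^bsub>B\<^esub> pcompl L (pcompl L (\<Squnion>S))" if "x \<in> S" for x
    using that S by (auto simp: booleanization_simps intro!: le_trans[OF sup_upper le_pcompl2])
  show "pcompl L (pcompl L (\<Squnion>S)) \<sqsubseteq>\<^bsub>B\<^esub> u"
    if "u \<in> carrier B" "\<And>x. x \<in> S \<Longrightarrow> x \<sqsubseteq>\<^bsub>B\<^esub> u" for u
    using that S by (auto simp: booleanization_simps intro!: pcompl2_le sup_least)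
qed (use assms in \<open>auto simp: booleanization_simps\<close>)

lemma join_booleanization:
  assumes "a \<in> regular_elements L" "b \<in> regular_elements L"
  shows "a \<squnion>\<^bsub>B\<^esub> b = pcompl L (pcompl L (a \<squnion> b))"
  using sup_booleanization[of "{a, b}"] assms by (simp add: join_def)

lemma bottom_booleanization: "\<bottom>\<^bsub>B\<^esub> = \<bottom>"
  by (rule B.bottom_eqI) (auto simp: booleanization_simps)

lemma top_booleanization: "\<top>\<^bsub>B\<^esub> = \<top>"
  by (rule B.top_eqI) (auto simp: booleanization_simps)

lemma pcompl_booleanization:
  assumes a: "a \<in> regular_elements L"
  shows "pcompl B a = pcompl L a"
  unfolding pcompl_def[of B]
proof (rule B.sup_eqI)
  show "x \<sqsubseteq>\<^bsub>B\<^esub> pcompl L a" if "x \<in> {b \<in> carrier B. a \<sqinter>\<^bsub>B\<^esub> b = \<bottom>\<^bsub>B\<^esub>}" for x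
    using that a
    by (auto simp: booleanization_simps meet_booleanization bottom_booleanization le_pcompl_iff)
  show "pcompl L a \<sqsubseteq>\<^bsub>B\<^esub> u"
    if "\<And>x. x \<in> {b \<in> carrier B. a \<sqinter>\<^bsub>B\<^esub> b = \<bottom>\<^bsub>B\<^esub>} \<Longrightarrow> x \<sqsubseteq>\<^bsub>B\<^esub> u" for u
    using a by (intro that)
      (auto simp: booleanization_simps meet_booleanization bottom_booleanization)
qed (use a in \<open>auto simp: booleanization_simps\<close>)

lemma complete_boolean_algebra_booleanization: "complete_boolean_algebra B"
proof
  fix a b c
  assume "a \<in> carrier B" "b \<in> carrier B" "c \<in> carrier B"
  then have abc: "a \<in> regular_elements L" "b \<in> regular_elements L" "c \<in> regular_elements L"
    by (auto simp: booleanization_simps)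
  \<comment> \<open>Since \<open>a\<close> is its own double pseudocomplement,
    \<open>pcompl2_meet\<close> moves the outer double pseudocomplement across the meet.\<close>
  have "a \<sqinter> pcompl L (pcompl L (b \<squnion> c)) = pcompl L (pcompl L (a \<sqinter> (b \<squnion> c)))"
    using abc by (simp add: pcompl2_meet)
  then show "a \<sqinter>\<^bsub>B\<^esub> (b \<squnion>\<^bsub>B\<^esub> c) = (a \<sqinter>\<^bsub>B\<^esub> b) \<squnion>\<^bsub>B\<^esub> (a \<sqinter>\<^bsub>B\<^esub> c)"
    using abc by (simp add: join_booleanization meet_booleanization meet_join_distrib)
next
  fix a
  assume "a \<in> carrier B"
  then have a: "a \<in> regular_elements L"
    by (simp add: booleanization_simps)
  then show "\<exists>b\<in>carrier B. a \<sqinter>\<^bsub>B\<^esub> b = \<bottom>\<^bsub>B\<^esub> \<and> a \<squnion>\<^bsub>B\<^esub> b = \<top>\<^bsub>B\<^esub>"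
    by (intro bexI[of _ "pcompl L a"])
       (simp_all add: booleanization_simps meet_booleanization join_booleanization
          bottom_booleanization top_booleanization pcompl_join)
qed

lemma de_vries_algebra_booleanization: "de_vries_algebra B"
proof -
  interpret BA: complete_boolean_algebra B
    by (rule complete_boolean_algebra_booleanization)
  show ?thesis
  proof
    show "\<top>\<^bsub>B\<^esub> \<prec>\<^bsub>B\<^esub> \<top>\<^bsub>B\<^esub>"
      by (simp add: top_booleanization prec_booleanization well_inside_def)
  next
    fix a b
    assume "a \<prec>\<^bsub>B\<^esub> b"
    then have ab: "a \<in> regular_elements L" "b \<in> regular_elements L" "well_inside L a b"
      by (auto simp: prec_booleanization)
    then show "a \<sqsubseteq>\<^bsub>B\<^esub> b"
      by (simp add: booleanization_simps well_inside_le)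
    from ab show "pcompl B b \<prec>\<^bsub>B\<^esub> pcompl B a"
      by (simp add: prec_booleanization pcompl_booleanization well_inside_pcompl)
    \<comment> \<open>The interpolant of the frame need not be regular. Its double pseudocomplement
      is larger, so \<open>a\<close> stays well inside it, and it is still well inside
      \<open>b\<close>.\<close>
    obtain c where c: "c \<in> carrier L" "well_inside L a c" "well_inside L c b"
      using well_inside_interpolate[OF compact regular ab(3)] ab by auto
    let ?c = "pcompl L (pcompl L c)"
    have "well_inside L a ?c"
      using c ab by (intro well_inside_mono[of a a c ?c]) auto
    moreover have "well_inside L ?c b"
      using c by (simp add: well_inside_pcompl2)
    ultimately show "\<exists>c\<in>carrier B. a \<prec>\<^bsub>B\<^esub> c \<and> c \<prec>\<^bsub>B\<^esub> b"
      using ab c by (intro bexI[of _ ?c]) (auto simp: prec_booleanization booleanization_simps)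
  next
    fix a b c d
    assume *: "a \<in> carrier B" "d \<in> carrier B" "a \<sqsubseteq>\<^bsub>B\<^esub> b" "b \<prec>\<^bsub>B\<^esub> c" "c \<sqsubseteq>\<^bsub>B\<^esub> d"
    then show "a \<prec>\<^bsub>B\<^esub> d"
      using well_inside_mono[of a b c d] by (auto simp: booleanization_simps prec_booleanization)
  next
    fix a b c
    assume "a \<prec>\<^bsub>B\<^esub> b" "a \<prec>\<^bsub>B\<^esub> c"
    then show "a \<prec>\<^bsub>B\<^esub> b \<sqinter>\<^bsub>B\<^esub> c"
      by (auto simp: prec_booleanization meet_booleanization well_inside_meet)
  next
    fix a
    assume "a \<in> carrier B" "a \<noteq> \<bottom>\<^bsub>B\<^esub>"
    then have a: "a \<in> regular_elements L" "a \<noteq> \<bottom>"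
      by (auto simp: booleanization_simps bottom_booleanization)
    \<comment> \<open>By regularity \<open>a\<close> is the join of the elements well inside it, so
      these cannot all be bottom.\<close>
    have "\<exists>b \<in> carrier L. well_inside L b a \<and> b \<noteq> \<bottom>"
    proof (rule ccontr)
      assume "\<not> ?thesis"
      then have "\<Squnion>{b \<in> carrier L. well_inside L b a} \<sqsubseteq> \<bottom>"
        by (intro sup_least) auto
      then show False
        using a by (simp add: sup_well_inside le_bottom_iff)
    qed
    then obtain b where b: "b \<in> carrier L" "well_inside L b a" "b \<noteq> \<bottom>"
      by auto
    let ?b = "pcompl L (pcompl L b)"
    have "?b \<noteq> \<bottom>"
      using b le_pcompl2[of b] by (auto simp: le_bottom_iff simp del: le_pcompl2)
    then show "\<exists>b\<in>carrier B. b \<noteq> \<bottom>\<^bsub>B\<^esub> \<and> b \<prec>\<^bsub>B\<^esub> a"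
      using a b by (intro bexI[of _ ?b])
        (auto simp: prec_booleanization booleanization_simps bottom_booleanization well_inside_pcompl2)
  qed
qed

end

section \<open>Booleanization of frame homomorphisms\<close>

locale frame_morphism = source: kr_frame L + target: kr_frame M
  for L :: "'a gorder" and M :: "'b gorder" +
  fixes h :: "'a \<Rightarrow> 'b"
  assumes hom: "h \<in> frame_hom L M"
begin

lemma closed [simp]: "a \<in> carrier L \<Longrightarrow> h a \<in> carrier M"
  using hom unfolding frame_hom_def by blast

lemma hom_top: "h \<top>\<^bsub>L\<^esub> = \<top>\<^bsub>M\<^esub>"
  using hom unfolding frame_hom_def by blast

lemma hom_meet: "\<lbrakk>a \<in> carrier L; b \<in> carrier L\<rbrakk> \<Longrightarrow> h (a \<sqinter>\<^bsub>L\<^esub> b) = h a \<sqinter>\<^bsub>M\<^esub> h b"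
  using hom unfolding frame_hom_def by blast

lemma hom_sup: "S \<subseteq> carrier L \<Longrightarrow> h (\<Squnion>\<^bsub>L\<^esub>S) = \<Squnion>\<^bsub>M\<^esub>(h ` S)"
  using hom unfolding frame_hom_def by blast

lemma hom_bottom: "h \<bottom>\<^bsub>L\<^esub> = \<bottom>\<^bsub>M\<^esub>"
  using hom_sup[of "{}"] by simp

lemma hom_join: "\<lbrakk>a \<in> carrier L; b \<in> carrier L\<rbrakk> \<Longrightarrow> h (a \<squnion>\<^bsub>L\<^esub> b) = h a \<squnion>\<^bsub>M\<^esub> h b"
  using hom_sup[of "{a, b}"] by (simp add: join_def)

lemma hom_mono:
  "\<lbrakk>a \<sqsubseteq>\<^bsub>L\<^esub> b; a \<in> carrier L; b \<in> carrier L\<rbrakk> \<Longrightarrow> h a \<sqsubseteq>\<^bsub>M\<^esub> h b"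
  by (metis closed hom_meet source.le_iff_meet target.le_iff_meet)

lemma hom_pcompl_le: "a \<in> carrier L \<Longrightarrow> h (pcompl L a) \<sqsubseteq>\<^bsub>M\<^esub> pcompl M (h a)"
  by (simp add: target.le_pcompl_iff hom_bottom flip: hom_meet)

lemma hom_join_pcompl:
  "\<lbrakk>well_inside L a b; a \<in> carrier L; b \<in> carrier L\<rbrakk>
    \<Longrightarrow> h (pcompl L a) \<squnion>\<^bsub>M\<^esub> h b = \<top>\<^bsub>M\<^esub>"
  by (simp add: well_inside_def hom_top flip: hom_join)

lemma hom_well_inside:
  assumes "well_inside L a b" and [simp]: "a \<in> carrier L" "b \<in> carrier L"
  shows "well_inside M (h a) (h b)"
proof -
  have "h (pcompl L a) \<squnion>\<^bsub>M\<^esub> h b \<sqsubseteq>\<^bsub>M\<^esub> pcompl M (h a) \<squnion>\<^bsub>M\<^esub> h b"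
    by (intro target.join_mono hom_pcompl_le) auto
  then show ?thesis
    using assms by (simp add: well_inside_def hom_join_pcompl target.top_le_iff)
qed

abbreviation bh :: "'a \<Rightarrow> 'b" where "bh \<equiv> booleanization_map L M h"

lemma bh_eq: "a \<in> regular_elements L \<Longrightarrow> bh a = pcompl M (pcompl M (h a))"
  by (simp add: booleanization_map_def)

text \<open>Regular elements well inside \<open>a\<close> suffice to control \<open>h a\<close>:
  \<open>h\<close> preserves the join of all elements well inside \<open>a\<close>, and each of
  these may be enlarged to its double pseudocomplement. Both (M4) and the composition law are
  reduced to this.\<close>

lemma hom_le_if:
  assumes a [simp]: "a \<in> carrier L" and u: "u \<in> carrier M"
    and le: "\<And>b. \<lbrakk>b \<in> regular_elements L; well_inside L b a\<rbrakk> \<Longrightarrow> h b \<sqsubseteq>\<^bsub>M\<^esub> u"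
  shows "h a \<sqsubseteq>\<^bsub>M\<^esub> u"
proof -
  have "h b \<sqsubseteq>\<^bsub>M\<^esub> u" if b: "b \<in> carrier L" "well_inside L b a" for b
  proof (rule target.le_trans)
    show "h b \<sqsubseteq>\<^bsub>M\<^esub> h (pcompl L (pcompl L b))"
      using b by (intro hom_mono) auto
    show "h (pcompl L (pcompl L b)) \<sqsubseteq>\<^bsub>M\<^esub> u"
      using b by (intro le) (auto simp: source.well_inside_pcompl2)
  qed (use b u in auto)
  then have "\<Squnion>\<^bsub>M\<^esub>(h ` {b \<in> carrier L. well_inside L b a}) \<sqsubseteq>\<^bsub>M\<^esub> u"
    using u by (intro target.sup_least) auto
  then show ?thesis
    using hom_sup[of "{b \<in> carrier L. well_inside L b a}"] by (auto simp: source.sup_well_inside)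
qed

lemma bh_sup:
  assumes a [simp]: "a \<in> regular_elements L"
  shows "\<Squnion>\<^bsub>target.B\<^esub>{bh b | b. b \<in> carrier source.B \<and> b \<prec>\<^bsub>source.B\<^esub> a} = bh a"
proof (rule target.B.sup_eqI)
  show "{bh b | b. b \<in> carrier source.B \<and> b \<prec>\<^bsub>source.B\<^esub> a} \<subseteq> carrier target.B"
    by (auto simp: source.booleanization_simps target.booleanization_simps bh_eq)
  show "bh a \<in> carrier target.B"
    by (simp add: target.booleanization_simps bh_eq)
  show "x \<sqsubseteq>\<^bsub>target.B\<^esub> bh a" if "x \<in> {bh b | b. b \<in> carrier source.B \<and> b \<prec>\<^bsub>source.B\<^esub> a}" for x
    using that by (auto simp: source.booleanization_simps target.booleanization_simps bh_eq
        source.prec_booleanization source.well_inside_le intro!: target.pcompl2_mono hom_mono)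
  fix u
  assume "u \<in> carrier target.B"
    and *: "\<And>x. x \<in> {bh b | b. b \<in> carrier source.B \<and> b \<prec>\<^bsub>source.B\<^esub> a} \<Longrightarrow> x \<sqsubseteq>\<^bsub>target.B\<^esub> u"
  then have u: "u \<in> regular_elements M"
    by (simp add: target.booleanization_simps)
  have "h a \<sqsubseteq>\<^bsub>M\<^esub> u"
  proof (rule hom_le_if)
    fix b
    assume b: "b \<in> regular_elements L" "well_inside L b a"
    then have "bh b \<sqsubseteq>\<^bsub>target.B\<^esub> u"
      by (intro *) (auto simp: source.booleanization_simps source.prec_booleanization)
    then show "h b \<sqsubseteq>\<^bsub>M\<^esub> u"
      using b u by (auto simp: target.booleanization_simps bh_eq
          intro!: target.le_trans[of "h b" "pcompl M (pcompl M (h b))" u])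
  qed (use u in auto)
  then show "bh a \<sqsubseteq>\<^bsub>target.B\<^esub> u"
    using u by (simp add: target.booleanization_simps bh_eq target.pcompl2_le)
qed

text \<open>\<open>h\<close> carries the cover witnessing \<open>well_inside L a b\<close> to a
  cover of \<open>M\<close>. Enlarging both members to their double pseudocomplements gives (M3) as
  it reads once the complements of the booleanization are computed in \<open>M\<close>.\<close>

lemma bh_prec:
  assumes ab: "well_inside L a b" and [simp]: "a \<in> regular_elements L" "b \<in> regular_elements L"
  shows "pcompl target.B (bh (pcompl source.B a)) \<prec>\<^bsub>target.B\<^esub> bh b"
proof -
  have "h (pcompl L a) \<squnion>\<^bsub>M\<^esub> h b \<sqsubseteq>\<^bsub>M\<^esub>
      pcompl M (pcompl M (h (pcompl L a))) \<squnion>\<^bsub>M\<^esub> pcompl M (pcompl M (h b))"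
    by (intro target.join_mono) auto
  then have "well_inside M (pcompl M (h (pcompl L a))) (pcompl M (pcompl M (h b)))"
    using ab by (simp add: well_inside_def[of M] hom_join_pcompl target.top_le_iff)
  then show ?thesis
    by (simp add: source.pcompl_booleanization target.pcompl_booleanization bh_eq
        target.prec_booleanization)
qed

lemma bh_hom: "bh \<in> dv_hom source.B target.B"
  unfolding dv_hom_def
proof (intro CollectI conjI ballI impI)
  show "bh \<in> carrier source.B \<rightarrow> carrier target.B"
    by (auto simp: source.booleanization_simps target.booleanization_simps bh_eq)
  show "bh \<bottom>\<^bsub>source.B\<^esub> = \<bottom>\<^bsub>target.B\<^esub>"
    by (simp add: source.bottom_booleanization target.bottom_booleanization bh_eq hom_bottom)
  fix a
  assume "a \<in> carrier source.B"
  then have a [simp]: "a \<in> regular_elements L"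
    by (simp add: source.booleanization_simps)
  show "bh a = \<Squnion>\<^bsub>target.B\<^esub>{bh b | b. b \<in> carrier source.B \<and> b \<prec>\<^bsub>source.B\<^esub> a}"
    by (simp add: bh_sup)
  fix b
  assume "b \<in> carrier source.B"
  then have b [simp]: "b \<in> regular_elements L"
    by (simp add: source.booleanization_simps)
  show "bh (a \<sqinter>\<^bsub>source.B\<^esub> b) = bh a \<sqinter>\<^bsub>target.B\<^esub> bh b"
    by (simp add: source.meet_booleanization target.meet_booleanization bh_eq hom_meet
        target.pcompl2_meet)
  assume "a \<prec>\<^bsub>source.B\<^esub> b"
  then show "pcompl target.B (bh (pcompl source.B a)) \<prec>\<^bsub>target.B\<^esub> bh b"
    by (auto simp: source.prec_booleanization intro: bh_prec)
qed

end

lemma frame_morphism_compose: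
  assumes "frame_morphism L M h" "frame_morphism M N g"
  shows "frame_morphism L N (compose (carrier L) g h)"
proof -
  interpret h: frame_morphism L M h by fact
  interpret g: frame_morphism M N g by fact
  have "g (h (\<Squnion>\<^bsub>L\<^esub>S)) = \<Squnion>\<^bsub>N\<^esub>(compose (carrier L) g h ` S)" if S: "S \<subseteq> carrier L" for S
  proof -
    have "compose (carrier L) g h ` S = g ` h ` S"
      using S by (force simp: compose_def)
    moreover have "h ` S \<subseteq> carrier M"
      using S by auto
    ultimately show ?thesis
      using S by (simp add: h.hom_sup g.hom_sup)
  qed
  then have "compose (carrier L) g h \<in> frame_hom L N"
    unfolding frame_hom_def
    by (auto simp: compose_eq h.hom_top g.hom_top h.hom_meet g.hom_meet)
  then show ?thesis
    by unfold_locales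
qed

text \<open>The pointwise composite carries an extra double pseudocomplement between
  \<open>g\<close> and \<open>h\<close>. For \<open>b\<close> well inside \<open>a\<close> it does
  no harm: \<open>h b\<close> is well inside \<open>h a\<close>, so even its double pseudocomplement
  lies below \<open>h a\<close>. The join in \<open>dv_comp\<close> runs over just these
  \<open>b\<close>.\<close>

lemma booleanization_map_compose:
  assumes "frame_morphism L M h" "frame_morphism M N g"
  shows "booleanization_map L N (compose (carrier L) g h)
    = dv_comp (booleanization L) (booleanization M) (booleanization N)
        (booleanization_map M N g) (booleanization_map L M h)"
    (is "?gh = ?comp")
proof -
  interpret h: frame_morphism L M h by fact
  interpret g: frame_morphism M N g by fact
  interpret gh: frame_morphism L N "compose (carrier L) g h"
    using assms by (rule frame_morphism_compose)
  have gh: "?gh a = pcompl N (pcompl N (g (h a)))" if "a \<in> regular_elements L" for a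
    using that by (simp add: gh.bh_eq compose_eq)
  have g_h: "g.bh (h.bh b) = pcompl N (pcompl N (g (pcompl M (pcompl M (h b)))))"
    if "b \<in> regular_elements L" for b
    using that by (simp add: g.bh_eq h.bh_eq)
  have "?comp a = ?gh a" if a [simp]: "a \<in> regular_elements L" for a
  proof -
    have "\<Squnion>\<^bsub>g.target.B\<^esub>{g.bh (h.bh b) | b. b \<in> carrier h.source.B \<and> b \<prec>\<^bsub>h.source.B\<^esub> a} = ?gh a"
    proof (rule g.target.B.sup_eqI)
      show "{g.bh (h.bh b) | b. b \<in> carrier h.source.B \<and> b \<prec>\<^bsub>h.source.B\<^esub> a} \<subseteq> carrier g.target.B"
        by (auto simp: g.target.booleanization_simps h.source.booleanization_simps g_h)
      show "?gh a \<in> carrier g.target.B"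
        by (simp add: g.target.booleanization_simps gh)
    next
      fix x
      assume "x \<in> {g.bh (h.bh b) | b. b \<in> carrier h.source.B \<and> b \<prec>\<^bsub>h.source.B\<^esub> a}"
      then obtain b where b: "b \<in> regular_elements L" "well_inside L b a" and x: "x = g.bh (h.bh b)"
        by (auto simp: h.source.prec_booleanization)
      have "well_inside M (h b) (h a)"
        using b by (intro h.hom_well_inside) auto
      then have "pcompl M (pcompl M (h b)) \<sqsubseteq>\<^bsub>M\<^esub> h a"
        using b by (intro h.target.well_inside_le) (auto simp: h.target.well_inside_pcompl2)
      then show "x \<sqsubseteq>\<^bsub>g.target.B\<^esub> ?gh a"
        using b by (auto simp: x g_h gh g.target.booleanization_simps
            intro!: g.target.pcompl2_mono g.hom_mono)
    next
      fix u
      assume "u \<in> carrier g.target.B"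
        and *: "\<And>x. x \<in> {g.bh (h.bh b) | b. b \<in> carrier h.source.B \<and> b \<prec>\<^bsub>h.source.B\<^esub> a}
          \<Longrightarrow> x \<sqsubseteq>\<^bsub>g.target.B\<^esub> u"
      then have u: "u \<in> regular_elements N"
        by (simp add: g.target.booleanization_simps)
      have "compose (carrier L) g h a \<sqsubseteq>\<^bsub>N\<^esub> u"
      proof (rule gh.hom_le_if)
        fix b
        assume b: "b \<in> regular_elements L" "well_inside L b a"
        then have "g.bh (h.bh b) \<sqsubseteq>\<^bsub>g.target.B\<^esub> u"
          by (intro *) (auto simp: h.source.booleanization_simps h.source.prec_booleanization)
        moreover have "g (h b) \<sqsubseteq>\<^bsub>N\<^esub> g (pcompl M (pcompl M (h b)))"
          using b by (intro g.hom_mono) auto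
        then have "g (h b) \<sqsubseteq>\<^bsub>N\<^esub> g.bh (h.bh b)"
          unfolding g_h[OF b(1)] using b by (rule_tac g.target.le_trans) auto
        ultimately show "compose (carrier L) g h b \<sqsubseteq>\<^bsub>N\<^esub> u"
          using b u by (auto simp: compose_def g.target.booleanization_simps g_h
              intro: g.target.le_trans)
      qed (use u in auto)
      then show "?gh a \<sqsubseteq>\<^bsub>g.target.B\<^esub> u"
        using u by (simp add: g.target.booleanization_simps gh compose_eq g.target.pcompl2_le)
    qed
    then show ?thesis
      by (simp add: dv_comp_def h.source.booleanization_simps)
  qed
  then show ?thesis
    by (intro extensionalityI[of _ "regular_elements L"])
       (auto simp: booleanization_map_def dv_comp_def h.source.booleanization_simps)
qed

section \<open>The category of compact regular frames and the booleanization functor\<close>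

lemma KRFrm_simps:
  "P \<in> Ob KRFrm \<longleftrightarrow> kr_frame P"
  "f \<in> Arr KRFrm P Q \<longleftrightarrow> f \<in> frame_hom P Q \<and> f \<in> extensional (carrier P)"
  "Ident KRFrm P = (\<lambda>a \<in> carrier P. a)"
  "Comp KRFrm P Q R g f = compose (carrier P) g f"
  by (simp_all add: KRFrm_def kr_frame_def kr_frame_axioms_def)

lemma frame_morphism_iff:
  "frame_morphism P Q f \<longleftrightarrow> kr_frame P \<and> kr_frame Q \<and> f \<in> frame_hom P Q"
  by (auto simp: frame_morphism_def frame_morphism_axioms_def)

lemma ident_frame_hom:
  assumes "kr_frame L"
  shows "(\<lambda>a \<in> carrier L. a) \<in> frame_hom L L"
proof -
  interpret kr_frame L by fact
  have "(\<lambda>a \<in> carrier L. a) ` S = S" if "S \<subseteq> carrier L" for S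
    using that by auto
  then show ?thesis
    by (auto simp: frame_hom_def)
qed

lemma KRFrm_category: "category KRFrm"
proof
  fix P :: "'a gorder"
  assume "P \<in> Ob KRFrm"
  then show "Ident KRFrm P \<in> Arr KRFrm P P"
    by (simp add: KRFrm_simps ident_frame_hom)
next
  fix P Q R :: "'a gorder" and f g
  assume "P \<in> Ob KRFrm" "Q \<in> Ob KRFrm" "R \<in> Ob KRFrm" "f \<in> Arr KRFrm P Q" "g \<in> Arr KRFrm Q R"
  then show "Comp KRFrm P Q R g f \<in> Arr KRFrm P R"
    using frame_morphism_compose[of P Q f R g] by (simp add: KRFrm_simps frame_morphism_iff)
next
  fix P Q :: "'a gorder" and f
  assume *: "P \<in> Ob KRFrm" "Q \<in> Ob KRFrm" "f \<in> Arr KRFrm P Q"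
  then interpret frame_morphism P Q f
    by (simp add: KRFrm_simps frame_morphism_iff)
  have f: "f \<in> extensional (carrier P)"
    using * by (simp add: KRFrm_simps)
  show "Comp KRFrm P P Q f (Ident KRFrm P) = f"
    unfolding KRFrm_simps by (rule extensionalityI[OF _ f]) (auto simp: compose_def)
  show "Comp KRFrm P Q Q (Ident KRFrm Q) f = f"
    unfolding KRFrm_simps by (rule extensionalityI[OF _ f]) (auto simp: compose_def)
next
  fix N P Q R :: "'a gorder" and f g h
  assume "N \<in> Ob KRFrm" "P \<in> Ob KRFrm" "Q \<in> Ob KRFrm" "R \<in> Ob KRFrm"
    and f: "f \<in> Arr KRFrm N P" "g \<in> Arr KRFrm P Q" "h \<in> Arr KRFrm Q R"
  have "f \<in> carrier N \<rightarrow> carrier P"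
    using f by (auto simp: KRFrm_simps frame_hom_def)
  then show "Comp KRFrm N Q R h (Comp KRFrm N P Q g f) = Comp KRFrm N P R (Comp KRFrm P Q R h g) f"
    unfolding KRFrm_simps by (rule compose_assoc)
qed

lemma Booleanization_functor: "covariant_functor KRFrm DeV Booleanization"
  unfolding covariant_functor_def covariant_functor_axioms_def
proof (intro conjI KRFrm_category DeV_category allI impI)
  fix P :: "'a gorder"
  assume P: "P \<in> Ob KRFrm"
  then interpret kr_frame P
    by (simp add: KRFrm_simps)
  show "omap Booleanization P \<in> Ob DeV"
    by (simp add: Booleanization_def DeV_simps de_vries_algebra_booleanization)
  show "amap Booleanization P P (Ident KRFrm P) = Ident DeV (omap Booleanization P)"
    by (auto simp: Booleanization_def KRFrm_simps DeV_simps booleanization_simps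
        booleanization_map_def intro!: restrict_ext)
next
  fix P Q :: "'a gorder" and f
  assume "P \<in> Ob KRFrm" "Q \<in> Ob KRFrm" "f \<in> Arr KRFrm P Q"
  then interpret frame_morphism P Q f
    by (simp add: KRFrm_simps frame_morphism_iff)
  show "amap Booleanization P Q f \<in> Arr DeV (omap Booleanization P) (omap Booleanization Q)"
    using bh_hom
    by (simp add: Booleanization_def DeV_simps source.booleanization_simps booleanization_map_def)
next
  fix P Q R :: "'a gorder" and f g
  assume "P \<in> Ob KRFrm" "Q \<in> Ob KRFrm" "R \<in> Ob KRFrm" "f \<in> Arr KRFrm P Q" "g \<in> Arr KRFrm Q R"
  then show "amap Booleanization P R (Comp KRFrm P Q R g f) =
      Comp DeV (omap Booleanization P) (omap Booleanization Q) (omap Booleanization R)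
        (amap Booleanization Q R g) (amap Booleanization P Q f)"
    using booleanization_map_compose[of P Q f R g]
    by (simp add: KRFrm_simps DeV_simps frame_morphism_iff Booleanization_def)
qed


section \<open>Bounded archimedean lattice-ordered algebras\<close>

context l_algebra
begin

abbreviation scal :: "real \<Rightarrow> 'a" where "scal r \<equiv> r \<odot> \<one>"

text \<open>The inherited scalar laws speak of the record \<open>ring_of_type_algebra\<close>; in
  this form the scalars are computed by real arithmetic.\<close>

lemma smult_real:
  "x \<in> carrier A \<Longrightarrow> r \<odot> x \<in> carrier A"
  "x \<in> carrier A \<Longrightarrow> (r + s) \<odot> x = r \<odot> x \<oplus> s \<odot> x"
  "x \<in> carrier A \<Longrightarrow> (r * s) \<odot> x = r \<odot> (s \<odot> x)"
  "x \<in> carrier A \<Longrightarrow> 1 \<odot> x = x"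
  "x \<in> carrier A \<Longrightarrow> 0 \<odot> x = \<zero>"
  "x \<in> carrier A \<Longrightarrow> y \<in> carrier A \<Longrightarrow> r \<odot> x \<otimes> y = r \<odot> (x \<otimes> y)"
  using smult_closed[of r x] smult_l_distr[of r s x] smult_assoc1[of r s x] smult_one[of x]
    smult_l_null[of x] smult_assoc2[of r x y]
  by (simp_all add: ring_of_type_algebra_def)

lemma scal_closed [simp]: "scal r \<in> carrier A"
  by (simp add: smult_real)

lemma scal_0 [simp]: "scal 0 = \<zero>"
  by (simp add: smult_real)

lemma scal_1 [simp]: "scal 1 = \<one>"
  by (simp add: smult_real)

lemma scal_add: "scal r \<oplus> scal s = scal (r + s)"
  by (simp add: smult_real)

lemma scal_mult: "scal r \<otimes> scal s = scal (r * s)"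
  by (simp add: smult_real)

lemma scal_mult_mult: "x \<in> carrier A \<Longrightarrow> scal r \<otimes> (scal s \<otimes> x) = scal (r * s) \<otimes> x"
  by (simp flip: scal_mult m_assoc)

lemma scal_half_double: "x \<in> carrier A \<Longrightarrow> scal (1/2) \<otimes> (x \<oplus> x) = x"
  by (simp add: r_distr scal_add flip: l_distr)

lemma scal_diff: "scal r \<ominus> scal s = scal (r - s)"
proof -
  have "scal r = scal (r - s) \<oplus> scal s"
    by (simp add: scal_add)
  then show ?thesis
    using scal_closed by algebra
qed

lemma add_pow_eq_scal: "x \<in> carrier A \<Longrightarrow> add_pow A (n::nat) x = scal (real n) \<otimes> x"
proof (induction n)
  case (Suc n)
  have "scal (real (Suc n)) = scal (real n) \<oplus> \<one>"
    using scal_add[of "real n" 1] by (simp add: add.commute)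
  then show ?case
    using Suc by (simp add: add.nat_pow_Suc l_distr)
qed simp

sublocale ord: lattice "order_of A"
  by (rule lattice_order)

lemma order_of_simps [simp]: "carrier (order_of A) = carrier A" "le (order_of A) = ale A"
  by (simp_all add: order_of_def)

lemma le_refl [simp]: "a \<in> carrier A \<Longrightarrow> a \<preceq> a"
  using ord.le_refl by simp

lemma le_trans: "\<lbrakk>a \<preceq> b; b \<preceq> c; a \<in> carrier A; b \<in> carrier A; c \<in> carrier A\<rbrakk> \<Longrightarrow> a \<preceq> c"
  using ord.le_trans by simp

lemma le_antisym: "\<lbrakk>a \<preceq> b; b \<preceq> a; a \<in> carrier A; b \<in> carrier A\<rbrakk> \<Longrightarrow> a = b"
  using ord.le_antisym by simp

lemma le_iff_diff:
  assumes [simp]: "a \<in> carrier A" "b \<in> carrier A"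
  shows "a \<preceq> b \<longleftrightarrow> \<zero> \<preceq> b \<ominus> a"
proof
  assume "a \<preceq> b"
  then have "a \<oplus> \<ominus> a \<preceq> b \<oplus> \<ominus> a"
    by (intro add_mono) auto
  then show "\<zero> \<preceq> b \<ominus> a"
    by (simp add: r_neg minus_eq)
next
  assume "\<zero> \<preceq> b \<ominus> a"
  then have "\<zero> \<oplus> a \<preceq> (b \<ominus> a) \<oplus> a"
    by (intro add_mono) auto
  moreover have "(b \<ominus> a) \<oplus> a = b"
    using assms by algebra
  ultimately show "a \<preceq> b"
    by simp
qed

text \<open>An inequality depends only on the difference of its sides. This lets a known inequality
  be rearranged by a ring identity, which \<open>algebra\<close> proves.\<close>

lemma le_if_diff_eq:
  "\<lbrakk>a \<preceq> b; b \<ominus> a = d \<ominus> c; a \<in> carrier A; b \<in> carrier A; c \<in> carrier A; d \<in> carrier A\<rbrakk>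
    \<Longrightarrow> c \<preceq> d"
  by (simp add: le_iff_diff)

lemma add_le:
  assumes "a \<preceq> c" "b \<preceq> d"
    and [simp]: "a \<in> carrier A" "b \<in> carrier A" "c \<in> carrier A" "d \<in> carrier A"
  shows "a \<oplus> b \<preceq> c \<oplus> d"
proof (rule le_trans)
  show "a \<oplus> b \<preceq> c \<oplus> b"
    using assms by (intro add_mono) auto
  have "b \<oplus> c \<preceq> d \<oplus> c"
    using assms by (intro add_mono) auto
  then show "c \<oplus> b \<preceq> c \<oplus> d"
    by (simp add: a_comm)
qed auto

lemma add_nonneg:
  "\<lbrakk>\<zero> \<preceq> a; \<zero> \<preceq> b; a \<in> carrier A; b \<in> carrier A\<rbrakk> \<Longrightarrow> \<zero> \<preceq> a \<oplus> b"
  using add_le[of \<zero> a \<zero> b] by simp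

lemma mult_left_mono:
  assumes "a \<preceq> b" "\<zero> \<preceq> c" and [simp]: "a \<in> carrier A" "b \<in> carrier A" "c \<in> carrier A"
  shows "c \<otimes> a \<preceq> c \<otimes> b"
proof -
  have "\<zero> \<preceq> c \<otimes> (b \<ominus> a)"
    using assms by (intro mult_nonneg) (auto simp flip: le_iff_diff)
  moreover have "c \<otimes> (b \<ominus> a) = c \<otimes> b \<ominus> c \<otimes> a"
    using assms(3-) by algebra
  ultimately show ?thesis
    by (simp add: le_iff_diff[of "c \<otimes> a"])
qed

end

section \<open>Positive and negative parts, squares and absolute values\<close>

locale bal = l_algebra A for A :: "'a lalg" (structure) +
  assumes bounded: "bounded_lalg A" and archimedean: "archimedean_lalg A"
begin

lemma exists_scal_ge:
  assumes "a \<in> carrier A"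
  obtains m where "m \<ge> 1" "a \<preceq> scal m"
proof -
  obtain n :: nat where "n \<ge> 1" "a \<preceq> add_pow A n \<one>"
    using bounded assms unfolding bounded_lalg_def by blast
  then show ?thesis
    by (intro that[of "real n"]) (auto simp: add_pow_eq_scal)
qed

text \<open>Boundedness applied to zero puts zero below a positive multiple of
  \<open>\<one>\<close>, which is then divided out.\<close>

lemma one_nonneg: "\<zero> \<preceq> \<one>"
proof -
  obtain m where m: "m \<ge> 1" "\<zero> \<preceq> scal m"
    by (rule exists_scal_ge[of \<zero>]) auto
  have "\<zero> \<preceq> (1/m) \<odot> scal m"
    using m by (intro smult_nonneg[of "scal m"]) auto
  moreover have "(1/m) \<odot> scal m = \<one>"
    using m(1) by (simp flip: smult_real(3))
  ultimately show ?thesis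
    by simp
qed

lemma scal_nonneg: "0 \<le> r \<Longrightarrow> \<zero> \<preceq> scal r"
  by (intro smult_nonneg one_nonneg) auto

lemma scal_mono: "r \<le> s \<Longrightarrow> scal r \<preceq> scal s"
  by (simp add: le_iff_diff[of "scal r"] scal_diff scal_nonneg)

text \<open>\<open>p\<close> and \<open>q\<close> are the positive and negative parts of
  \<open>c\<close>. That their product vanishes comes from boundedness: up to a positive factor it
  is a common lower bound of \<open>p\<close> and \<open>q\<close>, and such a bound is at most
  zero.\<close>

lemma exists_pos_neg_parts:
  assumes c [simp]: "c \<in> carrier A"
  obtains p q where "p \<in> carrier A" "q \<in> carrier A" "\<zero> \<preceq> p" "\<zero> \<preceq> q" "c = p \<ominus> q"
    "p \<otimes> q = \<zero>" "labs A c = p \<oplus> q"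
    "\<And>u. \<lbrakk>u \<in> carrier A; c \<preceq> u; \<zero> \<preceq> u\<rbrakk> \<Longrightarrow> p \<preceq> u"
proof
  define p where "p = c \<squnion>\<^bsub>order_of A\<^esub> \<zero>"
  define q where "q = p \<ominus> c"
  show p [simp]: "p \<in> carrier A"
    using ord.join_closed[of c \<zero>] by (simp add: p_def)
  show q [simp]: "q \<in> carrier A"
    by (simp add: q_def)
  have cp: "c \<preceq> p"
    using ord.join_left[of c \<zero>] by (simp add: p_def)
  show p0: "\<zero> \<preceq> p"
    using ord.join_right[of c \<zero>] by (simp add: p_def)
  show q0: "\<zero> \<preceq> q"
    using cp by (simp add: q_def flip: le_iff_diff)
  show "c = p \<ominus> q"
    unfolding q_def using p c by algebra
  show least: "p \<preceq> u" if "u \<in> carrier A" "c \<preceq> u" "\<zero> \<preceq> u" for u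
    using that ord.join_le[of c u \<zero>] by (simp add: p_def)
  \<comment> \<open>A common lower bound \<open>m\<close> leaves \<open>p - m\<close> above both
    \<open>c\<close> and zero, so leastness of \<open>p\<close> gives
    \<open>p \<preceq> p - m\<close>.\<close>
  have disjoint: "m \<preceq> \<zero>" if m [simp]: "m \<in> carrier A" and "m \<preceq> p" "m \<preceq> q" for m
  proof -
    have "c \<preceq> p \<ominus> m"
      by (rule le_if_diff_eq[OF \<open>m \<preceq> q\<close>], unfold q_def) (use p c m in \<open>algebra, simp_all\<close>)
    moreover have "\<zero> \<preceq> p \<ominus> m"
      using \<open>m \<preceq> p\<close> by (simp flip: le_iff_diff)
    ultimately have "p \<preceq> p \<ominus> m"
      by (intro least) auto
    then show ?thesis
      by (rule le_if_diff_eq) (use p m in \<open>algebra, simp_all\<close>)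
  qed
  obtain m1 where m1: "m1 \<ge> 1" "p \<preceq> scal m1"
    by (rule exists_scal_ge[OF p])
  obtain m2 where m2: "m2 \<ge> 1" "q \<preceq> scal m2"
    by (rule exists_scal_ge[OF q])
  define m where "m = max m1 m2"
  have m: "m > 0" "p \<preceq> scal m" "q \<preceq> scal m"
    using m1 m2 scal_mono by (auto simp: m_def intro: le_trans)
  \<comment> \<open>Dividing by a common bound \<open>m\<close> makes either factor at most 1, so
    \<open>?r\<close> lies below the other factor.\<close>
  let ?r = "scal (1/m) \<otimes> (p \<otimes> q)"
  have inv: "scal (1/m) \<otimes> (scal m \<otimes> x) = x" if "x \<in> carrier A" for x
    using m(1) that by (simp add: scal_mult_mult)
  have "?r \<preceq> scal (1/m) \<otimes> (p \<otimes> scal m)"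
    using m p0 by (intro mult_left_mono scal_nonneg) auto
  then have "?r \<preceq> p"
    using inv by (simp add: m_comm[of p "scal m"])
  moreover have "?r \<preceq> scal (1/m) \<otimes> (q \<otimes> scal m)"
    unfolding m_comm[OF p q] using m q0 by (intro mult_left_mono scal_nonneg) auto
  then have "?r \<preceq> q"
    using inv by (simp add: m_comm[of q "scal m"])
  ultimately have "?r \<preceq> \<zero>"
    by (intro disjoint) auto
  then have "scal m \<otimes> ?r \<preceq> scal m \<otimes> \<zero>"
    using m by (intro mult_left_mono scal_nonneg) auto
  then have "p \<otimes> q \<preceq> \<zero>"
    using m(1) by (simp add: scal_mult_mult)
  then show "p \<otimes> q = \<zero>"
    using mult_nonneg[OF p q p0 q0] by (intro le_antisym) auto
  show "labs A c = p \<oplus> q"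
    unfolding labs_def
  proof (rule ord.le_antisym, simp_all)
    have "c \<preceq> p \<oplus> q"
      by (rule le_if_diff_eq[OF add_nonneg[OF q0 q0 q q]], unfold q_def)
         (use p c in \<open>algebra, simp_all\<close>)
    moreover have "\<ominus> c \<preceq> p \<oplus> q"
      by (rule le_if_diff_eq[OF add_nonneg[OF p0 p0 p p]], unfold q_def)
         (use p c in \<open>algebra, simp_all\<close>)
    ultimately show "c \<squnion>\<^bsub>order_of A\<^esub> \<ominus> c \<preceq> p \<oplus> q"
      using ord.join_le[of c "p \<oplus> q" "\<ominus> c"] by simp
    define u where "u = c \<squnion>\<^bsub>order_of A\<^esub> \<ominus> c"
    have u [simp]: "u \<in> carrier A" "c \<preceq> u" "\<ominus> c \<preceq> u"
      using ord.join_closed[of c "\<ominus> c"] ord.join_left[of c "\<ominus> c"] ord.join_right[of c "\<ominus> c"]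
      by (simp_all add: u_def)
    \<comment> \<open>As \<open>p + q = 2 p - c\<close>, the goal \<open>p + q \<preceq> u\<close>
      amounts to \<open>p \<preceq> (u + c) / 2\<close>. The right side dominates \<open>c\<close>
      because \<open>c \<preceq> u\<close>, and zero because \<open>- c \<preceq> u\<close>.\<close>
    have "p \<preceq> scal (1/2) \<otimes> (u \<oplus> c)"
    proof (rule least)
      have "scal (1/2) \<otimes> (c \<oplus> c) \<preceq> scal (1/2) \<otimes> (u \<oplus> c)"
        by (intro mult_left_mono add_mono scal_nonneg) auto
      then show "c \<preceq> scal (1/2) \<otimes> (u \<oplus> c)"
        by (simp add: scal_half_double)
      have "\<ominus> c \<oplus> c \<preceq> u \<oplus> c"
        by (intro add_mono) auto
      then have "\<zero> \<preceq> u \<oplus> c"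
        by (simp add: l_neg)
      then show "\<zero> \<preceq> scal (1/2) \<otimes> (u \<oplus> c)"
        by (intro mult_nonneg scal_nonneg) auto
    qed auto
    then have "p \<oplus> p \<preceq> scal (1/2) \<otimes> (u \<oplus> c) \<oplus> scal (1/2) \<otimes> (u \<oplus> c)"
      by (intro add_le) auto
    then have "p \<oplus> p \<preceq> u \<oplus> c"
      by (simp add: scal_half_double flip: r_distr)
    then show "p \<oplus> q \<preceq> c \<squnion>\<^bsub>order_of A\<^esub> \<ominus> c"
      unfolding u_def[symmetric]
      by (rule le_if_diff_eq, unfold q_def) (use p c u(1) in \<open>algebra, simp_all\<close>)
    show "c \<squnion>\<^bsub>order_of A\<^esub> \<ominus> c \<in> carrier A"
      using u(1) by (simp add: u_def)
  qed
qed

lemma square_nonneg: "x \<in> carrier A \<Longrightarrow> \<zero> \<preceq> x \<otimes> x"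
proof -
  assume x: "x \<in> carrier A"
  obtain p q where pq: "p \<in> carrier A" "q \<in> carrier A" "\<zero> \<preceq> p" "\<zero> \<preceq> q" "x = p \<ominus> q"
    "p \<otimes> q = \<zero>"
    by (rule exists_pos_neg_parts[OF x])
  have "(p \<ominus> q) \<otimes> (p \<ominus> q) = p \<otimes> p \<oplus> q \<otimes> q \<ominus> (p \<otimes> q \<oplus> p \<otimes> q)"
    using pq(1,2) by algebra
  then have "x \<otimes> x = p \<otimes> p \<oplus> q \<otimes> q"
    using pq by (simp add: minus_eq)
  then show ?thesis
    using pq by (simp add: add_nonneg mult_nonneg)
qed

text \<open>\<open>(p - q)^2\<close> and \<open>(p + q)^2\<close> agree because \<open>p q\<close>
  vanishes. The equality of squares is what allows conditions on absolute values to be restated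
  through squares.\<close>

lemma labs_facts:
  assumes x [simp]: "x \<in> carrier A"
  shows labs_closed: "labs A x \<in> carrier A"
    and labs_nonneg: "\<zero> \<preceq> labs A x"
    and le_labs: "x \<preceq> labs A x"
    and labs_square: "labs A x \<otimes> labs A x = x \<otimes> x"
proof -
  obtain p q where pq: "p \<in> carrier A" "q \<in> carrier A" "\<zero> \<preceq> p" "\<zero> \<preceq> q" "x = p \<ominus> q"
    "p \<otimes> q = \<zero>" "labs A x = p \<oplus> q"
    by (rule exists_pos_neg_parts[OF x])
  show "labs A x \<in> carrier A" "\<zero> \<preceq> labs A x"
    using pq by (simp_all add: add_nonneg)
  show "x \<preceq> labs A x"
    unfolding pq(7)
    by (rule le_if_diff_eq[OF add_nonneg[OF pq(4,4,2,2)]], unfold pq(5))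
       (use pq(1,2) in \<open>algebra, simp_all\<close>)
  have "(p \<ominus> q) \<otimes> (p \<ominus> q) = p \<otimes> p \<oplus> q \<otimes> q \<ominus> (p \<otimes> q \<oplus> p \<otimes> q)"
    using pq(1,2) by algebra
  moreover have "(p \<oplus> q) \<otimes> (p \<oplus> q) = p \<otimes> p \<oplus> q \<otimes> q \<oplus> (p \<otimes> q \<oplus> p \<otimes> q)"
    using pq(1,2) by algebra
  ultimately show "labs A x \<otimes> labs A x = x \<otimes> x"
    using pq by (simp add: minus_eq)
qed

section \<open>Smallness modulo an ideal\<close>

text \<open>For an ideal \<open>I\<close> this says that the class of \<open>x\<close> in
  \<open>A/I\<close> lies below every positive constant. Working with representatives keeps the
  quotient out of the proofs.\<close>

definition below :: "'a set \<Rightarrow> 'a \<Rightarrow> bool" where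
  "below I x \<longleftrightarrow> (\<forall>e > 0. \<exists>i \<in> I. x \<preceq> scal e \<oplus> i)"

lemma belowI: "(\<And>e. e > 0 \<Longrightarrow> \<exists>i \<in> I. x \<preceq> scal e \<oplus> i) \<Longrightarrow> below I x"
  by (simp add: below_def)

lemma belowD:
  assumes "below I x" "e > 0"
  obtains i where "i \<in> I" "x \<preceq> scal e \<oplus> i"
  using assms by (auto simp: below_def)

lemma below_mono:
  assumes "x \<preceq> y" "below I y" "I \<subseteq> J" and [simp]: "I \<subseteq> carrier A" "x \<in> carrier A" "y \<in> carrier A"
  shows "below J x"
proof (rule belowI)
  fix e :: real
  assume "e > 0"
  then obtain i where i: "i \<in> I" "y \<preceq> scal e \<oplus> i"
    using assms(2) by (auto elim: belowD)
  then have "x \<preceq> scal e \<oplus> i"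
    using assms by (rule_tac le_trans[of x y]) (auto simp: subset_iff)
  then show "\<exists>i \<in> J. x \<preceq> scal e \<oplus> i"
    using i assms by auto
qed

lemma below_mem: "\<lbrakk>x \<in> I; I \<subseteq> carrier A\<rbrakk> \<Longrightarrow> below I x"
proof (rule belowI)
  fix e :: real
  assume "x \<in> I" "I \<subseteq> carrier A" "e > 0"
  then show "\<exists>i \<in> I. x \<preceq> scal e \<oplus> i"
    using add_le[of \<zero> "scal e" x x] scal_nonneg[of e] by (intro bexI[of _ x]) auto
qed

lemma below_add:
  assumes "below I x" "below I y" "ideal I A" and [simp]: "x \<in> carrier A" "y \<in> carrier A"
  shows "below I (x \<oplus> y)"
proof (rule belowI)
  interpret I: ideal I A by fact
  fix e :: real
  assume "e > 0"
  then obtain i j where i: "i \<in> I" "x \<preceq> scal (e/2) \<oplus> i" and j: "j \<in> I" "y \<preceq> scal (e/2) \<oplus> j"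
    using assms(1,2) by (meson belowD half_gt_zero)
  have [simp]: "i \<in> carrier A" "j \<in> carrier A"
    using i j by auto
  have "x \<oplus> y \<preceq> (scal (e/2) \<oplus> i) \<oplus> (scal (e/2) \<oplus> j)"
    using i j by (intro add_le) auto
  also have "\<dots> = (scal (e/2) \<oplus> scal (e/2)) \<oplus> (i \<oplus> j)"
    using \<open>i \<in> carrier A\<close> \<open>j \<in> carrier A\<close> scal_closed[of "e/2"] by algebra
  also have "\<dots> = scal e \<oplus> (i \<oplus> j)"
    by (simp add: scal_add)
  finally show "\<exists>i \<in> I. x \<oplus> y \<preceq> scal e \<oplus> i"
    using i j by (intro bexI[of _ "i \<oplus> j"]) auto
qed

text \<open>The multiplier is at most a constant \<open>m\<close>, so precision \<open>e/m\<close>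
  for \<open>x\<close> gives precision \<open>e\<close> for the product. Two sets occur because
  multiplication may lead from one ideal into another, as from a residual of \<open>M\<close> into
  \<open>M\<close>.\<close>

lemma below_mult:
  assumes "below I x" "\<And>i. i \<in> I \<Longrightarrow> a \<otimes> i \<in> J" "I \<subseteq> carrier A" "J \<subseteq> carrier A" "\<zero> \<preceq> a"
    and [simp]: "a \<in> carrier A" "x \<in> carrier A"
  shows "below J (a \<otimes> x)"
proof (rule belowI)
  fix e :: real
  assume e: "e > 0"
  obtain m where m: "m \<ge> 1" "a \<preceq> scal m"
    by (rule exists_scal_ge[of a]) auto
  obtain i where i: "i \<in> I" "x \<preceq> scal (e/m) \<oplus> i"
    using assms(1) e m by (metis belowD divide_pos_pos less_le_trans zero_less_one)
  have [simp]: "i \<in> carrier A" "a \<otimes> i \<in> carrier A"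
    using i assms by auto
  have "a \<otimes> x \<preceq> a \<otimes> (scal (e/m) \<oplus> i)"
    using i assms by (intro mult_left_mono) auto
  moreover have "scal (e/m) \<otimes> a \<preceq> scal (e/m) \<otimes> scal m"
    using m e by (intro mult_left_mono scal_nonneg) auto
  then have "scal (e/m) \<otimes> a \<oplus> a \<otimes> i \<preceq> scal e \<oplus> a \<otimes> i"
    using m by (intro add_mono) (auto simp: scal_mult)
  then have "a \<otimes> (scal (e/m) \<oplus> i) \<preceq> scal e \<oplus> a \<otimes> i"
    by (simp add: r_distr m_comm)
  ultimately have "a \<otimes> x \<preceq> scal e \<oplus> a \<otimes> i"
    by (rule le_trans) auto
  then show "\<exists>i \<in> J. a \<otimes> x \<preceq> scal e \<oplus> i"
    using i assms by auto
qed

text \<open>Expands \<open>(c x - d)^2 \<ge> 0\<close>, where \<open>2 c d = 1\<close> makes the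
  linear term exactly \<open>x\<close>. A small \<open>d\<close> gives a small constant at the price
  of a large factor \<open>c^2\<close>, which is harmless once \<open>x^2\<close> is arbitrarily
  small modulo an ideal.\<close>

lemma le_square:
  assumes x [simp]: "x \<in> carrier A" and cd: "2 * c * d = 1"
  shows "x \<preceq> scal (d * d) \<oplus> scal (c * c) \<otimes> (x \<otimes> x)"
proof -
  let ?y = "scal c \<otimes> x \<ominus> scal d"
  have "?y \<otimes> ?y = scal c \<otimes> scal c \<otimes> (x \<otimes> x) \<ominus> (scal c \<otimes> scal d \<oplus> scal c \<otimes> scal d) \<otimes> x
      \<oplus> scal d \<otimes> scal d"
    using x scal_closed[of c] scal_closed[of d] by algebra
  also have "\<dots> = scal (c * c) \<otimes> (x \<otimes> x) \<ominus> x \<oplus> scal (d * d)"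
    using cd by (simp add: scal_mult scal_add algebra_simps)
  finally have "\<zero> \<preceq> scal (c * c) \<otimes> (x \<otimes> x) \<ominus> x \<oplus> scal (d * d)"
    using square_nonneg[of ?y] by simp
  then show ?thesis
    by (rule le_if_diff_eq) (use x scal_closed[of "c * c"] scal_closed[of "d * d"] in \<open>algebra, simp_all\<close>)
qed

text \<open>Multiplying the bound for \<open>e = 1/n\<close> by \<open>n\<close> gives
  \<open>n a \<preceq> \<one>\<close> for every \<open>n\<close>, to which the archimedean property
  applies.\<close>

lemma le_zero_if_small:
  assumes a [simp]: "a \<in> carrier A" and small: "\<And>e. e > 0 \<Longrightarrow> a \<preceq> scal e"
  shows "a \<preceq> \<zero>"
proof -
  have "add_pow A n a \<preceq> \<one>" if n: "n \<ge> 1" for n :: nat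
  proof -
    have "scal (real n) \<otimes> a \<preceq> scal (real n) \<otimes> scal (1 / real n)"
      using n by (intro mult_left_mono small scal_nonneg) auto
    then show ?thesis
      using n by (simp add: add_pow_eq_scal scal_mult)
  qed
  then show ?thesis
    by (intro archimedean[unfolded archimedean_lalg_def, rule_format, OF a one_closed])
qed

lemma square_eq_zero:
  assumes x: "x \<in> carrier A" and xx: "x \<otimes> x = \<zero>"
  shows "x = \<zero>"
proof -
  have le: "y \<preceq> \<zero>" if y: "y \<in> carrier A" "y \<otimes> y = \<zero>" for y
  proof (rule le_zero_if_small)
    fix e :: real
    assume e: "e > 0"
    \<comment> \<open>Capping at 1 ensures \<open>d * d \<le> e\<close> without a square
      root.\<close>
    define d where "d = min e 1"
    have d: "d > 0" "d * d \<le> e"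
      using e mult_mono[of d e d 1] by (auto simp: d_def)
    have "y \<preceq> scal (d * d)"
      using le_square[of y "1 / (2 * d)" d] y d by simp
    then show "y \<preceq> scal e"
      using scal_mono[OF d(2)] y by (auto intro: le_trans)
  qed (use y in simp)
  have "\<ominus> x \<otimes> \<ominus> x = \<zero>"
    using x xx by (simp add: l_minus r_minus)
  then have "\<ominus> x \<preceq> \<zero>"
    using x by (intro le) auto
  then have "\<zero> \<preceq> x"
    by (rule le_if_diff_eq) (use x in \<open>algebra, simp_all\<close>)
  then show ?thesis
    using le[OF x xx] x by (intro le_antisym) auto
qed

section \<open>Characterization of archimedean l-ideals\<close>

definition closed_ideal :: "'a set \<Rightarrow> bool" where
  "closed_ideal I \<longleftrightarrow> ideal I A \<and> (\<forall>x \<in> carrier A. below I (x \<otimes> x) \<longrightarrow> x \<in> I)"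

lemma closed_ideal_ideal: "closed_ideal I \<Longrightarrow> ideal I A"
  by (simp add: closed_ideal_def)

lemma closed_ideal_subset: "closed_ideal I \<Longrightarrow> I \<subseteq> carrier A"
  by (simp add: closed_ideal_def ideal.axioms(1) additive_subgroup.a_subset)

lemma closed_idealD: "\<lbrakk>closed_ideal I; below I (x \<otimes> x); x \<in> carrier A\<rbrakk> \<Longrightarrow> x \<in> I"
  by (simp add: closed_ideal_def)

lemma closed_ideal_square: "\<lbrakk>closed_ideal I; x \<otimes> x \<in> I; x \<in> carrier A\<rbrakk> \<Longrightarrow> x \<in> I"
  by (rule closed_idealD[OF _ below_mem[OF _ closed_ideal_subset]])

text \<open>Cosets are compared through some pair of representatives, and the discrepancy can be
  collected into a single \<open>i \<in> I\<close> on the right.\<close>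

lemma archimedean_quot_iff:
  assumes I: "ideal I A"
  shows "archimedean_lalg (lalg_quot A I) \<longleftrightarrow>
    (\<forall>a \<in> carrier A. \<forall>b \<in> carrier A.
      (\<forall>n::nat. n \<ge> 1 \<longrightarrow> (\<exists>i \<in> I. scal (real n) \<otimes> a \<preceq> b \<oplus> i)) \<longrightarrow> (\<exists>i \<in> I. a \<preceq> i))"
proof -
  interpret I: ideal I A by fact
  let ?Q = "lalg_quot A I"
  have carrier: "carrier ?Q = (+>) I ` carrier A"
    by (auto simp: lalg_quot_def FactRing_def A_RCOSETS_def')
  have coset: "u \<in> I +> a \<longleftrightarrow> (\<exists>i \<in> I. u = i \<oplus> a)" for u a
    by (auto simp: a_r_coset_def')
  have pow: "add_pow ?Q n (I +> a) = I +> (scal (real n) \<otimes> a)" if a: "a \<in> carrier A" for n :: nat and a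
  proof -
    have "add_pow ?Q n (I +> a) = I +> (add_pow A n a)"
    proof (induction n)
      case 0
      then show ?case
        using I.a_rcos_const[OF I.zero_closed] by (simp add: add_pow_def nat_pow_def lalg_quot_def FactRing_def)
    next
      case (Suc n)
      have "add_pow ?Q (Suc n) (I +> a) = (add_pow ?Q n (I +> a)) <+> (I +> a)"
        by (simp add: add_pow_def nat_pow_def lalg_quot_def FactRing_def)
      then show ?case
        using Suc a by (simp add: I.a_rcos_sum add.nat_pow_Suc)
    qed
    then show ?thesis
      using a by (simp add: add_pow_eq_scal)
  qed
  have le: "ale ?Q (I +> a) (I +> b) \<longleftrightarrow> (\<exists>i \<in> I. a \<preceq> b \<oplus> i)"
    if a [simp]: "a \<in> carrier A" and b [simp]: "b \<in> carrier A" for a b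
  proof
    assume "ale ?Q (I +> a) (I +> b)"
    then obtain i j where ij: "i \<in> I" "j \<in> I" and le: "i \<oplus> a \<preceq> j \<oplus> b"
      by (auto simp: lalg_quot_def coset)
    have "a \<preceq> b \<oplus> (j \<ominus> i)"
      using le by (rule le_if_diff_eq) (use a b ij[THEN I.a_Hcarr] in \<open>algebra, simp_all\<close>)
    then show "\<exists>i \<in> I. a \<preceq> b \<oplus> i"
      using ij by (intro bexI[of _ "j \<ominus> i"]) (auto simp: minus_eq)
  next
    assume "\<exists>i \<in> I. a \<preceq> b \<oplus> i"
    then obtain i where i: "i \<in> I" "a \<preceq> i \<oplus> b"
      using I.a_Hcarr b a_comm by metis
    then have "a \<in> I +> a" "i \<oplus> b \<in> I +> b"
      by (auto simp: coset intro!: bexI[of _ \<zero>])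
    then have "\<exists>x \<in> I +> a. \<exists>y \<in> I +> b. x \<preceq> y"
      using i(2) by blast
    then show "ale ?Q (I +> a) (I +> b)"
      by (simp add: lalg_quot_def)
  qed
  have zero: "\<zero>\<^bsub>?Q\<^esub> = I +> \<zero>"
    using I.a_rcos_const[OF I.zero_closed] by (simp add: lalg_quot_def FactRing_def)
  have le_zero: "(\<exists>i \<in> I. a \<preceq> \<zero> \<oplus> i) \<longleftrightarrow> (\<exists>i \<in> I. a \<preceq> i)" for a
    by (auto dest: I.a_Hcarr)
  show ?thesis
    unfolding archimedean_lalg_def carrier ball_simps(9) zero
    by (simp add: pow le le_zero)
qed

text \<open>Left to right: the square of \<open>n |x|\<close> is small modulo \<open>I\<close>, so
  \<open>n |x|\<close> is at most 1 modulo \<open>I\<close> for every \<open>n\<close>, and the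
  archimedean quotient bounds \<open>|x|\<close> by a member of \<open>I\<close>. Right to left:
  comparing absolute values compares squares, and an element whose multiples are bounded modulo
  \<open>I\<close> has a positive part with small square.\<close>

lemma arch_ideals_iff: "I \<in> arch_ideals A \<longleftrightarrow> closed_ideal I"
proof
  assume "I \<in> arch_ideals A"
  then have l: "l_ideal I A" and arch: "archimedean_lalg (lalg_quot A I)" and I: "ideal I A"
    by (auto simp: arch_ideals_def l_ideal_def)
  interpret I: ideal I A by fact
  have "x \<in> I" if x [simp]: "x \<in> carrier A" and small: "below I (x \<otimes> x)" for x
  proof -
    note [simp] = labs_closed[OF x]
    have "\<exists>i \<in> I. scal (real n) \<otimes> labs A x \<preceq> \<one> \<oplus> i" for n :: nat
    proof -
      let ?y = "scal (real n) \<otimes> labs A x" and ?a = "scal (real n * real n)"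
      have "?y \<otimes> ?y = ?a \<otimes> (labs A x \<otimes> labs A x)"
        by (simp add: scal_mult m_ac flip: m_assoc)
      then have yy: "?y \<otimes> ?y = ?a \<otimes> (x \<otimes> x)"
        by (simp add: labs_square)
      have "below I (?a \<otimes> (x \<otimes> x))"
        using small by (rule below_mult) (auto intro: I.I_l_closed scal_nonneg)
      \<comment> \<open>The target \<open>\<one>\<close> is split as \<open>1/4 + 3/4\<close>:
        \<open>le_square\<close> with \<open>c = 1\<close> and \<open>d = 1/2\<close> costs
        \<open>1/4\<close>, which leaves \<open>3/4\<close> for the square.\<close>
      then obtain i where i: "i \<in> I" "?a \<otimes> (x \<otimes> x) \<preceq> scal (3/4) \<oplus> i"
        by (rule belowD[where e = "3/4"]) auto
      have [simp]: "i \<in> carrier A"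
        using i by auto
      have "?y \<preceq> scal (1/4) \<oplus> ?a \<otimes> (x \<otimes> x)"
        using le_square[of ?y 1 "1/2"] by (simp add: yy)
      moreover have "scal (1/4) \<oplus> ?a \<otimes> (x \<otimes> x) \<preceq> scal (1/4) \<oplus> (scal (3/4) \<oplus> i)"
        using i by (intro add_le) auto
      ultimately have "?y \<preceq> scal (1/4) \<oplus> (scal (3/4) \<oplus> i)"
        by (rule le_trans) auto
      also have "\<dots> = \<one> \<oplus> i"
        by (simp add: scal_add flip: a_assoc)
      finally show ?thesis
        using i by auto
    qed
    then obtain i where i: "i \<in> I" "labs A x \<preceq> i"
      using arch unfolding archimedean_quot_iff[OF I] by (meson labs_closed one_closed x)
    then have "labs A x \<preceq> labs A i"
      by (intro le_trans[OF _ le_labs]) (auto intro: labs_closed)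
    then show "x \<in> I"
      using l i by (auto simp: l_ideal_def)
  qed
  with I show "closed_ideal I"
    by (simp add: closed_ideal_def)
next
  assume closed: "closed_ideal I"
  interpret I: ideal I A by (rule closed_ideal_ideal) fact
  have labs_mem: "labs A b \<in> I" if "b \<in> I" for b
    using that by (rule_tac closed_ideal_square[OF closed])
      (auto simp: labs_square labs_closed intro: I.I_l_closed)
  have "a \<in> I" if a [simp]: "a \<in> carrier A" and b: "b \<in> I" and le: "labs A a \<preceq> labs A b" for a b
  proof (rule closed_idealD[OF closed])
    have [simp]: "b \<in> carrier A"
      using b by auto
    have "labs A a \<otimes> labs A a \<preceq> labs A a \<otimes> labs A b"
      using le by (intro mult_left_mono labs_nonneg labs_closed) auto
    moreover have "labs A b \<otimes> labs A a \<preceq> labs A b \<otimes> labs A b"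
      using le by (intro mult_left_mono labs_nonneg labs_closed) auto
    ultimately have "a \<otimes> a \<preceq> b \<otimes> b"
      using le_trans[of "a \<otimes> a" "labs A a \<otimes> labs A b" "b \<otimes> b"]
      by (simp add: labs_square labs_closed m_comm[of "labs A b" "labs A a"])
    then show "below I (a \<otimes> a)"
      using b by (rule_tac below_mono[OF _ below_mem[of "b \<otimes> b" I]]) (auto intro: I.I_l_closed)
  qed auto
  then have "l_ideal I A"
    unfolding l_ideal_def using I.is_ideal by blast
  moreover have "\<exists>i \<in> I. a \<preceq> i"
    if a [simp]: "a \<in> carrier A" and b [simp]: "b \<in> carrier A"
      and le: "\<And>n::nat. n \<ge> 1 \<Longrightarrow> \<exists>i \<in> I. scal (real n) \<otimes> a \<preceq> b \<oplus> i" for a b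
  proof -
    obtain m where m: "m \<ge> 1" "b \<preceq> scal m"
      by (rule exists_scal_ge[OF b])
    \<comment> \<open>\<open>a\<close> itself may have any sign, whereas \<open>below_mult\<close>
      needs a nonnegative factor to reach the square. So smallness is proved for the positive
      part.\<close>
    obtain p where p [simp]: "p \<in> carrier A" and p0: "\<zero> \<preceq> p" and ap: "a \<preceq> p"
      and least: "\<And>u. \<lbrakk>u \<in> carrier A; a \<preceq> u; \<zero> \<preceq> u\<rbrakk> \<Longrightarrow> p \<preceq> u"
    proof -
      obtain p q where pq: "p \<in> carrier A" "q \<in> carrier A" "\<zero> \<preceq> p" "\<zero> \<preceq> q" "a = p \<ominus> q"
        "\<And>u. \<lbrakk>u \<in> carrier A; a \<preceq> u; \<zero> \<preceq> u\<rbrakk> \<Longrightarrow> p \<preceq> u"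
        by (rule exists_pos_neg_parts[OF a]) blast
      have "a \<preceq> p"
        unfolding pq(5) by (rule le_if_diff_eq[OF pq(4)]) (use pq(1,2) in \<open>algebra, simp_all\<close>)
      then show ?thesis
        by (rule that[OF pq(1,3) _ pq(6)])
    qed
    have "below I p"
    proof (rule belowI)
      fix e :: real
      assume e: "e > 0"
      obtain n :: nat where n: "real n > m / e"
        using reals_Archimedean2 by blast
      have n1: "n \<ge> 1"
        using n e m by (cases n) (auto simp: divide_less_0_iff)
      obtain i where i: "i \<in> I" "scal (real n) \<otimes> a \<preceq> b \<oplus> i"
        using le[OF n1] by auto
      let ?j = "scal (1 / real n) \<otimes> i"
      have j: "?j \<in> I"
        using i by (intro I.I_l_closed) auto
      have [simp]: "i \<in> carrier A" "?j \<in> carrier A"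
        using i j by auto
      note [simp] = labs_closed[of ?j]
      have "scal (1 / real n) \<otimes> (scal (real n) \<otimes> a) \<preceq> scal (1 / real n) \<otimes> (scal m \<oplus> i)"
        using i m by (intro mult_left_mono scal_nonneg le_trans[OF i(2)] add_mono) auto
      then have "a \<preceq> scal (m / real n) \<oplus> ?j"
        using n1 by (simp add: scal_mult_mult r_distr scal_mult)
      \<comment> \<open>Replacing \<open>?j\<close> by its absolute value makes the bound
        nonnegative, as leastness of \<open>p\<close> requires; it stays in \<open>I\<close> by
        \<open>labs_mem\<close>.\<close>
      moreover have "scal (m / real n) \<oplus> ?j \<preceq> scal e \<oplus> labs A ?j"
        using n e n1 by (intro add_le scal_mono le_labs) (auto simp: field_simps)
      ultimately have "a \<preceq> scal e \<oplus> labs A ?j"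
        by (rule le_trans) auto
      then have "p \<preceq> scal e \<oplus> labs A ?j"
        using e by (intro least add_nonneg labs_nonneg scal_nonneg) auto
      then show "\<exists>i \<in> I. p \<preceq> scal e \<oplus> i"
        using labs_mem[OF j] by auto
    qed
    then have "below I (p \<otimes> p)"
      using p0 by (rule_tac below_mult) (auto intro: I.I_l_closed)
    then have "p \<in> I"
      by (rule closed_idealD[OF closed]) simp
    then show ?thesis
      using ap by auto
  qed
  then have "archimedean_lalg (lalg_quot A I)"
    unfolding archimedean_quot_iff[OF I.is_ideal] by blast
  ultimately show "I \<in> arch_ideals A"
    by (simp add: arch_ideals_def)
qed

end


section \<open>The frame of archimedean \<open>\<ell>\<close>-ideals\<close>

lemma (in cring) ideal_if_closed:
  assumes "I \<subseteq> carrier R" "\<zero> \<in> I" "\<And>x y. \<lbrakk>x \<in> I; y \<in> I\<rbrakk> \<Longrightarrow> x \<oplus> y \<in> I"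
    and mult: "\<And>a x. \<lbrakk>a \<in> carrier R; x \<in> I\<rbrakk> \<Longrightarrow> a \<otimes> x \<in> I"
  shows "ideal I R"
proof (rule idealI)
  show "ring R"
    by (rule ring_axioms)
  show "a \<otimes> x \<in> I" "x \<otimes> a \<in> I" if "a \<in> I" "x \<in> carrier R" for a x
    using that mult[of x a] assms(1) m_comm[of x a] by auto
  show "subgroup I (add_monoid R)"
  proof (rule add.subgroupI)
    fix x
    assume "x \<in> I"
    then have "\<ominus> \<one> \<otimes> x \<in> I" "x \<in> carrier R"
      using assms by auto
    then show "\<ominus> x \<in> I"
      by (simp add: l_minus)
  qed (use assms in auto)
qed

section \<open>Closed ideals, residuals and generated ideals\<close>

context bal
begin

lemma closed_ideal_carrier: "closed_ideal (carrier A)"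
  by (simp add: closed_ideal_def oneideal)

lemma closed_ideal_mem: "\<lbrakk>closed_ideal I; x \<in> I\<rbrakk> \<Longrightarrow> x \<in> carrier A"
  using closed_ideal_subset by auto

lemma closed_ideal_Inter:
  assumes "S \<noteq> {}" "\<And>I. I \<in> S \<Longrightarrow> closed_ideal I"
  shows "closed_ideal (\<Inter>S)"
  unfolding closed_ideal_def
proof (intro conjI ballI impI InterI)
  show ideal: "ideal (\<Inter>S) A"
    using assms by (intro i_Intersect closed_ideal_ideal) auto
  fix x I
  assume x: "x \<in> carrier A" "below (\<Inter>S) (x \<otimes> x)" and I: "I \<in> S"
  have "below I (x \<otimes> x)"
    using x I closed_ideal_subset[OF assms(2)[OF I]]
    by (rule_tac below_mono[of "x \<otimes> x" "x \<otimes> x" "\<Inter>S"]) auto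
  then show "x \<in> I"
    using assms(2)[OF I] x by (rule_tac closed_idealD)
qed

text \<open>Here the archimedean property of \<open>A\<close> itself enters:
  \<open>x^2 \<preceq> e\<close> for all \<open>e > 0\<close> forces \<open>x^2\<close>, and then
  \<open>x\<close>, to vanish. Annihilators thereby become residuals of a closed ideal.\<close>

lemma closed_ideal_zero: "closed_ideal {\<zero>}"
  unfolding closed_ideal_def
proof (intro conjI ballI impI zeroideal)
  fix x
  assume x: "x \<in> carrier A" "below {\<zero>} (x \<otimes> x)"
  have "x \<otimes> x \<preceq> \<zero>"
    using x by (intro le_zero_if_small) (auto simp: below_def)
  then have "x \<otimes> x = \<zero>"
    using x by (intro le_antisym square_nonneg) auto
  then show "x \<in> {\<zero>}"
    using x(1) square_eq_zero[of x] by simp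
qed

lemma closed_ideal_Int:
  assumes "closed_ideal I" "closed_ideal J"
  shows "closed_ideal (I \<inter> J)"
proof -
  have "closed_ideal (\<Inter>{I, J})"
    using assms by (intro closed_ideal_Inter) blast+
  then show ?thesis
    by simp
qed

definition residual :: "'a set \<Rightarrow> 'a set \<Rightarrow> 'a set" where
  "residual M S = {x \<in> carrier A. \<forall>y \<in> S. x \<otimes> y \<in> M}"

text \<open>If \<open>x^2\<close> is small modulo the residual, multiplying by the nonnegative
  \<open>y^2\<close> makes \<open>(x y)^2\<close> small modulo \<open>M\<close>, so
  \<open>x y\<close> lies in \<open>M\<close>.\<close>

lemma residual_closed:
  assumes M: "closed_ideal M" and S: "S \<subseteq> carrier A"
  shows "closed_ideal (residual M S)"
  unfolding closed_ideal_def
proof (intro conjI ballI impI)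
  interpret M: ideal M A
    using M by (rule closed_ideal_ideal)
  show "ideal (residual M S) A"
  proof (rule ideal_if_closed)
    show "x \<oplus> y \<in> residual M S" if "x \<in> residual M S" "y \<in> residual M S" for x y
      using that S by (auto simp: residual_def l_distr subset_iff)
    show "a \<otimes> x \<in> residual M S" if "a \<in> carrier A" "x \<in> residual M S" for a x
      using that S by (auto simp: residual_def m_assoc subset_iff intro: M.I_l_closed)
  qed (use S in \<open>auto simp: residual_def subset_iff\<close>)
  fix x
  assume x: "x \<in> carrier A" "below (residual M S) (x \<otimes> x)"
  have "x \<otimes> y \<in> M" if y: "y \<in> S" for y
  proof (rule closed_idealD[OF M])
    have yA: "y \<in> carrier A"
      using y S by auto
    have "(y \<otimes> y) \<otimes> i \<in> M" if "i \<in> residual M S" for i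
    proof -
      have i: "i \<in> carrier A" "i \<otimes> y \<in> M"
        using that y by (auto simp: residual_def)
      then have "y \<otimes> (i \<otimes> y) \<in> M"
        using yA by (simp add: M.I_l_closed)
      moreover have "y \<otimes> (i \<otimes> y) = (y \<otimes> y) \<otimes> i"
        using yA i(1) by algebra
      ultimately show ?thesis
        by simp
    qed
    then have "below M ((y \<otimes> y) \<otimes> (x \<otimes> x))"
      using x yA by (intro below_mult[OF x(2)] square_nonneg) (auto simp: residual_def)
    moreover have "(y \<otimes> y) \<otimes> (x \<otimes> x) = (x \<otimes> y) \<otimes> (x \<otimes> y)"
      using yA x(1) by algebra
    ultimately show "below M ((x \<otimes> y) \<otimes> (x \<otimes> y))"
      by simp
    show "x \<otimes> y \<in> carrier A"
      using x yA by simp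
  qed
  then show "x \<in> residual M S"
    using x by (simp add: residual_def)
qed

lemma Int_subset_if_mult:
  assumes M: "closed_ideal M" and "I \<subseteq> carrier A" "\<And>x y. \<lbrakk>x \<in> I; y \<in> J\<rbrakk> \<Longrightarrow> x \<otimes> y \<in> M"
  shows "I \<inter> J \<subseteq> M"
  using assms by (auto intro: closed_ideal_square)

lemma arch_gen_eq: "arch_gen A S = \<Inter>{J. closed_ideal J \<and> S \<subseteq> J}"
  by (simp add: arch_gen_def arch_ideals_iff)

lemma arch_gen_closed: "S \<subseteq> carrier A \<Longrightarrow> closed_ideal (arch_gen A S)"
  unfolding arch_gen_eq by (intro closed_ideal_Inter) (auto intro: closed_ideal_carrier)

lemma arch_gen_superset: "S \<subseteq> arch_gen A S"
  by (auto simp: arch_gen_eq)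

lemma arch_gen_least: "\<lbrakk>closed_ideal J; S \<subseteq> J\<rbrakk> \<Longrightarrow> arch_gen A S \<subseteq> J"
  by (auto simp: arch_gen_eq)

text \<open>Products of generated ideals are controlled by products of generators. The elements
  multiplying all of \<open>T\<close> into \<open>M\<close> form a residual containing
  \<open>S\<close>, hence \<open>arch_gen A S\<close>; fixing one of these, the same argument
  extends \<open>T\<close>.\<close>

lemma arch_gen_mult:
  assumes M: "closed_ideal M" and S: "S \<subseteq> carrier A" and T: "T \<subseteq> carrier A"
    and mult: "\<And>x y. \<lbrakk>x \<in> S; y \<in> T\<rbrakk> \<Longrightarrow> x \<otimes> y \<in> M"
    and xy: "x \<in> arch_gen A S" "y \<in> arch_gen A T"
  shows "x \<otimes> y \<in> M"
proof -
  have gen: "arch_gen A S \<subseteq> carrier A" "arch_gen A T \<subseteq> carrier A"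
    using S T by (auto intro: arch_gen_closed closed_ideal_subset[THEN subsetD])
  have "arch_gen A S \<subseteq> residual M T"
    using S mult by (intro arch_gen_least residual_closed M T) (auto simp: residual_def)
  then have mult': "z \<otimes> x \<in> M" if "z \<in> T" for z
  proof -
    have "x \<in> residual M T"
      using \<open>arch_gen A S \<subseteq> residual M T\<close> xy(1) by (rule subsetD)
    then show ?thesis
      using that T m_comm[of z x] by (auto simp: residual_def subset_iff)
  qed
  have "arch_gen A T \<subseteq> residual M {x}"
    using T mult' xy gen by (intro arch_gen_least residual_closed M) (auto simp: residual_def)
  then have "y \<in> residual M {x}"
    using xy(2) by (rule subsetD)
  then show ?thesis
    using xy(1) gen(1) m_comm[of x y] by (auto simp: residual_def subset_iff)
qed

section \<open>The frame structure\<close>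

lemma Arch_ob_simps:
  "I \<in> carrier (Arch_ob A) \<longleftrightarrow> closed_ideal I" "le (Arch_ob A) I J \<longleftrightarrow> I \<subseteq> J"
  "eq (Arch_ob A) = (=)"
  by (simp_all add: Arch_ob_def arch_ideals_iff)

lemma complete_lattice_Arch_ob: "complete_lattice (Arch_ob A)"
proof -
  interpret L: partial_order "Arch_ob A"
    by unfold_locales (auto simp: Arch_ob_simps)
  show ?thesis
  proof (rule L.complete_lattice_criterion1)
    show "\<exists>g. greatest (Arch_ob A) g (carrier (Arch_ob A))"
      by (rule exI[of _ "carrier A"])
         (auto simp: greatest_def Arch_ob_simps closed_ideal_carrier dest: closed_ideal_mem)
    fix S
    assume "S \<subseteq> carrier (Arch_ob A)" "S \<noteq> {}"
    then have "greatest (Arch_ob A) (\<Inter>S) (Lower (Arch_ob A) S)"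
      by (auto simp: greatest_def Lower_def Arch_ob_simps subset_iff intro!: closed_ideal_Inter)
    then show "\<exists>i. greatest (Arch_ob A) i (Lower (Arch_ob A) S)" ..
  qed
qed

sublocale L: complete_lattice "Arch_ob A"
  by (rule complete_lattice_Arch_ob)

lemma top_Arch: "\<top>\<^bsub>Arch_ob A\<^esub> = carrier A"
  by (rule L.top_eqI) (auto simp: Arch_ob_simps closed_ideal_carrier dest: closed_ideal_mem)

lemma bottom_Arch: "\<bottom>\<^bsub>Arch_ob A\<^esub> = {\<zero>}"
  by (rule L.bottom_eqI)
     (auto simp: Arch_ob_simps closed_ideal_zero closed_ideal_ideal ideal.axioms(1)
       additive_subgroup.zero_closed)

lemma meet_Arch: "\<lbrakk>closed_ideal I; closed_ideal J\<rbrakk> \<Longrightarrow> I \<sqinter>\<^bsub>Arch_ob A\<^esub> J = I \<inter> J"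
  by (rule L.meet_eqI) (auto simp: Arch_ob_simps closed_ideal_Int)

lemma Union_subset_carrier: "S \<subseteq> carrier (Arch_ob A) \<Longrightarrow> \<Union>S \<subseteq> carrier A"
  by (auto simp: Arch_ob_simps subset_iff dest: closed_ideal_mem)

lemma sup_Arch: "S \<subseteq> carrier (Arch_ob A) \<Longrightarrow> \<Squnion>\<^bsub>Arch_ob A\<^esub>S = arch_gen A (\<Union>S)"
proof (rule L.sup_eqI)
  assume S: "S \<subseteq> carrier (Arch_ob A)"
  show "arch_gen A (\<Union>S) \<in> carrier (Arch_ob A)"
    using Union_subset_carrier[OF S] by (simp add: Arch_ob_simps arch_gen_closed)
  show "x \<sqsubseteq>\<^bsub>Arch_ob A\<^esub> arch_gen A (\<Union>S)" if "x \<in> S" for x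
    using that arch_gen_superset[of "\<Union>S"] by (auto simp: Arch_ob_simps)
  show "arch_gen A (\<Union>S) \<sqsubseteq>\<^bsub>Arch_ob A\<^esub> u"
    if "u \<in> carrier (Arch_ob A)" "\<And>x. x \<in> S \<Longrightarrow> x \<sqsubseteq>\<^bsub>Arch_ob A\<^esub> u" for u
    using that unfolding Arch_ob_simps by (intro arch_gen_least) auto
qed

lemma frame_Arch_ob: "frame (Arch_ob A)"
proof
  fix I S
  assume "I \<in> carrier (Arch_ob A)" and S: "S \<subseteq> carrier (Arch_ob A)"
  then have I: "closed_ideal I"
    by (simp add: Arch_ob_simps)
  have J: "closed_ideal J" if "J \<in> S" for J
    using S that by (auto simp: Arch_ob_simps subset_iff)
  have US: "\<Union>S \<subseteq> carrier A"
    by (rule Union_subset_carrier[OF S])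
  have T: "{I \<sqinter>\<^bsub>Arch_ob A\<^esub> J | J. J \<in> S} = {I \<inter> J | J. J \<in> S}"
    using I J by (metis (no_types, lifting) meet_Arch)
  have TC: "{I \<inter> J | J. J \<in> S} \<subseteq> carrier (Arch_ob A)"
    using I J by (auto simp: Arch_ob_simps closed_ideal_Int)
  let ?M = "arch_gen A (\<Union>{I \<inter> J | J. J \<in> S})"
  have M: "closed_ideal ?M"
    using TC by (intro arch_gen_closed Union_subset_carrier)
  have "I \<inter> arch_gen A (\<Union>S) = ?M"
  proof
    have "x \<otimes> y \<in> ?M" if x: "x \<in> I" and y: "y \<in> \<Union>S" for x y
    proof -
      obtain J where JS: "J \<in> S" "y \<in> J"
        using y by auto
      interpret I: ideal I A by (rule closed_ideal_ideal[OF I])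
      interpret J: ideal J A by (rule closed_ideal_ideal[OF J[OF JS(1)]])
      have "x \<otimes> y \<in> I \<inter> J"
        using x JS by (auto intro: I.I_r_closed J.I_l_closed)
      then have "x \<otimes> y \<in> \<Union>{I \<inter> J | J. J \<in> S}"
        using JS by auto
      then show ?thesis
        by (rule arch_gen_superset[THEN subsetD])
    qed
    \<comment> \<open>\<open>I\<close> lies in the ideal it generates, so
      \<open>arch_gen_mult\<close> applies with \<open>I\<close> as one of the two generating
      sets.\<close>
    then have "x \<otimes> y \<in> ?M" if "x \<in> I" "y \<in> arch_gen A (\<Union>S)" for x y
      using that closed_ideal_subset[OF I] arch_gen_superset[of I]
      by (rule_tac arch_gen_mult[OF M _ US, of I]) auto
    then show "I \<inter> arch_gen A (\<Union>S) \<subseteq> ?M"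
      using I by (intro Int_subset_if_mult[OF M] closed_ideal_subset)
    show "?M \<subseteq> I \<inter> arch_gen A (\<Union>S)"
      using I US arch_gen_superset[of "\<Union>S"]
      by (intro arch_gen_least closed_ideal_Int arch_gen_closed) auto
  qed
  then show "I \<sqinter>\<^bsub>Arch_ob A\<^esub> \<Squnion>\<^bsub>Arch_ob A\<^esub>S = \<Squnion>\<^bsub>Arch_ob A\<^esub>{I \<sqinter>\<^bsub>Arch_ob A\<^esub> J | J. J \<in> S}"
    using I US unfolding T sup_Arch[OF S] sup_Arch[OF TC] by (simp add: meet_Arch arch_gen_closed)
qed

sublocale L: frame "Arch_ob A"
  by (rule frame_Arch_ob)

section \<open>Pseudocomplements as annihilators\<close>

lemma closed_ideal_pcompl: "closed_ideal (pcompl (Arch_ob A) I)"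
  using L.pcompl_closed[of I] unfolding Arch_ob_simps .

lemma annihilator_eq_residual: "annihilator A S = residual {\<zero>} S"
  by (simp add: annihilator_def residual_def)

lemma annihilator_closed: "S \<subseteq> carrier A \<Longrightarrow> closed_ideal (annihilator A S)"
  by (simp add: annihilator_eq_residual residual_closed closed_ideal_zero)

text \<open>An element of both \<open>I\<close> and its annihilator has square zero, hence is zero.
  Conversely, products of \<open>I\<close> with an ideal meeting it trivially fall into the
  intersection.\<close>

lemma pcompl_Arch:
  assumes I: "closed_ideal I"
  shows "pcompl (Arch_ob A) I = annihilator A I"
proof (rule L.le_antisym)
  interpret I: ideal I A by (rule closed_ideal_ideal[OF I])
  have carrier: "I \<in> carrier (Arch_ob A)" "annihilator A I \<in> carrier (Arch_ob A)"
    using I by (auto simp: Arch_ob_simps intro: annihilator_closed)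
  have "I \<inter> annihilator A I \<subseteq> {\<zero>}"
    by (rule Int_subset_if_mult[OF closed_ideal_zero]) (auto simp: annihilator_def m_comm)
  then have "I \<inter> annihilator A I = {\<zero>}"
    by (auto simp: annihilator_def)
  then have "I \<sqinter>\<^bsub>Arch_ob A\<^esub> annihilator A I = \<bottom>\<^bsub>Arch_ob A\<^esub>"
    using carrier by (simp add: meet_Arch bottom_Arch Arch_ob_simps)
  then show "annihilator A I \<sqsubseteq>\<^bsub>Arch_ob A\<^esub> pcompl (Arch_ob A) I"
    using carrier by (simp add: L.le_pcompl_iff)
  define P where "P = pcompl (Arch_ob A) I"
  have P: "closed_ideal P"
    unfolding P_def by (rule closed_ideal_pcompl)
  interpret P: ideal P A by (rule closed_ideal_ideal[OF P])
  have "I \<inter> P = {\<zero>}"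
    using L.meet_pcompl(1)[OF carrier(1)] meet_Arch[OF I P] by (simp only: P_def bottom_Arch)
  moreover have "x \<otimes> y \<in> I \<inter> P" if "x \<in> P" "y \<in> I" for x y
    using that by (auto intro: I.I_l_closed P.I_r_closed)
  ultimately have "P \<subseteq> annihilator A I"
    by (auto simp: annihilator_def)
  then show "pcompl (Arch_ob A) I \<sqsubseteq>\<^bsub>Arch_ob A\<^esub> annihilator A I"
    by (simp add: P_def Arch_ob_simps)
qed (use I in \<open>simp_all add: Arch_ob_simps closed_ideal_pcompl annihilator_closed closed_ideal_subset\<close>)

text \<open>The set \<open>S\<close> need not be an ideal, so the identity that the triple
  annihilator of \<open>S\<close> is its annihilator is proved elementwise; pseudocomplements enter
  only at the closed ideals \<open>I\<close> and \<open>annihilator A I\<close>. In the other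
  direction a regular \<open>I\<close> annihilates its pseudocomplement.\<close>

lemma ann_ideals_eq: "ann_ideals A = regular_elements (Arch_ob A)"
proof (intro equalityI subsetI)
  fix I
  assume "I \<in> ann_ideals A"
  then obtain S where S: "S \<subseteq> carrier A" "I = annihilator A S"
    by (auto simp: ann_ideals_def)
  have I: "closed_ideal I"
    using S by (simp add: annihilator_closed)
  then have AI: "closed_ideal (annihilator A I)"
    by (intro annihilator_closed closed_ideal_subset)
  have "annihilator A (annihilator A I) \<subseteq> annihilator A S"
  proof -
    have "x \<otimes> a = \<zero>" if "x \<in> S" "a \<in> I" for x a
      using that S m_comm[of x a] by (auto simp: annihilator_def)
    then have "S \<subseteq> annihilator A I"
      using S by (auto simp: annihilator_def)
    then show ?thesis
      by (auto simp: annihilator_def)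
  qed
  moreover have "I \<subseteq> annihilator A (annihilator A I)"
  proof -
    have "x \<otimes> a = \<zero>" if "x \<in> I" "a \<in> annihilator A I" for x a
      using that closed_ideal_mem[OF I] m_comm[of x a] by (auto simp: annihilator_def)
    then show ?thesis
      using closed_ideal_subset[OF I] by (auto simp: annihilator_def)
  qed
  ultimately have "annihilator A (annihilator A I) = I"
    using S by auto
  then show "I \<in> regular_elements (Arch_ob A)"
    using I AI by (simp add: regular_elements_def Arch_ob_simps pcompl_Arch)
next
  fix I
  assume "I \<in> regular_elements (Arch_ob A)"
  then have I: "closed_ideal I" "pcompl (Arch_ob A) (pcompl (Arch_ob A) I) = I"
    by (auto simp: regular_elements_def Arch_ob_simps)
  have "closed_ideal (pcompl (Arch_ob A) I)"
    by (rule closed_ideal_pcompl)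
  then have "I = annihilator A (pcompl (Arch_ob A) I)" "pcompl (Arch_ob A) I \<subseteq> carrier A"
    using I pcompl_Arch[of "pcompl (Arch_ob A) I"] by (auto dest: closed_ideal_mem)
  then show "I \<in> ann_ideals A"
    by (auto simp: ann_ideals_def)
qed

section \<open>Closure of an ideal, compactness and regularity\<close>

text \<open>Smallness modulo the closure is already smallness modulo \<open>J\<close>. The error
  \<open>e\<close> is spent in thirds: on passing from \<open>x\<close> to a member \<open>y\<close>
  of the closure, on \<open>d * d\<close> in \<open>le_square\<close> for \<open>y\<close>, and on
  the multiple of \<open>y^2\<close>, which is small modulo \<open>J\<close>.\<close>

lemma below_closure:
  assumes J: "ideal J A" and x: "x \<in> carrier A"
    and small: "below {y \<in> carrier A. below J (y \<otimes> y)} x"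
  shows "below J x"
proof (rule belowI)
  interpret J: ideal J A by (rule J)
  fix e :: real
  assume e: "e > 0"
  \<comment> \<open>The cap at 1 gives \<open>d * d \<le> e/3\<close>; the choice of
    \<open>c\<close> below meets \<open>2 * c * d = 1\<close>.\<close>
  define d where "d = min (e/3) 1"
  have d: "d > 0" "d * d \<le> e/3"
    using e mult_mono[of d "e/3" d 1] by (auto simp: d_def)
  define c where "c = 1 / (2 * d)"
  obtain y where y [simp]: "y \<in> carrier A" and yJ: "below J (y \<otimes> y)" and xy: "x \<preceq> scal (e/3) \<oplus> y"
    using belowD[OF small, of "e/3"] e by auto
  have y_le: "y \<preceq> scal (d * d) \<oplus> scal (c * c) \<otimes> (y \<otimes> y)"
    using d by (intro le_square) (auto simp: c_def)
  have "below J (scal (c * c) \<otimes> (y \<otimes> y))"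
    using yJ by (rule below_mult) (auto intro: J.I_l_closed scal_nonneg)
  then obtain j where j: "j \<in> J" "scal (c * c) \<otimes> (y \<otimes> y) \<preceq> scal (e/3) \<oplus> j"
    by (rule belowD[of _ _ "e/3"]) (use e in auto)
  have [simp]: "j \<in> carrier A"
    using j by auto
  have "scal (d * d) \<oplus> scal (c * c) \<otimes> (y \<otimes> y) \<preceq> scal (e/3) \<oplus> (scal (e/3) \<oplus> j)"
    using d j by (intro add_le scal_mono) auto
  with y_le have "y \<preceq> scal (e/3) \<oplus> (scal (e/3) \<oplus> j)"
    by (rule le_trans) auto
  then have "scal (e/3) \<oplus> y \<preceq> scal (e/3) \<oplus> (scal (e/3) \<oplus> (scal (e/3) \<oplus> j))"
    by (intro add_le) auto
  with xy have "x \<preceq> scal (e/3) \<oplus> (scal (e/3) \<oplus> (scal (e/3) \<oplus> j))"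
    by (rule le_trans) (use x in auto)
  also have "\<dots> = scal e \<oplus> j"
    by (simp add: scal_add flip: a_assoc)
  finally show "\<exists>i \<in> J. x \<preceq> scal e \<oplus> i"
    using j by auto
qed

text \<open>Adjoining the elements with small square once suffices, by \<open>below_closure\<close>.
  Sums stay inside because \<open>2 x^2 + 2 y^2\<close> exceeds \<open>(x + y)^2\<close> by the
  square \<open>(x - y)^2\<close>.\<close>

lemma closed_ideal_closure:
  assumes J: "ideal J A"
  shows "closed_ideal {x \<in> carrier A. below J (x \<otimes> x)}"
  unfolding closed_ideal_def
proof (intro conjI ballI impI)
  interpret J: ideal J A by (rule J)
  show "ideal {x \<in> carrier A. below J (x \<otimes> x)} A"
  proof (rule ideal_if_closed)
    show "\<zero> \<in> {x \<in> carrier A. below J (x \<otimes> x)}"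
      using below_mem[of \<zero> J] J.a_subset by auto
  next
    fix x y
    assume "x \<in> {x \<in> carrier A. below J (x \<otimes> x)}" "y \<in> {x \<in> carrier A. below J (x \<otimes> x)}"
    then have x: "x \<in> carrier A" "below J (x \<otimes> x)" and y: "y \<in> carrier A" "below J (y \<otimes> y)"
      by auto
    have small: "below J ((x \<otimes> x \<oplus> x \<otimes> x) \<oplus> (y \<otimes> y \<oplus> y \<otimes> y))"
      using x y by (intro below_add J) auto
    have "(x \<oplus> y) \<otimes> (x \<oplus> y) \<preceq> (x \<otimes> x \<oplus> x \<otimes> x) \<oplus> (y \<otimes> y \<oplus> y \<otimes> y)"
      by (rule le_if_diff_eq[OF square_nonneg[of "x \<ominus> y"]]) (use x(1) y(1) in \<open>simp, algebra, simp_all\<close>)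
    then have "below J ((x \<oplus> y) \<otimes> (x \<oplus> y))"
      by (rule below_mono[OF _ small]) (use x y J.a_subset in auto)
    then show "x \<oplus> y \<in> {x \<in> carrier A. below J (x \<otimes> x)}"
      using x y by simp
  next
    fix a x
    assume a: "a \<in> carrier A" and "x \<in> {x \<in> carrier A. below J (x \<otimes> x)}"
    then have x: "x \<in> carrier A" "below J (x \<otimes> x)"
      by auto
    have "below J ((a \<otimes> a) \<otimes> (x \<otimes> x))"
      using x(2) by (rule below_mult) (use a x in \<open>auto intro: J.I_l_closed square_nonneg\<close>)
    moreover have "(a \<otimes> a) \<otimes> (x \<otimes> x) = (a \<otimes> x) \<otimes> (a \<otimes> x)"
      using a x(1) by algebra
    ultimately show "a \<otimes> x \<in> {x \<in> carrier A. below J (x \<otimes> x)}"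
      using a x by simp
  qed auto
qed (auto intro: below_closure[OF J])

text \<open>After division by \<open>e\<close>, a member of \<open>I\<close> dominates
  \<open>\<one> \<otimes> \<one>\<close>, so the closure condition puts \<open>\<one>\<close> into
  \<open>I\<close>.\<close>

lemma eq_carrier_if_scal_le:
  assumes I: "closed_ideal I" and i: "i \<in> I" and e: "e > 0" and le: "scal e \<preceq> i"
  shows "I = carrier A"
proof -
  interpret I: ideal I A by (rule closed_ideal_ideal[OF I])
  have "scal (1/e) \<otimes> scal e \<preceq> scal (1/e) \<otimes> i"
    using e i le by (intro mult_left_mono scal_nonneg) auto
  then have "\<one> \<otimes> \<one> \<preceq> scal (1/e) \<otimes> i"
    using e by (simp add: scal_mult)
  moreover have "below I (scal (1/e) \<otimes> i)"
    using i by (intro below_mem I.a_subset) (simp add: I.I_l_closed)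
  ultimately have "below I (\<one> \<otimes> \<one>)"
    using I.a_subset i by (rule_tac below_mono) auto
  then have "\<one> \<in> I"
    by (rule closed_idealD[OF I]) simp
  then show ?thesis
    by (rule I.one_imp_carrier)
qed

text \<open>The joins of finite subsets of \<open>S\<close> form a directed family, so their union \<open>J\<close> is an ideal
  whose closure is the join of \<open>S\<close>. If \<open>1\<close> lies in the closure, then already \<open>1/2 \<le> i\<close> for
  some \<open>i \<in> J\<close>.\<close>

lemma compact_Arch_ob: "compact_frame (Arch_ob A)"
  unfolding compact_frame_def
proof (intro allI impI)
  fix S
  assume S: "S \<subseteq> carrier (Arch_ob A)" and top: "\<Squnion>\<^bsub>Arch_ob A\<^esub>S = \<top>\<^bsub>Arch_ob A\<^esub>"
  define F where "F T = arch_gen A (\<Union>T)" for T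
  have F: "closed_ideal (F T)" if "T \<subseteq> S" for T
    using that S unfolding F_def by (intro arch_gen_closed Union_subset_carrier) auto
  have F_mono: "F T \<subseteq> F T'" if "T \<subseteq> T'" "T' \<subseteq> S" for T T'
    using that arch_gen_superset[of "\<Union>T'"] F[OF that(2)] unfolding F_def
    by (intro arch_gen_least) auto
  define J where "J = \<Union>{F T | T. T \<subseteq> S \<and> finite T}"
  have J_iff: "x \<in> J \<longleftrightarrow> (\<exists>T. T \<subseteq> S \<and> finite T \<and> x \<in> F T)" for x
    by (auto simp: J_def)
  have J: "ideal J A"
  proof (rule ideal_if_closed)
    show "J \<subseteq> carrier A"
      by (auto simp: J_iff dest: closed_ideal_mem[OF F])
    show "\<zero> \<in> J"
      using F[of "{}"] unfolding J_iff
      by (intro exI[of _ "{}"]) (auto intro: additive_subgroup.zero_closed ideal.axioms(1) closed_ideal_ideal)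
    show "x \<oplus> y \<in> J" if xy: "x \<in> J" "y \<in> J" for x y
    proof -
      obtain T T' where T: "T \<subseteq> S" "finite T" "x \<in> F T" and T': "T' \<subseteq> S" "finite T'" "y \<in> F T'"
        using xy by (auto simp: J_iff)
      have U: "T \<union> T' \<subseteq> S"
        using T T' by auto
      interpret I: ideal "F (T \<union> T')" A by (rule closed_ideal_ideal[OF F[OF U]])
      have "x \<oplus> y \<in> F (T \<union> T')"
        using T T' U F_mono[of T "T \<union> T'"] F_mono[of T' "T \<union> T'"] by (rule_tac I.a_closed) auto
      then show ?thesis
        using T T' U unfolding J_iff by (intro exI[of _ "T \<union> T'"]) simp
    qed
    show "a \<otimes> x \<in> J" if "a \<in> carrier A" "x \<in> J" for a x
      using that F[THEN closed_ideal_ideal] by (auto simp: J_iff intro: ideal.I_l_closed)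
  qed
  interpret J: ideal J A by (rule J)
  let ?C = "{x \<in> carrier A. below J (x \<otimes> x)}"
  have "\<Union>S \<subseteq> ?C"
  proof
    fix x
    assume "x \<in> \<Union>S"
    then obtain I where I: "I \<in> S" "x \<in> I"
      by auto
    then have "x \<in> F {I}"
      using arch_gen_superset[of I] by (auto simp: F_def)
    then have "x \<in> J"
      using I by (auto simp: J_iff intro!: exI[of _ "{I}"])
    then show "x \<in> ?C"
      by (auto intro!: below_mem J.I_l_closed)
  qed
  then have "arch_gen A (\<Union>S) \<subseteq> ?C"
    by (intro arch_gen_least closed_ideal_closure J)
  then have "\<one> \<in> ?C"
    using top unfolding sup_Arch[OF S] top_Arch by auto
  then have "below J \<one>"
    by simp
  then obtain i where "i \<in> J" and i: "\<one> \<preceq> scal (1/2) \<oplus> i"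
    by (rule belowD[of _ _ "1/2"]) auto
  then obtain T where T: "T \<subseteq> S" "finite T" "i \<in> F T"
    by (auto simp: J_iff)
  interpret I: ideal "F T" A by (rule closed_ideal_ideal[OF F[OF T(1)]])
  have [simp]: "i \<in> carrier A"
    using T by auto
  have "scal (1/2) \<oplus> scal (1/2) \<preceq> scal (1/2) \<oplus> i"
    using i by (simp add: scal_add)
  then have "scal (1/2) \<preceq> i"
    by (rule le_if_diff_eq) (use \<open>i \<in> carrier A\<close> scal_closed[of "1/2"] in \<open>algebra, simp_all\<close>)
  then have "F T = carrier A"
    by (rule eq_carrier_if_scal_le[OF F[OF T(1)] T(3), rotated]) simp
  moreover have "T \<subseteq> carrier (Arch_ob A)"
    using T S by auto
  ultimately show "\<exists>T \<subseteq> S. finite T \<and> \<Squnion>\<^bsub>Arch_ob A\<^esub>T = \<top>\<^bsub>Arch_ob A\<^esub>"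
    using T by (intro exI[of _ T]) (simp add: sup_Arch top_Arch F_def)
qed

text \<open>For \<open>a \<in> I\<close> the ideal generated by \<open>(a\<^sup>2 - e)\<^sup>+\<close> is well inside \<open>I\<close>, since
  \<open>(a\<^sup>2 - e)\<^sup>-\<close> annihilates it and \<open>(a\<^sup>2 - e)\<^sup>- + a\<^sup>2 \<ge> e\<close>.\<close>

lemma regular_Arch_ob: "regular_frame (Arch_ob A)"
  unfolding regular_frame_def
proof
  fix I
  assume "I \<in> carrier (Arch_ob A)"
  then have I: "closed_ideal I"
    by (simp add: Arch_ob_simps)
  interpret I: ideal I A by (rule closed_ideal_ideal[OF I])
  let ?W = "{J \<in> carrier (Arch_ob A). well_inside (Arch_ob A) J I}"
  have W: "?W \<subseteq> carrier (Arch_ob A)"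
    by auto
  let ?G = "arch_gen A (\<Union>?W)"
  have G: "closed_ideal ?G"
    by (rule arch_gen_closed[OF Union_subset_carrier[OF W]])
  interpret G: ideal ?G A by (rule closed_ideal_ideal[OF G])
  have "?G \<subseteq> I"
  proof (rule arch_gen_least[OF I])
    show "\<Union>?W \<subseteq> I"
      using L.well_inside_le[of _ I] I by (auto simp: Arch_ob_simps)
  qed
  moreover have "a \<in> ?G" if a: "a \<in> I" for a
  proof (rule closed_idealD[OF G])
    have [simp]: "a \<in> carrier A"
      using a by auto
    show "below ?G (a \<otimes> a)"
    proof (rule belowI)
      fix e :: real
      assume e: "e > 0"
      obtain p q where pq: "p \<in> carrier A" "q \<in> carrier A" "\<zero> \<preceq> p" "\<zero> \<preceq> q"
        "a \<otimes> a \<ominus> scal e = p \<ominus> q" "p \<otimes> q = \<zero>"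
        by (rule exists_pos_neg_parts[of "a \<otimes> a \<ominus> scal e"]) auto
      \<comment> \<open>This one identity gives both estimates: \<open>e \<preceq> a^2 + q\<close>
        makes the join below everything, and \<open>a^2 \<preceq> e + p\<close> makes
        \<open>a^2\<close> small modulo \<open>?G\<close>.\<close>
      have eq: "a \<otimes> a \<oplus> q = scal e \<oplus> p"
      proof -
        have "a \<otimes> a \<oplus> q = (a \<otimes> a \<ominus> scal e) \<oplus> (scal e \<oplus> q)"
          using pq(2) \<open>a \<in> carrier A\<close> scal_closed[of e] by algebra
        also have "\<dots> = (p \<ominus> q) \<oplus> (scal e \<oplus> q)"
          by (simp only: pq(5))
        also have "\<dots> = scal e \<oplus> p"
          using pq(1,2) scal_closed[of e] by algebra
        finally show ?thesis .
      qed
      define P where "P = arch_gen A {p}"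
      have P: "closed_ideal P" "p \<in> P"
        using pq arch_gen_closed[of "{p}"] arch_gen_superset[of "{p}"] by (auto simp: P_def)
      let ?K = "pcompl (Arch_ob A) P \<squnion>\<^bsub>Arch_ob A\<^esub> I"
      have K: "closed_ideal ?K"
        using L.join_closed[of "pcompl (Arch_ob A) P" I] I closed_ideal_pcompl
        unfolding Arch_ob_simps by blast
      interpret K: ideal ?K A by (rule closed_ideal_ideal[OF K])
      \<comment> \<open>\<open>q\<close> annihilates the generator \<open>p\<close>, and
        \<open>arch_gen_mult\<close> with target ideal zero extends this to all of
        \<open>P\<close>.\<close>
      have "q \<otimes> y = \<zero>" if "y \<in> P" for y
        using arch_gen_mult[OF closed_ideal_zero, of "{q}" "{p}" q y] that pq
          arch_gen_superset[of "{q}"] by (auto simp: P_def m_comm)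
      then have "q \<in> pcompl (Arch_ob A) P"
        using P pq by (simp add: pcompl_Arch annihilator_def)
      moreover have "pcompl (Arch_ob A) P \<subseteq> ?K" "I \<subseteq> ?K"
        using L.join_left[of "pcompl (Arch_ob A) P" I] L.join_right[of "pcompl (Arch_ob A) P" I]
          I closed_ideal_pcompl unfolding Arch_ob_simps by blast+
      moreover have "a \<otimes> a \<in> I"
        using a by (simp add: I.I_l_closed)
      ultimately have "q \<in> ?K" "a \<otimes> a \<in> ?K"
        by auto
      then have "a \<otimes> a \<oplus> q \<in> ?K"
        by (rule_tac K.a_closed)
      moreover have "scal e \<preceq> a \<otimes> a \<oplus> q"
        unfolding eq using add_le[of "scal e" "scal e" \<zero> p] pq by simp
      ultimately have "?K = carrier A"
        using e by (intro eq_carrier_if_scal_le[OF K])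
      then have "P \<in> ?W"
        using P by (simp add: Arch_ob_simps well_inside_def top_Arch)
      then have "p \<in> ?G"
        using P arch_gen_superset[of "\<Union>?W"] by blast
      moreover have "a \<otimes> a \<preceq> scal e \<oplus> p"
        unfolding eq[symmetric] using add_le[of "a \<otimes> a" "a \<otimes> a" \<zero> q] pq by simp
      ultimately show "\<exists>i \<in> ?G. a \<otimes> a \<preceq> scal e \<oplus> i"
        by auto
    qed
  qed (use a in auto)
  ultimately show "I = \<Squnion>\<^bsub>Arch_ob A\<^esub>?W"
    unfolding sup_Arch[OF W] by auto
qed

lemma kr_frame_Arch_ob: "kr_frame (Arch_ob A)"
  by (intro kr_frame.intro kr_frame_axioms.intro frame_Arch_ob compact_Arch_ob regular_Arch_ob)

end


section \<open>The functors \<open>Arch\<close> and \<open>Ann\<close>\<close>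

locale bal_hom = source: bal A + target: bal A'
  for A :: "'a lalg" and A' :: "'b lalg" +
  fixes \<alpha> :: "'a \<Rightarrow> 'b"
  assumes hom: "\<alpha> \<in> lalg_hom A A'"
begin

lemma ring_hom: "\<alpha> \<in> ring_hom A A'"
  using hom unfolding lalg_hom_def by blast

lemma closed [simp]: "a \<in> carrier A \<Longrightarrow> \<alpha> a \<in> carrier A'"
  using ring_hom by (rule ring_hom_closed)

lemma hom_smult: "a \<in> carrier A \<Longrightarrow> \<alpha> (r \<odot>\<^bsub>A\<^esub> a) = r \<odot>\<^bsub>A'\<^esub> \<alpha> a"
  using hom unfolding lalg_hom_def by blast

lemma hom_join:
  "\<lbrakk>a \<in> carrier A; b \<in> carrier A\<rbrakk> \<Longrightarrow> \<alpha> (a \<squnion>\<^bsub>order_of A\<^esub> b) = \<alpha> a \<squnion>\<^bsub>order_of A'\<^esub> \<alpha> b"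
  using hom unfolding lalg_hom_def by blast

lemma hom_scal: "\<alpha> (source.scal r) = target.scal r"
  using ring_hom_one[OF ring_hom] by (simp add: hom_smult)

lemma hom_mono:
  assumes "a \<preceq>\<^bsub>A\<^esub> b" and [simp]: "a \<in> carrier A" "b \<in> carrier A"
  shows "\<alpha> a \<preceq>\<^bsub>A'\<^esub> \<alpha> b"
proof -
  have "a \<squnion>\<^bsub>order_of A\<^esub> b \<in> carrier A"
    using source.ord.join_closed[of a b] by simp
  moreover have "b \<preceq>\<^bsub>A\<^esub> a \<squnion>\<^bsub>order_of A\<^esub> b" "a \<squnion>\<^bsub>order_of A\<^esub> b \<preceq>\<^bsub>A\<^esub> b"
    using source.ord.join_right[of a b] source.ord.join_le[of a b b] assms by simp_all
  ultimately have "a \<squnion>\<^bsub>order_of A\<^esub> b = b"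
    by (intro source.le_antisym) auto
  then have "\<alpha> a \<squnion>\<^bsub>order_of A'\<^esub> \<alpha> b = \<alpha> b"
    by (simp flip: hom_join)
  then show ?thesis
    using target.ord.join_left[of "\<alpha> a" "\<alpha> b"] by simp
qed

text \<open>A homomorphism respects order, constants and squares, so it sends each witness of
  smallness in the preimage to a witness in \<open>K\<close>.\<close>

lemma preimage_closed_ideal:
  assumes K: "target.closed_ideal K"
  shows "source.closed_ideal {x \<in> carrier A. \<alpha> x \<in> K}"
  unfolding source.closed_ideal_def
proof (intro conjI ballI impI)
  interpret K: ideal K A' by (rule target.closed_ideal_ideal[OF K])
  show "ideal {x \<in> carrier A. \<alpha> x \<in> K} A"
    using ring_hom_zero[OF ring_hom source.ring_axioms target.ring_axioms]
    by (intro source.ideal_if_closed)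
       (auto simp: ring_hom_add[OF ring_hom] ring_hom_mult[OF ring_hom] K.I_l_closed)
  fix x
  assume x: "x \<in> carrier A" and small: "source.below {x \<in> carrier A. \<alpha> x \<in> K} (x \<otimes>\<^bsub>A\<^esub> x)"
  have "target.below K (\<alpha> x \<otimes>\<^bsub>A'\<^esub> \<alpha> x)"
  proof (rule target.belowI)
    fix e :: real
    assume "e > 0"
    then obtain i where i: "i \<in> carrier A" "\<alpha> i \<in> K"
      and le: "x \<otimes>\<^bsub>A\<^esub> x \<preceq>\<^bsub>A\<^esub> source.scal e \<oplus>\<^bsub>A\<^esub> i"
      using source.belowD[OF small] by auto
    have "\<alpha> (x \<otimes>\<^bsub>A\<^esub> x) \<preceq>\<^bsub>A'\<^esub> \<alpha> (source.scal e \<oplus>\<^bsub>A\<^esub> i)"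
      using x i by (intro hom_mono[OF le]) auto
    then have "\<alpha> x \<otimes>\<^bsub>A'\<^esub> \<alpha> x \<preceq>\<^bsub>A'\<^esub> target.scal e \<oplus>\<^bsub>A'\<^esub> \<alpha> i"
      using x i by (simp add: ring_hom_add[OF ring_hom] ring_hom_mult[OF ring_hom] hom_scal)
    then show "\<exists>i \<in> K. \<alpha> x \<otimes>\<^bsub>A'\<^esub> \<alpha> x \<preceq>\<^bsub>A'\<^esub> target.scal e \<oplus>\<^bsub>A'\<^esub> i"
      using i by auto
  qed
  then have "\<alpha> x \<in> K"
    by (rule target.closed_idealD[OF K]) (simp add: x)
  with x show "x \<in> {x \<in> carrier A. \<alpha> x \<in> K}"
    by simp
qed

lemma image_subset: "I \<subseteq> carrier A \<Longrightarrow> \<alpha> ` I \<subseteq> carrier A'"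
  by auto

text \<open>Generating from the image is left adjoint to taking preimages. Closedness of the
  preimage of \<open>K\<close> lets inclusions be tested on generators, which serves for joins and
  for composites.\<close>

lemma arch_gen_image_subset_iff:
  assumes K: "target.closed_ideal K" and S: "S \<subseteq> carrier A"
  shows "arch_gen A' (\<alpha> ` arch_gen A S) \<subseteq> K \<longleftrightarrow> \<alpha> ` S \<subseteq> K"
proof
  assume "\<alpha> ` S \<subseteq> K"
  then have "arch_gen A S \<subseteq> {x \<in> carrier A. \<alpha> x \<in> K}"
    using S by (intro source.arch_gen_least preimage_closed_ideal K) auto
  then show "arch_gen A' (\<alpha> ` arch_gen A S) \<subseteq> K"
    by (intro target.arch_gen_least K) auto
next
  assume "arch_gen A' (\<alpha> ` arch_gen A S) \<subseteq> K"
  then show "\<alpha> ` S \<subseteq> K"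
    using source.arch_gen_superset[of S] target.arch_gen_superset[of "\<alpha> ` arch_gen A S"] by blast
qed

lemma Arch_map_eq: "source.closed_ideal I \<Longrightarrow> Arch_map A A' \<alpha> I = arch_gen A' (\<alpha> ` I)"
  by (simp add: Arch_map_def source.arch_ideals_iff)

lemma arch_gen_image_closed: "I \<subseteq> carrier A \<Longrightarrow> target.closed_ideal (arch_gen A' (\<alpha> ` I))"
  by (intro target.arch_gen_closed image_subset)

lemma Arch_map_sup:
  assumes S: "S \<subseteq> carrier (Arch_ob A)"
  shows "Arch_map A A' \<alpha> (\<Squnion>\<^bsub>Arch_ob A\<^esub>S) = \<Squnion>\<^bsub>Arch_ob A'\<^esub>(Arch_map A A' \<alpha> ` S)"
proof -
  have US: "\<Union>S \<subseteq> carrier A"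
    by (rule source.Union_subset_carrier[OF S])
  have I: "source.closed_ideal I" if "I \<in> S" for I
    using S that by (auto simp: source.Arch_ob_simps subset_iff)
  have image: "Arch_map A A' \<alpha> ` S \<subseteq> carrier (Arch_ob A')"
    using I by (auto simp: target.Arch_ob_simps Arch_map_eq
        intro!: arch_gen_image_closed source.closed_ideal_mem)
  let ?M = "\<Squnion>\<^bsub>Arch_ob A'\<^esub>(Arch_map A A' \<alpha> ` S)"
  have M: "target.closed_ideal ?M"
    using target.L.sup_closed[OF image] by (simp add: target.Arch_ob_simps)
  have "arch_gen A' (\<alpha> ` arch_gen A (\<Union>S)) = ?M"
  proof
    have "\<alpha> ` I \<subseteq> ?M" if "I \<in> S" for I
    proof -
      have "Arch_map A A' \<alpha> I \<subseteq> ?M"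
        using target.L.sup_upper[OF image, of "Arch_map A A' \<alpha> I"] that
        by (simp add: target.Arch_ob_simps)
      then show ?thesis
        using target.arch_gen_superset[of "\<alpha> ` I"] I[OF that] by (auto simp: Arch_map_eq)
    qed
    then show "arch_gen A' (\<alpha> ` arch_gen A (\<Union>S)) \<subseteq> ?M"
      unfolding arch_gen_image_subset_iff[OF M US] by auto
    have gen: "target.closed_ideal (arch_gen A' (\<alpha> ` arch_gen A (\<Union>S)))"
      by (intro arch_gen_image_closed source.closed_ideal_subset source.arch_gen_closed US)
    have "arch_gen A' (\<alpha> ` I) \<subseteq> arch_gen A' (\<alpha> ` arch_gen A (\<Union>S))" if "I \<in> S" for I
      using that source.arch_gen_superset[of "\<Union>S"]
        target.arch_gen_superset[of "\<alpha> ` arch_gen A (\<Union>S)"]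
      by (intro target.arch_gen_least gen) blast
    then show "?M \<subseteq> arch_gen A' (\<alpha> ` arch_gen A (\<Union>S))"
      using target.L.sup_least[OF image, of "arch_gen A' (\<alpha> ` arch_gen A (\<Union>S))"] gen I
      by (auto simp: target.Arch_ob_simps Arch_map_eq)
  qed
  then show ?thesis
    by (simp add: source.sup_Arch[OF S] Arch_map_eq source.arch_gen_closed US)
qed

text \<open>\<open>\<alpha>\<close> commutes with products but not obviously with intersections.
  Images of products lie in \<open>?M\<close>, \<open>arch_gen_mult\<close> extends this to the
  generated ideals, and squares return from products to the intersection.\<close>

lemma Arch_map_meet:
  assumes I: "source.closed_ideal I" and J: "source.closed_ideal J"
  shows "Arch_map A A' \<alpha> (I \<inter> J) = Arch_map A A' \<alpha> I \<inter> Arch_map A A' \<alpha> J"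
proof -
  note subset = source.closed_ideal_subset[OF I] source.closed_ideal_subset[OF J]
  interpret I: ideal I A by (rule source.closed_ideal_ideal[OF I])
  interpret J: ideal J A by (rule source.closed_ideal_ideal[OF J])
  let ?M = "arch_gen A' (\<alpha> ` (I \<inter> J))"
  have M: "target.closed_ideal ?M"
    using subset by (intro arch_gen_image_closed) auto
  have "\<alpha> x \<otimes>\<^bsub>A'\<^esub> \<alpha> y \<in> ?M" if "x \<in> I" "y \<in> J" for x y
  proof -
    have "x \<otimes>\<^bsub>A\<^esub> y \<in> I \<inter> J"
      using that subset by (auto intro: I.I_r_closed J.I_l_closed)
    then have "\<alpha> (x \<otimes>\<^bsub>A\<^esub> y) \<in> ?M"
      by (intro target.arch_gen_superset[THEN subsetD] imageI)
    then show ?thesis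
      using that subset by (simp add: ring_hom_mult[OF ring_hom] subset_iff)
  qed
  then have "x \<otimes>\<^bsub>A'\<^esub> y \<in> ?M" if "x \<in> arch_gen A' (\<alpha> ` I)" "y \<in> arch_gen A' (\<alpha> ` J)" for x y
    using that subset by (rule_tac target.arch_gen_mult[OF M, of "\<alpha> ` I" "\<alpha> ` J"]) auto
  then have "arch_gen A' (\<alpha> ` I) \<inter> arch_gen A' (\<alpha> ` J) \<subseteq> ?M"
    using subset by (intro target.Int_subset_if_mult[OF M] target.closed_ideal_subset
        arch_gen_image_closed)
  moreover have "?M \<subseteq> arch_gen A' (\<alpha> ` K)" if "I \<inter> J \<subseteq> K" "K \<subseteq> carrier A" for K
    using that target.arch_gen_superset[of "\<alpha> ` K"]
    by (intro target.arch_gen_least arch_gen_image_closed) auto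
  ultimately show ?thesis
    using I J subset by (auto simp: Arch_map_eq source.closed_ideal_Int)
qed

lemma Arch_map_top: "Arch_map A A' \<alpha> (carrier A) = carrier A'"
proof -
  have "arch_gen A' (\<alpha> ` carrier A) \<subseteq> carrier A'"
    by (intro target.closed_ideal_subset arch_gen_image_closed) auto
  moreover have "\<one>\<^bsub>A'\<^esub> \<in> arch_gen A' (\<alpha> ` carrier A)"
    using target.arch_gen_superset[of "\<alpha> ` carrier A"] ring_hom_one[OF ring_hom]
    by (metis imageI source.one_closed subsetD)
  then have "arch_gen A' (\<alpha> ` carrier A) = carrier A'"
    by (intro ideal.one_imp_carrier target.closed_ideal_ideal arch_gen_image_closed) auto
  ultimately show ?thesis
    by (simp add: Arch_map_eq source.closed_ideal_carrier)
qed

lemma Arch_map_frame_hom: "Arch_map A A' \<alpha> \<in> frame_hom (Arch_ob A) (Arch_ob A')"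
  unfolding frame_hom_def
proof (intro CollectI conjI ballI allI impI)
  show closed: "Arch_map A A' \<alpha> \<in> carrier (Arch_ob A) \<rightarrow> carrier (Arch_ob A')"
    by (auto simp: source.Arch_ob_simps target.Arch_ob_simps Arch_map_eq
        intro!: arch_gen_image_closed dest: source.closed_ideal_mem)
  show "Arch_map A A' \<alpha> \<top>\<^bsub>Arch_ob A\<^esub> = \<top>\<^bsub>Arch_ob A'\<^esub>"
    by (simp add: source.top_Arch target.top_Arch Arch_map_top)
  fix I J
  assume IJ: "I \<in> carrier (Arch_ob A)" "J \<in> carrier (Arch_ob A)"
  then have "Arch_map A A' \<alpha> I \<in> carrier (Arch_ob A')" "Arch_map A A' \<alpha> J \<in> carrier (Arch_ob A')"
    using closed by auto
  with IJ show "Arch_map A A' \<alpha> (I \<sqinter>\<^bsub>Arch_ob A\<^esub> J) =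
      Arch_map A A' \<alpha> I \<sqinter>\<^bsub>Arch_ob A'\<^esub> Arch_map A A' \<alpha> J"
    by (simp add: source.Arch_ob_simps target.Arch_ob_simps source.meet_Arch target.meet_Arch
        Arch_map_meet)
qed (rule Arch_map_sup)

end

lemma (in bal) Arch_map_ident:
  assumes I: "closed_ideal I"
  shows "Arch_map A A (\<lambda>a \<in> carrier A. a) I = I"
proof -
  have "(\<lambda>a \<in> carrier A. a) ` I = I"
    using closed_ideal_subset[OF I] by auto
  then have "Arch_map A A (\<lambda>a \<in> carrier A. a) I = arch_gen A I"
    using I by (simp add: Arch_map_def arch_ideals_iff)
  then show ?thesis
    using I arch_gen_superset[of I] arch_gen_least[of I I] by auto
qed

section \<open>The category of bounded archimedean l-algebras and the functor
  \<open>Arch\<close>\<close>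

lemma BAL_simps:
  "P \<in> Ob BAL \<longleftrightarrow> bal P"
  "f \<in> Arr BAL P Q \<longleftrightarrow> f \<in> lalg_hom P Q \<and> f \<in> extensional (carrier P)"
  "Ident BAL P = (\<lambda>a \<in> carrier P. a)"
  "Comp BAL P Q R g f = compose (carrier P) g f"
  by (auto simp: BAL_def bal_def bal_axioms_def)

lemma bal_hom_iff: "bal_hom P Q f \<longleftrightarrow> bal P \<and> bal Q \<and> f \<in> lalg_hom P Q"
  by (auto simp: bal_hom_def bal_hom_axioms_def)

lemma bal_hom_compose:
  assumes "bal_hom A B \<alpha>" "bal_hom B C \<beta>"
  shows "bal_hom A C (compose (carrier A) \<beta> \<alpha>)"
proof -
  interpret f: bal_hom A B \<alpha> by fact
  interpret g: bal_hom B C \<beta> by fact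
  have join_closed: "a \<squnion>\<^bsub>order_of A\<^esub> b \<in> carrier A" "a \<sqinter>\<^bsub>order_of A\<^esub> b \<in> carrier A"
    if "a \<in> carrier A" "b \<in> carrier A" for a b
    using that f.source.ord.join_closed[of a b] f.source.ord.meet_closed[of a b] by simp_all
  have hom_meet: "\<alpha> (a \<sqinter>\<^bsub>order_of A\<^esub> b) = \<alpha> a \<sqinter>\<^bsub>order_of B\<^esub> \<alpha> b"
    if "a \<in> carrier A" "b \<in> carrier A" for a b
    using f.hom that unfolding lalg_hom_def by blast
  have hom_meet': "\<beta> (a \<sqinter>\<^bsub>order_of B\<^esub> b) = \<beta> a \<sqinter>\<^bsub>order_of C\<^esub> \<beta> b"
    if "a \<in> carrier B" "b \<in> carrier B" for a b
    using g.hom that unfolding lalg_hom_def by blast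
  have "compose (carrier A) \<beta> \<alpha> \<in> lalg_hom A C"
    unfolding lalg_hom_def
    by (auto simp: compose_eq join_closed hom_meet hom_meet' f.hom_join g.hom_join
        f.hom_smult g.hom_smult f.source.smult_real(1)
        ring_hom_add[OF f.ring_hom] ring_hom_add[OF g.ring_hom]
        ring_hom_mult[OF f.ring_hom] ring_hom_mult[OF g.ring_hom]
        ring_hom_one[OF f.ring_hom] ring_hom_one[OF g.ring_hom] intro!: ring_hom_memI)
  then show ?thesis
    by (simp add: bal_hom_iff f.source.bal_axioms g.target.bal_axioms)
qed

lemma ident_lalg_hom:
  assumes "bal A"
  shows "(\<lambda>a \<in> carrier A. a) \<in> lalg_hom A A"
proof -
  interpret bal A by fact
  have "a \<squnion>\<^bsub>order_of A\<^esub> b \<in> carrier A" "a \<sqinter>\<^bsub>order_of A\<^esub> b \<in> carrier A"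
    if "a \<in> carrier A" "b \<in> carrier A" for a b
    using that ord.join_closed[of a b] ord.meet_closed[of a b] by simp_all
  then show ?thesis
    by (auto simp: lalg_hom_def smult_real(1) intro!: ring_hom_memI)
qed

lemma BAL_category: "category BAL"
proof
  fix P :: "'a lalg"
  assume "P \<in> Ob BAL"
  then show "Ident BAL P \<in> Arr BAL P P"
    by (simp add: BAL_simps ident_lalg_hom)
next
  fix P Q R :: "'a lalg" and f g
  assume "P \<in> Ob BAL" "Q \<in> Ob BAL" "R \<in> Ob BAL" "f \<in> Arr BAL P Q" "g \<in> Arr BAL Q R"
  then show "Comp BAL P Q R g f \<in> Arr BAL P R"
    using bal_hom_compose[of P Q f R g] by (simp add: BAL_simps bal_hom_iff)
next
  fix P Q :: "'a lalg" and f
  assume *: "P \<in> Ob BAL" "Q \<in> Ob BAL" "f \<in> Arr BAL P Q"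
  then interpret bal_hom P Q f
    by (simp add: BAL_simps bal_hom_iff)
  have f: "f \<in> extensional (carrier P)"
    using * by (simp add: BAL_simps)
  show "Comp BAL P P Q f (Ident BAL P) = f"
    unfolding BAL_simps by (rule extensionalityI[OF _ f]) (auto simp: compose_def)
  show "Comp BAL P Q Q (Ident BAL Q) f = f"
    unfolding BAL_simps by (rule extensionalityI[OF _ f]) (auto simp: compose_def)
next
  fix N P Q R :: "'a lalg" and f g h
  assume "N \<in> Ob BAL" "P \<in> Ob BAL" "Q \<in> Ob BAL" "R \<in> Ob BAL"
    and "f \<in> Arr BAL N P" "g \<in> Arr BAL P Q" "h \<in> Arr BAL Q R"
  then have "f \<in> carrier N \<rightarrow> carrier P"
    by (auto simp: BAL_simps lalg_hom_def ring_hom_def)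
  then show "Comp BAL N Q R h (Comp BAL N P Q g f) = Comp BAL N P R (Comp BAL P Q R h g) f"
    unfolding BAL_simps by (rule compose_assoc)
qed

lemma Arch_map_extensional: "Arch_map A A' \<alpha> \<in> extensional (carrier (Arch_ob A))"
  by (simp add: Arch_map_def Arch_ob_def)

lemma Arch_map_compose:
  assumes "bal_hom A B \<alpha>" "bal_hom B C \<beta>"
  shows "Arch_map A C (compose (carrier A) \<beta> \<alpha>)
    = compose (carrier (Arch_ob A)) (Arch_map B C \<beta>) (Arch_map A B \<alpha>)"
proof -
  interpret f: bal_hom A B \<alpha> by fact
  interpret g: bal_hom B C \<beta> by fact
  interpret gf: bal_hom A C "compose (carrier A) \<beta> \<alpha>"
    using assms by (rule bal_hom_compose)
  have "Arch_map A C (compose (carrier A) \<beta> \<alpha>) I = Arch_map B C \<beta> (Arch_map A B \<alpha> I)"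
    if I: "f.source.closed_ideal I" for I
  proof -
    note subset = f.source.closed_ideal_subset[OF I]
    have image: "compose (carrier A) \<beta> \<alpha> ` I = \<beta> ` \<alpha> ` I"
      using subset by (force simp: compose_def)
    have "arch_gen C (\<beta> ` \<alpha> ` I) = arch_gen C (\<beta> ` arch_gen B (\<alpha> ` I))"
    proof
      have "g.target.closed_ideal (arch_gen C (\<beta> ` arch_gen B (\<alpha> ` I)))"
        by (intro g.arch_gen_image_closed f.target.closed_ideal_subset f.arch_gen_image_closed subset)
      then show "arch_gen C (\<beta> ` \<alpha> ` I) \<subseteq> arch_gen C (\<beta> ` arch_gen B (\<alpha> ` I))"
        using f.target.arch_gen_superset[of "\<alpha> ` I"]
          g.target.arch_gen_superset[of "\<beta> ` arch_gen B (\<alpha> ` I)"]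
        by (intro g.target.arch_gen_least) blast+
      have "\<alpha> ` I \<subseteq> carrier B"
        using subset by auto
      then show "arch_gen C (\<beta> ` arch_gen B (\<alpha> ` I)) \<subseteq> arch_gen C (\<beta> ` \<alpha> ` I)"
        using g.target.arch_gen_superset[of "\<beta> ` \<alpha> ` I"]
        by (subst g.arch_gen_image_subset_iff) (auto intro: g.arch_gen_image_closed)
    qed
    then show ?thesis
      using I by (simp add: f.Arch_map_eq g.Arch_map_eq gf.Arch_map_eq image f.arch_gen_image_closed subset)
  qed
  then show ?thesis
    by (intro extensionalityI[of _ "carrier (Arch_ob A)"])
       (simp_all add: Arch_map_extensional compose_eq f.source.Arch_ob_simps)
qed

lemma Arch_functor: "covariant_functor BAL KRFrm Arch"
  unfolding covariant_functor_def covariant_functor_axioms_def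
proof (intro conjI BAL_category KRFrm_category allI impI)
  fix P :: "'a lalg"
  assume "P \<in> Ob BAL"
  then interpret bal P
    by (simp add: BAL_simps)
  show "omap Arch P \<in> Ob KRFrm"
    by (simp add: Arch_def KRFrm_simps kr_frame_Arch_ob)
  have "Arch_map P P (\<lambda>a \<in> carrier P. a) = (\<lambda>I \<in> carrier (Arch_ob P). I)"
    by (intro extensionalityI[of _ "carrier (Arch_ob P)"])
       (simp_all add: Arch_map_extensional Arch_ob_simps Arch_map_ident)
  then show "amap Arch P P (Ident BAL P) = Ident KRFrm (omap Arch P)"
    by (simp add: Arch_def BAL_simps KRFrm_simps)
next
  fix P Q :: "'a lalg" and f
  assume "P \<in> Ob BAL" "Q \<in> Ob BAL" "f \<in> Arr BAL P Q"
  then interpret bal_hom P Q f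
    by (simp add: BAL_simps bal_hom_iff)
  show "amap Arch P Q f \<in> Arr KRFrm (omap Arch P) (omap Arch Q)"
    using Arch_map_frame_hom by (simp add: Arch_def KRFrm_simps Arch_map_extensional)
next
  fix P Q R :: "'a lalg" and f g
  assume "P \<in> Ob BAL" "Q \<in> Ob BAL" "R \<in> Ob BAL" "f \<in> Arr BAL P Q" "g \<in> Arr BAL Q R"
  then show "amap Arch P R (Comp BAL P Q R g f) =
      Comp KRFrm (omap Arch P) (omap Arch Q) (omap Arch R) (amap Arch Q R g) (amap Arch P Q f)"
    using Arch_map_compose[of P Q f R g]
    by (simp add: BAL_simps KRFrm_simps bal_hom_iff Arch_def)
qed

section \<open>\<open>Ann\<close> as the composite of \<open>Arch\<close> and the
  booleanization\<close>

lemma (in bal) Ann_ob_eq: "Ann_ob A = booleanization (Arch_ob A)"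
  unfolding Ann_ob_def booleanization_def
  by (simp add: ann_ideals_eq Arch_ob_def[of A] well_inside_def top_Arch[unfolded Arch_ob_def])

lemma (in bal) Ann_map_eq:
  "Ann_map A A' \<alpha> = booleanization_map (Arch_ob A) (Arch_ob A') (Arch_map A A' \<alpha>)"
  by (simp add: Ann_map_def booleanization_map_def ann_ideals_eq)

lemma functor_comp_functor:
  assumes "covariant_functor C D F" "covariant_functor D E G"
  shows "covariant_functor C E (G \<circ>\<^sub>F F)"
proof -
  interpret F: covariant_functor C D F by fact
  interpret G: covariant_functor D E G by fact
  show ?thesis
    by unfold_locales
       (simp_all add: functor_comp_def F.omap_ob F.amap_arr F.amap_ident F.amap_comp
         G.omap_ob G.amap_arr G.amap_ident G.amap_comp)
qed

text \<open>\<open>functor_eq_on\<close> compares the data only at objects and arrows of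
  \<open>C\<close>, so the functor laws are carried over one by one, using that identities and
  composites are arrows.\<close>

lemma functor_cong:
  assumes "covariant_functor C E G" "functor_eq_on C F G"
  shows "covariant_functor C E F"
proof -
  interpret G: covariant_functor C E G by fact
  have ob: "omap F P = omap G P" if "P \<in> Ob C" for P
    using assms(2) that by (auto simp: functor_eq_on_def)
  have arr: "amap F P Q f = amap G P Q f" if "P \<in> Ob C" "Q \<in> Ob C" "f \<in> Arr C P Q" for P Q f
    using assms(2) that by (auto simp: functor_eq_on_def)
  show ?thesis
    by unfold_locales
       (simp_all add: ob arr G.source.ident_arr G.source.comp_arr G.omap_ob G.amap_arr
         G.amap_ident G.amap_comp)
qed

lemma Ann_eq: "functor_eq_on BAL Ann (Booleanization \<circ>\<^sub>F Arch)"
  unfolding functor_eq_on_def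
  by (auto simp: BAL_simps functor_comp_def Ann_def Booleanization_def Arch_def
      bal.Ann_ob_eq bal.Ann_map_eq)

theorem theorem3p12:
  shows "covariant_functor (BAL :: ('a lalg, 'a \<Rightarrow> 'a) cat)
           (DeV :: ('a set dv, 'a set \<Rightarrow> 'a set) cat) Ann
       \<and> commuting_triangle (BAL :: ('a lalg, 'a \<Rightarrow> 'a) cat)
           (KRFrm :: ('a set gorder, 'a set \<Rightarrow> 'a set) cat)
           (DeV :: ('a set dv, 'a set \<Rightarrow> 'a set) cat) Arch Booleanization Ann"
proof -
  have "covariant_functor (BAL :: ('a lalg, 'a \<Rightarrow> 'a) cat)
      (DeV :: ('a set dv, 'a set \<Rightarrow> 'a set) cat) Ann"
    using functor_comp_functor[OF Arch_functor Booleanization_functor] Ann_eq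
    by (rule functor_cong)
  then show ?thesis
    by (simp add: commuting_triangle_def Arch_functor Booleanization_functor Ann_eq)
qed

end
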